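(* Let $n$ and $h$ be positive integers and put $m=\operatorname{lcm}(n,h)$. Let $u$ be the largest divisor of $n$ which is self-conjugate modulo $m$, and write $u=w^2k$ where $k$ is the square-free part of $u$. Let $t$ and $r$ be the numbers of distinct prime divisors of $h$ and $k$, respectively. Suppose a $\mathrm{BH}(\mathbb{Z}_n,h)$ matrix exists. Then: (a) if $k$ is odd, $w\leq 2^{t-r-1+\delta_{rt}}\gcd(h,u)\sqrt{k/\varphi(k)}$; (b) if $k$ is even, $w\leq 2^{t-r-1}\gcd(h,u)\sqrt{2k/\varphi(k)}$.
   Context: For a finite abelian group $(G,+)$ and a positive integer $h$, a $\mathrm{BH}(G,h)$ matrix is a $|G|\times|G|$ matrix $H=(a_{g,k})_{g,k\in G}$ whose entries are complex $h$th roots of unity, which is $G$-invariant (i.e. $a_{g+l,k+l}=a_{g,k}$ for all $g,k,l\in G$), and satisfies $HH^*=|G|I$. $\mathbb{Z}_n$ is the cyclic group of order $n$. A prime $p$ is self-conjugate modulo $N$ if, writing $N=p^aN'$ with $\gcd(p,N')=1$, there is an integer $j$ with $p^j\equiv -1\pmod{N'}$; a positive integer is self-conjugate modulo $N$ if every prime divisor of it is (so $1$ qualifies). The square-free part of an integer $x$ is the product of all primes $p$ for which $\nu_p(x)$ is odd. $\varphi$ is Euler's function, and $\delta_{rt}=1$ if $r=t$ and $0$ otherwise. *)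

theory Defs
  imports
    "HOL-Analysis.Analysis"
    "HOL-Algebra.Elementary_Groups"
    "HOL-Number_Theory.Number_Theory"
    "HOL-Computational_Algebra.Squarefree"
begin

text \<open>The group is written multiplicatively as in HOL-Algebra, so the invariance
  $a_{g+l,k+l} = a_{g,k}$ becomes \<open>H (g \<otimes> l) (k \<otimes> l) = H g k\<close>.  Matrices indexed by the
  group are functions of which only the values on the carrier matter.\<close>

definition is_BH :: "('a, 'b) monoid_scheme \<Rightarrow> nat \<Rightarrow> ('a \<Rightarrow> 'a \<Rightarrow> complex) \<Rightarrow> bool" where
  "is_BH G h H \<longleftrightarrow>
     comm_group G \<and> finite (carrier G) \<and> h > 0 \<and>
     (\<forall>g\<in>carrier G. \<forall>k\<in>carrier G. H g k ^ h = 1) \<and>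
     (\<forall>g\<in>carrier G. \<forall>k\<in>carrier G. \<forall>l\<in>carrier G.
        H (g \<otimes>\<^bsub>G\<^esub> l) (k \<otimes>\<^bsub>G\<^esub> l) = H g k) \<and>
     (\<forall>g\<in>carrier G. \<forall>k\<in>carrier G.
        (\<Sum>l\<in>carrier G. H g l * cnj (H k l)) = (if g = k then of_nat (order G) else 0))"

text \<open>The exponent \<open>j\<close> may be taken to be a natural number, since \<open>p\<close> has finite
  multiplicative order modulo \<open>N'\<close>.\<close>

definition self_conjugate_prime :: "nat \<Rightarrow> nat \<Rightarrow> bool" where
  "self_conjugate_prime p N \<longleftrightarrow>
     prime p \<and>
     (\<exists>a N'. N = p ^ a * N' \<and> coprime p N' \<and> (\<exists>j::nat. [int p ^ j = -1] (mod int N')))"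

definition self_conjugate :: "nat \<Rightarrow> nat \<Rightarrow> bool" where
  "self_conjugate d N \<longleftrightarrow> d > 0 \<and> (\<forall>p. prime p \<and> p dvd d \<longrightarrow> self_conjugate_prime p N)"

text \<open>The library's \<^const>\<open>squarefree_part\<close> is the product of the primes of odd multiplicity.\<close>

lemma squarefree_part_eq_prod_odd_primes:
  fixes x :: nat
  assumes "x > 0"
  shows "squarefree_part x = \<Prod>{p. prime p \<and> odd (multiplicity p x)}"
proof -
  let ?P = "prime_factors x"
  have sub: "{p. prime p \<and> odd (multiplicity p x)} = {p\<in>?P. odd (multiplicity p x)}"
    using assms by (auto simp: prime_factors_multiplicity intro: Nat.gr0I)
  have "x = (\<Prod>p\<in>?P. p ^ multiplicity p x)"
    using assms by (simp add: prime_factorization_nat)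
  also have "\<dots> = (\<Prod>p\<in>?P. p ^ (multiplicity p x mod 2) * (p ^ (multiplicity p x div 2))\<^sup>2)"
    by (intro prod.cong refl)
       (simp only: power_mult [symmetric] power_add [symmetric] mod_div_mult_eq)
  also have "\<dots> = (\<Prod>p\<in>?P. p ^ (multiplicity p x mod 2)) * square_part x ^ 2"
    using assms by (simp add: prod.distrib prod_power_distrib square_part_def)
  also have "(\<Prod>p\<in>?P. p ^ (multiplicity p x mod 2)) =
      (\<Prod>p\<in>?P. if odd (multiplicity p x) then p else 1)"
    by (intro prod.cong refl) (auto simp: odd_iff_mod_2_eq_one even_iff_mod_2_eq_zero)
  also have "\<dots> = \<Prod>{p. prime p \<and> odd (multiplicity p x)}"
    unfolding sub by (subst prod.inter_filter) auto
  finally have "x = \<Prod>{p. prime p \<and> odd (multiplicity p x)} * square_part x ^ 2" .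
  moreover have "x = squarefree_part x * square_part x ^ 2"
    by (rule squarefree_decompose)
  moreover have "square_part x ^ 2 \<noteq> 0"
    using assms by simp
  ultimately show ?thesis
    by (metis mult_right_cancel)
qed

end

theory Submission
  imports Defs "Jordan_Normal_Form.Char_Poly"
begin

text \<open>The first row \<open>b\<close> of a \<open>BH(Z\<^sub>n, h)\<close> matrix has character sums of squared modulus \<open>n\<close>. If \<open>p\<close> is
  self-conjugate modulo \<open>m\<close>, complex conjugation is a power of the Frobenius map modulo the primes above
  \<open>p\<close> in \<open>Z[\<zeta>\<^sub>m]\<close>, so these sums are divisible by the square root of the \<open>p\<close>-part of \<open>n\<close>. Writing
  \<open>n = u v\<close>, Fourier inversion over the part of order \<open>v\<close> shows that each
  \<open>\<Sum>\<^bsub>c<u\<^esub> b(y + v c) \<zeta>\<^sub>u\<^sup>c\<close> is divisible by a generator \<open>\<theta>\<close> of this square root, where \<open>\<theta>\<close> lies in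
  \<open>Z[\<zeta>\<^sub>q]\<close> for the odd part \<open>q\<close> of \<open>k\<close> and \<open>\<theta> \<cdot> cnj \<theta>\<close> is associated to \<open>w\<^sup>2 q\<close>. After multiplication by
  \<open>\<Prod>(1 - \<zeta>\<^sub>p)\<close> over the primes \<open>p\<close> not dividing \<open>q\<close>, a suitable coefficient over \<open>Z[\<zeta>\<^sub>q]\<close> is a nonzero
  multiple of \<open>\<theta>\<close> in \<open>Z[\<zeta>\<^sub>q]\<close> with integer coordinates bounded by \<open>2\<^sup>s gcd(h, u)\<close>. The
  arithmetic-geometric mean inequality for its conjugates and Parseval's identity give the bound. A
  self-conjugate prime divisor of \<open>n\<close> not dividing \<open>h\<close> would force \<open>b\<close> to be periodic along the
  \<open>p\<close>-part, making all these sums vanish.\<close>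

text \<open>Two obstacles shape the proof. Galois conjugates are needed throughout, while elements
  are plain complex numbers; so an element is carried by an integer polynomial \<open>P\<close>, its
  conjugates being \<open>ev P (z ^ s)\<close>. Secondly, size and divisibility live in different
  places: small coefficients belong to a polynomial modulo x^m - 1, but divisibility by theta is
  known only at primitive m-th roots. Projecting to Z[zeta_q] averages over the powers z^(1 + q i),
  and not all of these are primitive. The factors 1 - x^(m/p) are inserted because their product
  vanishes exactly at the non-primitive ones; each costs at most a factor 2. Primes of
  \<open>m\<close> outside \<open>lcm u h\<close> cost nothing, since the projection discards their
  second term. As every prime of \<open>u\<close> divides \<open>h\<close>, there remain the primes
  of \<open>h\<close> outside \<open>q\<close>; one of them is free because the initial coefficients
  are nonnegative, hence the -1 in the exponent. If none remains, nothing can be saved, hence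
  delta_rt. The prime 2 is special: it is unramified in Z[zeta_q] for odd q, so theta has to round
  odd exponents of 2 down, and this separates (b) from (a).\<close>

section \<open>The rings Z[z] and divisibility in them\<close>

definition ev :: "int poly \<Rightarrow> complex \<Rightarrow> complex" where
  "ev P z = poly (map_poly of_int P) z"

definition int_adjoin :: "complex \<Rightarrow> complex set" where
  "int_adjoin z = range (\<lambda>P. ev P z)"

text \<open>The ring is a parameter because divisibilities proved in a small cyclotomic ring are
  used in larger ones (\<open>rdvd_mono\<close>); the way back down is not automatic and is the
  purpose of the projections below.\<close>

definition rdvd :: "complex \<Rightarrow> complex \<Rightarrow> complex \<Rightarrow> bool" where
  "rdvd z a b \<longleftrightarrow> (\<exists>c\<in>int_adjoin z. b = a * c)"

lemma ev_0 [simp]: "ev 0 z = 0" and ev_1 [simp]: "ev 1 z = 1"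
  and ev_add [simp]: "ev (P + Q) z = ev P z + ev Q z"
  and ev_diff [simp]: "ev (P - Q) z = ev P z - ev Q z"
  and ev_uminus [simp]: "ev (- P) z = - ev P z"
  and ev_mult [simp]: "ev (P * Q) z = ev P z * ev Q z"
  and ev_power [simp]: "ev (P ^ n) z = ev P z ^ n"
  by (simp_all add: ev_def hom_distribs)

lemma ev_pCons [simp]: "ev (pCons a P) z = of_int a + z * ev P z"
  by (simp add: ev_def hom_distribs)

lemma ev_monom [simp]: "ev (Polynomial.monom a n) z = of_int a * z ^ n"
  by (simp add: ev_def map_poly_monom poly_monom)

lemma ev_sum [simp]: "ev (sum f A) z = (\<Sum>x\<in>A. ev (f x) z)"
  by (induction A rule: infinite_finite_induct) auto

lemma ev_prod [simp]: "ev (prod f A) z = (\<Prod>x\<in>A. ev (f x) z)"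
  by (induction A rule: infinite_finite_induct) auto

lemma ev_pcompose [simp]: "ev (pcompose P Q) z = ev P (ev Q z)"
  by (induction P) (simp_all add: pcompose_pCons)

lemma cnj_ev: "cnj (ev P z) = ev P (cnj z)"
  by (induction P) auto

lemma ev_coeff_sum: "ev P z = (\<Sum>k\<le>degree P. of_int (Polynomial.coeff P k) * z ^ k)"
  unfolding ev_def by (subst poly_altdef) simp

lemma ev_in_int_adjoin [simp, intro]: "ev P z \<in> int_adjoin z"
  by (simp add: int_adjoin_def)

lemma int_adjoinE:
  assumes "x \<in> int_adjoin z"
  obtains P where "x = ev P z"
  using assms by (auto simp: int_adjoin_def)

lemma int_adjoin_of_int [simp, intro]: "of_int a \<in> int_adjoin z"
  using ev_in_int_adjoin [of "[:a:]" z] by simp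

lemma int_adjoin_of_nat [simp, intro]: "of_nat a \<in> int_adjoin z"
  using int_adjoin_of_int [of "int a" z] by simp

lemma int_adjoin_0 [simp, intro]: "0 \<in> int_adjoin z"
  and int_adjoin_1 [simp, intro]: "1 \<in> int_adjoin z"
  using int_adjoin_of_int [of 0 z] int_adjoin_of_int [of 1 z] by simp_all

lemma int_adjoin_self [simp, intro]: "z \<in> int_adjoin z"
  using ev_in_int_adjoin [of "[:0, 1:]" z] by simp

lemma int_adjoin_add [intro]: "x \<in> int_adjoin z \<Longrightarrow> y \<in> int_adjoin z \<Longrightarrow> x + y \<in> int_adjoin z"
  by (metis ev_add ev_in_int_adjoin int_adjoinE)

lemma int_adjoin_diff [intro]: "x \<in> int_adjoin z \<Longrightarrow> y \<in> int_adjoin z \<Longrightarrow> x - y \<in> int_adjoin z"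
  by (metis ev_diff ev_in_int_adjoin int_adjoinE)

lemma int_adjoin_uminus [intro]: "x \<in> int_adjoin z \<Longrightarrow> - x \<in> int_adjoin z"
  by (metis ev_uminus ev_in_int_adjoin int_adjoinE)

lemma int_adjoin_mult [intro]: "x \<in> int_adjoin z \<Longrightarrow> y \<in> int_adjoin z \<Longrightarrow> x * y \<in> int_adjoin z"
  by (metis ev_mult ev_in_int_adjoin int_adjoinE)

lemma int_adjoin_power [intro]: "x \<in> int_adjoin z \<Longrightarrow> x ^ n \<in> int_adjoin z"
  by (metis ev_power ev_in_int_adjoin int_adjoinE)

lemma int_adjoin_sum [intro]: "(\<And>i. i \<in> A \<Longrightarrow> f i \<in> int_adjoin z) \<Longrightarrow> sum f A \<in> int_adjoin z"
  by (induction A rule: infinite_finite_induct) auto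

lemma int_adjoin_prod [intro]: "(\<And>i. i \<in> A \<Longrightarrow> f i \<in> int_adjoin z) \<Longrightarrow> prod f A \<in> int_adjoin z"
  by (induction A rule: infinite_finite_induct) auto

lemma ev_mem_int_adjoin: "w \<in> int_adjoin z \<Longrightarrow> ev P w \<in> int_adjoin z"
  by (metis ev_pcompose ev_in_int_adjoin int_adjoinE)

lemma int_adjoin_mono: "w \<in> int_adjoin z \<Longrightarrow> int_adjoin w \<subseteq> int_adjoin z"
  using ev_mem_int_adjoin by (auto elim!: int_adjoinE)

lemma rdvdI: "c \<in> int_adjoin z \<Longrightarrow> b = a * c \<Longrightarrow> rdvd z a b"
  by (auto simp: rdvd_def)

lemma rdvdE:
  assumes "rdvd z a b"
  obtains c where "c \<in> int_adjoin z" "b = a * c"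
  using assms by (auto simp: rdvd_def)

lemma rdvd_refl [simp, intro]: "rdvd z a a"
  by (rule rdvdI [of 1]) auto

lemma rdvd_0 [simp, intro]: "rdvd z a 0"
  by (rule rdvdI [of 0]) auto

lemma rdvd_trans: "rdvd z a b \<Longrightarrow> rdvd z b c \<Longrightarrow> rdvd z a c"
  unfolding rdvd_def by (metis int_adjoin_mult mult.assoc)

lemma rdvd_add: "rdvd z a b \<Longrightarrow> rdvd z a c \<Longrightarrow> rdvd z a (b + c)"
  unfolding rdvd_def by (metis int_adjoin_add distrib_left)

lemma rdvd_diff: "rdvd z a b \<Longrightarrow> rdvd z a c \<Longrightarrow> rdvd z a (b - c)"
  unfolding rdvd_def by (metis int_adjoin_diff right_diff_distrib)

lemma rdvd_minus_commute: "rdvd z a (b - c) \<Longrightarrow> rdvd z a (c - b)"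
  using rdvd_diff [of z a 0 "b - c"] by simp

lemma rdvd_mult_right: "rdvd z a b \<Longrightarrow> c \<in> int_adjoin z \<Longrightarrow> rdvd z a (b * c)"
  unfolding rdvd_def by (metis int_adjoin_mult mult.assoc)

lemma rdvd_mult_left: "rdvd z a b \<Longrightarrow> c \<in> int_adjoin z \<Longrightarrow> rdvd z a (c * b)"
  using rdvd_mult_right [of z a b c] by (simp add: mult.commute)

lemma rdvd_sum: "(\<And>i. i \<in> A \<Longrightarrow> rdvd z a (f i)) \<Longrightarrow> rdvd z a (sum f A)"
  by (induction A rule: infinite_finite_induct) (auto intro: rdvd_add)

lemma rdvd_mult: "rdvd z a b \<Longrightarrow> rdvd z c d \<Longrightarrow> rdvd z (a * c) (b * d)"
  unfolding rdvd_def by (metis (no_types, lifting) int_adjoin_mult mult.assoc mult.left_commute)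

lemma rdvd_power: "rdvd z a b \<Longrightarrow> rdvd z (a ^ n) (b ^ n)"
  by (induction n) (auto intro: rdvd_mult)

lemma rdvd_prod: "(\<And>i. i \<in> A \<Longrightarrow> rdvd z (f i) (g i)) \<Longrightarrow> rdvd z (prod f A) (prod g A)"
  by (induction A rule: infinite_finite_induct) (auto intro: rdvd_mult)

lemma rdvd_mono: "rdvd w a b \<Longrightarrow> w \<in> int_adjoin z \<Longrightarrow> rdvd z a b"
  using int_adjoin_mono by (auto simp: rdvd_def)

lemma rdvd_cong_mult:
  assumes "rdvd z q (a - b)" "rdvd z q (c - d)" "b \<in> int_adjoin z" "c \<in> int_adjoin z"
  shows "rdvd z q (a * c - b * d)"
proof -
  have "a * c - b * d = (a - b) * c + b * (c - d)" by (simp add: algebra_simps)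
  thus ?thesis using assms by (simp add: rdvd_add rdvd_mult_right rdvd_mult_left)
qed

lemma rdvd_cong_power:
  assumes "rdvd z q (a - b)" "a \<in> int_adjoin z" "b \<in> int_adjoin z"
  shows "rdvd z q (a ^ n - b ^ n)"
  by (induction n) (use assms in \<open>auto intro!: rdvd_cong_mult\<close>)

lemma rdvd_cong_ev:
  assumes "rdvd z q (a - b)" "a \<in> int_adjoin z" "b \<in> int_adjoin z"
  shows "rdvd z q (ev P a - ev P b)"
proof (induction P)
  case (pCons c P)
  have "rdvd z q (a * ev P a - b * ev P b)"
    using pCons assms by (intro rdvd_cong_mult) (auto intro: ev_mem_int_adjoin)
  thus ?case by simp
qed auto

lemma rdvd_cong_trans: "rdvd z q (a - b) \<Longrightarrow> rdvd z q (b - c) \<Longrightarrow> rdvd z q (a - c)"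
  using rdvd_add [of z q "a - b" "b - c"] by simp

section \<open>Integrality in Z[z] for a root of unity z\<close>

lemma root_of_unity_power_mod:
  fixes z :: complex
  assumes "z ^ m = 1"
  shows "z ^ (k mod m) = z ^ k"
proof -
  have "z ^ k = z ^ (m * (k div m) + k mod m)" by (simp only: mult_div_mod_eq)
  also have "\<dots> = z ^ (k mod m)" by (simp only: power_add power_mult assms power_one mult_1_left)
  finally show ?thesis by simp
qed

lemma int_adjoin_expand:
  assumes "z ^ m = 1" "m > 0" "x \<in> int_adjoin z"
  shows "\<exists>c :: nat \<Rightarrow> int. x = (\<Sum>j<m. of_int (c j) * z ^ j)"
proof -
  obtain P where P: "x = ev P z" using assms(3) by (rule int_adjoinE)
  obtain k where k: "m = Suc k" using assms(2) by (cases m) auto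
  have "\<exists>c :: nat \<Rightarrow> int. ev P z = (\<Sum>j<m. of_int (c j) * z ^ j)"
  proof (induction P)
    case 0
    show ?case by (rule exI [of _ "\<lambda>_. 0"]) simp
  next
    case (pCons a P)
    then obtain c :: "nat \<Rightarrow> int" where c: "ev P z = (\<Sum>j<m. of_int (c j) * z ^ j)" by blast
    \<comment> \<open>Multiplication by \<open>z\<close> shifts the coefficients; the top one wraps
      around to the constant term because z^m = 1.\<close>
    define d where "d = (\<lambda>j. if j = 0 then a + c k else c (j - 1))"
    have "z * ev P z = (\<Sum>j<k. of_int (c j) * z ^ Suc j) + of_int (c k) * z ^ Suc k"
      by (simp add: c k sum_distrib_left algebra_simps)
    also have "z ^ Suc k = 1" using assms k by simp
    finally have "of_int a + z * ev P z = (\<Sum>j<m. of_int (d j) * z ^ j)"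
      unfolding k sum.lessThan_Suc_shift by (simp add: d_def)
    thus ?case by (intro exI [of _ d]) simp
  qed
  thus ?thesis by (simp add: P)
qed

text \<open>Multiplication by \<open>x\<close> acts on \<open>1, z, \<dots>, z\<^bsup>m-1\<^esup>\<close> through an integer matrix, whose
  characteristic polynomial is monic and vanishes at \<open>x\<close>.\<close>

lemma algebraic_int_int_adjoin:
  assumes z: "z ^ m = 1" "m > 0" and x: "x \<in> int_adjoin z"
  shows "algebraic_int x"
proof -
  have "\<forall>i. \<exists>c :: nat \<Rightarrow> int. x * z ^ i = (\<Sum>j<m. of_int (c j) * z ^ j)"
    using z x by (intro allI int_adjoin_expand) auto
  then obtain c :: "nat \<Rightarrow> nat \<Rightarrow> int" where c: "\<And>i. x * z ^ i = (\<Sum>j<m. of_int (c i j) * z ^ j)"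
    by metis
  define A where "A = mat m m (\<lambda>(i, j). c i j)"
  define v where "v = Matrix.vec m (\<lambda>j. z ^ j)"
  have A: "A \<in> carrier_mat m m" by (simp add: A_def)
  let ?B = "map_mat complex_of_int A"
  have B: "?B \<in> carrier_mat m m" using A by simp
  have "?B *\<^sub>v v = x \<cdot>\<^sub>v v"
    by (rule eq_vecI) (auto simp: A_def v_def scalar_prod_def c row_def atLeast0LessThan)
  moreover have "v \<noteq> 0\<^sub>v m"
  proof
    assume "v = 0\<^sub>v m"
    hence "vec_index v 0 = vec_index (0\<^sub>v m) 0" by simp
    thus False using z(2) by (simp add: v_def)
  qed
  ultimately have "eigenvalue ?B x"
    unfolding eigenvalue_def eigenvector_def using A by (intro exI [of _ v]) (auto simp: v_def)
  hence "poly (char_poly ?B) x = 0" using eigenvalue_root_char_poly [OF B] by simp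
  hence "poly (map_poly of_int (char_poly A)) x = 0"
    by (subst (asm) of_int_hom.char_poly_hom [OF A])
  moreover have "lead_coeff (char_poly A) = 1"
    using degree_monic_char_poly [OF A] by simp
  ultimately show ?thesis
    unfolding algebraic_int_altdef_ipoly by blast
qed

lemma rational_int_adjoin:
  assumes "z ^ m = 1" "m > 0" "x \<in> int_adjoin z" "x \<in> \<rat>"
  shows "x \<in> \<int>"
  using rational_algebraic_int_is_int [OF algebraic_int_int_adjoin [OF assms(1-3)] assms(4)] .

text \<open>The quotient is rational and an algebraic integer, hence an integer. Divisibilities in
  Z[z] are turned back into arithmetic through this.\<close>

lemma rdvd_of_int_iff:
  assumes "z ^ m = 1" "m > 0"
  shows "rdvd z (of_int a) (of_int b) \<longleftrightarrow> a dvd b"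
proof
  assume "rdvd z (of_int a) (of_int b)"
  then obtain c where c: "c \<in> int_adjoin z" "of_int b = of_int a * c" by (rule rdvdE)
  show "a dvd b"
  proof (cases "a = 0")
    case False
    have "c = of_int b / of_int a" using c(2) False by simp
    hence "c \<in> \<rat>" by simp
    with rational_int_adjoin [OF assms c(1)] obtain d where "c = of_int d" by (auto elim: Ints_cases)
    hence "(of_int b :: complex) = of_int (a * d)" using c(2) by simp
    thus ?thesis by (metis dvd_triv_left of_int_eq_iff)
  qed (use c in auto)
next
  assume "a dvd b"
  then obtain d where "b = a * d" by (elim dvdE)
  thus "rdvd z (of_int a) (of_int b)" by (intro rdvdI [of "of_int d"]) auto
qed

text \<open>In an integer equation for \<open>x\<close> the constant term is a multiple of
  \<open>x\<close>; if it is zero, one factor \<open>x\<close> can be cancelled and the degree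
  drops. This replaces the norm before norms are available.\<close>

lemma int_adjoin_divides_int:
  assumes "z ^ m = 1" "m > 0" "x \<in> int_adjoin z" "x \<noteq> 0"
  shows "\<exists>c::int. c \<noteq> 0 \<and> rdvd z x (of_int c)"
proof -
  obtain p :: "int poly" where p: "ev p x = 0" "lead_coeff p = 1"
    using algebraic_int_int_adjoin [OF assms(1-3)] unfolding algebraic_int_altdef_ipoly ev_def by blast
  have "p \<noteq> 0 \<Longrightarrow> ev p x = 0 \<Longrightarrow> ?thesis" for p
  proof (induction p)
    case (pCons a p)
    show ?case
    proof (cases "a = 0")
      case True
      thus ?thesis using pCons assms by auto
    next
      case False
      have "rdvd z x (of_int (-a))"
        using pCons.prems(2) assms(3)
        by (intro rdvdI [of "ev p x"]) (auto intro: ev_mem_int_adjoin simp: add_eq_0_iff)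
      thus ?thesis using False by (metis neg_equal_0_iff_equal)
    qed
  qed auto
  moreover have "p \<noteq> 0" using p(2) by auto
  ultimately show ?thesis using p by blast
qed

section \<open>Frobenius congruences\<close>

lemma freshman_dream:
  assumes p: "prime p" and "x \<in> int_adjoin z" "y \<in> int_adjoin z"
  shows "rdvd z (of_nat p) ((x + y) ^ p - (x ^ p + y ^ p))"
proof -
  have p0: "p > 0" using p by (simp add: prime_gt_0_nat)
  have "(x + y) ^ p = (\<Sum>k\<le>p. of_nat (p choose k) * x ^ k * y ^ (p - k))"
    by (rule binomial_ring)
  also have "{..p} = insert 0 (insert p {1..<p})" using p0 by auto
  also have "(\<Sum>k\<in>\<dots>. of_nat (p choose k) * x ^ k * y ^ (p - k)) =
      y ^ p + (x ^ p + (\<Sum>k\<in>{1..<p}. of_nat (p choose k) * x ^ k * y ^ (p - k)))"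
    using p0 by simp
  finally have eq: "(x + y) ^ p - (x ^ p + y ^ p) =
      (\<Sum>k\<in>{1..<p}. of_nat (p choose k) * x ^ k * y ^ (p - k))" by simp
  show ?thesis unfolding eq
  proof (rule rdvd_sum)
    fix k assume k: "k \<in> {1..<p}"
    have "p dvd (p choose k)" using k p by (intro dvd_choose_prime) auto
    then obtain d where "p choose k = p * d" by (elim dvdE)
    thus "rdvd z (of_nat p) (of_nat (p choose k) * x ^ k * y ^ (p - k))"
      using assms by (intro rdvdI [of "of_nat d * x ^ k * y ^ (p - k)"]) auto
  qed
qed

lemma int_fermat: "prime p \<Longrightarrow> int p dvd a ^ p - a"
proof -
  assume p: "prime p"
  show ?thesis
  proof (cases "int p dvd a")
    case True
    hence "int p dvd a ^ p" using p by (meson dvd_power dvd_trans prime_gt_0_nat)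
    thus ?thesis using True by (rule dvd_diff)
  next
    case False
    define b where "b = nat (a mod int p)"
    have pp: "int p > 0" using p by (simp add: prime_gt_0_nat)
    have b: "int b = a mod int p" using pp by (simp add: b_def)
    have "\<not> p dvd b"
      using False b by (metis dvd_mod_iff dvd_refl int_dvd_int_iff)
    hence "[b ^ (p - 1) = 1] (mod p)" using fermat_theorem [OF p] by blast
    hence "[int b ^ (p - 1) = 1] (mod int p)" by (metis cong_int_iff of_nat_1 of_nat_power)
    hence "[int b ^ (p - 1) * int b = 1 * int b] (mod int p)" by (rule cong_scalar_right)
    hence "[int b ^ p = int b] (mod int p)"
      using p power_minus_mult [of p "int b"] prime_gt_0_nat [OF p] by simp
    moreover have "[int b = a] (mod int p)" by (simp add: b cong_def)
    ultimately have "[a ^ p = a] (mod int p)"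
      using cong_pow [of "int b" a "int p" p] by (blast intro: cong_sym cong_trans)
    thus ?thesis by (simp add: cong_iff_dvd_diff)
  qed
qed

text \<open>Induction along the Horner form, with Fermat for the coefficients. A general
  \<open>w\<close> in Z[z] is allowed since iterating the congruence applies it to powers of
  \<open>w\<close>.\<close>

lemma frobenius_cong:
  assumes p: "prime p" and w: "w \<in> int_adjoin z"
  shows "rdvd z (of_nat p) (ev P w ^ p - ev P (w ^ p))"
proof (induction P)
  case 0
  thus ?case using prime_gt_0_nat [OF p] by (simp add: zero_power)
next
  case (pCons a P)
  obtain d where d: "a ^ p - a = int p * d" using int_fermat [OF p, of a] by (elim dvdE)
  have "of_int a ^ p - of_int a = (of_nat p * of_int d :: complex)"
    using arg_cong [OF d, of complex_of_int] by simp
  hence 1: "rdvd z (of_nat p) (of_int a ^ p - of_int a)" by (intro rdvdI [of "of_int d"]) auto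
  have "rdvd z (of_nat p) (w ^ p * (ev P w ^ p - ev P (w ^ p)))"
    using pCons w by (intro rdvd_mult_left) auto
  hence 2: "rdvd z (of_nat p) ((w * ev P w) ^ p - w ^ p * ev P (w ^ p))"
    by (simp add: power_mult_distrib algebra_simps)
  have 3: "rdvd z (of_nat p) ((of_int a + w * ev P w) ^ p - (of_int a ^ p + (w * ev P w) ^ p))"
    using w by (intro freshman_dream p) (auto intro: ev_mem_int_adjoin)
  show ?case using rdvd_add [OF 3 rdvd_add [OF 1 2]] by (simp add: algebra_simps)
qed

lemma frobenius_power_cong:
  assumes p: "prime p" and w: "w \<in> int_adjoin z"
  shows "rdvd z (of_nat p) (ev P w ^ (p ^ j) - ev P (w ^ (p ^ j)))"
proof (induction j)
  case (Suc j)
  have "rdvd z (of_nat p) ((ev P w ^ (p ^ j)) ^ p - ev P (w ^ (p ^ j)) ^ p)"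
    using Suc w by (intro rdvd_cong_power) (auto intro: ev_mem_int_adjoin)
  moreover have "rdvd z (of_nat p) (ev P (w ^ (p ^ j)) ^ p - ev P ((w ^ (p ^ j)) ^ p))"
    using w by (intro frobenius_cong p) auto
  ultimately have "rdvd z (of_nat p) ((ev P w ^ (p ^ j)) ^ p - ev P ((w ^ (p ^ j)) ^ p))"
    by (rule rdvd_cong_trans)
  thus ?case by (simp add: power_mult [symmetric] mult.commute)
qed auto

section \<open>Conjugacy of the primitive roots of unity\<close>

text \<open>Take \<open>t = s + m * D\<close> with D the product of the primes of \<open>C\<close>
  not dividing \<open>s\<close>: every prime of \<open>C\<close> then divides exactly one of the two
  summands.\<close>

lemma coprime_shift:
  assumes "coprime s m" "C \<noteq> (0::nat)"
  shows "\<exists>t. [t = s] (mod m) \<and> coprime t C"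
proof -
  define D where "D = {p \<in> prime_factors C. \<not> p dvd s}"
  have fin: "finite D" by (simp add: D_def)
  define t where "t = s + m * \<Prod>D"
  have "coprime t C"
  proof (rule ccontr)
    assume "\<not> coprime t C"
    then obtain p where p: "prime p" "p dvd t" "p dvd C"
      using prime_factor_nat [of "gcd t C"] by (metis coprime_iff_gcd_eq_1 gcd_greatest_iff)
    have pC: "p \<in> prime_factors C" using p assms by (simp add: prime_factors_dvd)
    show False
    proof (cases "p dvd s")
      case True
      hence "p dvd m * \<Prod>D" using p(2) by (simp add: t_def dvd_add_right_iff)
      moreover have "\<not> p dvd m" using assms(1) p(1) True
        using coprime_common_divisor [of s m p] not_prime_unit by blast
      ultimately obtain q where "q \<in> D" "p dvd q"
        using p(1) fin by (auto simp: prime_dvd_mult_iff prime_dvd_prod_iff)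
      thus False using True p(1) primes_dvd_imp_eq [of p q] by (auto simp: D_def)
    next
      case False
      hence "p \<in> D" using pC by (simp add: D_def)
      hence "p dvd \<Prod>D" using fin by (simp add: dvd_prod_eqI)
      hence "p dvd s" using p(2) by (simp add: t_def dvd_add_left_iff)
      thus False using False by simp
    qed
  qed
  moreover have "[t = s] (mod m)" by (simp add: t_def cong_def)
  ultimately show ?thesis by blast
qed

text \<open>Landau's proof that the primitive roots of unity are conjugate: by the Frobenius congruence
  \<open>P(z\<^bsup>tp\<^esup>)\<close> is divisible by \<open>p\<close> whenever \<open>P(z\<^bsup>t\<^esup>) = 0\<close>, but a nonzero element is
  divisible by finitely many primes only, and these can be avoided by moving \<open>s\<close> inside its
  residue class.\<close>

lemma ev_conjugate_eq_0:
  assumes z: "z ^ m = 1" "m > 0" and s: "coprime s m" and P: "ev P z = 0"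
  shows "ev P (z ^ s) = 0"
proof -
  have "\<forall>i. \<exists>c::int. c \<noteq> 0 \<and> (ev P (z ^ i) \<noteq> 0 \<longrightarrow> rdvd z (ev P (z ^ i)) (of_int c))"
  proof
    fix i
    show "\<exists>c::int. c \<noteq> 0 \<and> (ev P (z ^ i) \<noteq> 0 \<longrightarrow> rdvd z (ev P (z ^ i)) (of_int c))"
    proof (cases "ev P (z ^ i) = 0")
      case False
      have "ev P (z ^ i) \<in> int_adjoin z" by (auto intro: ev_mem_int_adjoin)
      thus ?thesis using int_adjoin_divides_int [OF z _ False] by blast
    qed (auto intro: exI [of _ 1])
  qed
  then obtain c :: "nat \<Rightarrow> int" where c: "\<And>i. c i \<noteq> 0"
    "\<And>i. ev P (z ^ i) \<noteq> 0 \<Longrightarrow> rdvd z (ev P (z ^ i)) (of_int (c i))" by metis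
  define C where "C = (\<Prod>i<m. c i)"
  have C0: "C \<noteq> 0" using c(1) by (simp add: C_def)
  have C: "rdvd z (ev P (z ^ i)) (of_int C)" if "ev P (z ^ i) \<noteq> 0" for i
  proof -
    have eq: "z ^ (i mod m) = z ^ i" by (rule root_of_unity_power_mod [OF z(1)])
    have "c (i mod m) dvd C" unfolding C_def using z(2) by (intro dvd_prodI) auto
    hence "rdvd z (of_int (c (i mod m))) (of_int C)" using rdvd_of_int_iff [OF z] by simp
    moreover have "rdvd z (ev P (z ^ i)) (of_int (c (i mod m)))" using c(2) [of "i mod m"] that eq by simp
    ultimately show ?thesis by (meson rdvd_trans)
  qed
  have step: "ev P (z ^ (i * p)) = 0" if "ev P (z ^ i) = 0" "prime p" "\<not> int p dvd C" for i p
  proof (rule ccontr)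
    assume ne: "ev P (z ^ (i * p)) \<noteq> 0"
    have "rdvd z (of_nat p) (ev P (z ^ i) ^ p - ev P ((z ^ i) ^ p))"
      by (intro frobenius_cong that) auto
    hence "rdvd z (of_nat p) (0 - ev P (z ^ (i * p)))"
      using that prime_gt_0_nat [OF that(2)] by (simp add: power_mult zero_power)
    hence "rdvd z (of_nat p) (ev P (z ^ (i * p)))" using rdvd_minus_commute by fastforce
    hence "rdvd z (of_int (int p)) (of_int C)" using C [OF ne] rdvd_trans by fastforce
    thus False using that rdvd_of_int_iff [OF z] by blast
  qed
  have all: "ev P (z ^ t) = 0" if "t > 0" "coprime t (nat \<bar>C\<bar>)" for t
    using that
  proof (induction t rule: prime_divisors_induct)
    case (factor p t)
    have "\<not> p dvd nat \<bar>C\<bar>"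
      using factor.prems(2) factor.hyps coprime_common_divisor [of "p * t" "nat \<bar>C\<bar>" p] not_prime_unit
      by auto
    hence "\<not> int p dvd C" by (simp add: int_dvd_int_iff [symmetric])
    moreover have "ev P (z ^ t) = 0" using factor by auto
    ultimately have "ev P (z ^ (t * p)) = 0" using step factor.hyps by blast
    thus ?case by (simp add: mult.commute)
  next
    case (unit t)
    thus ?case using P by simp
  qed auto
  obtain t where t: "[t = s] (mod m)" "coprime t (nat \<bar>C\<bar>)"
    using coprime_shift [OF s, of "nat \<bar>C\<bar>"] C0 by auto
  have zt: "z ^ t = z ^ s"
    using t(1) root_of_unity_power_mod [OF z(1), of t] root_of_unity_power_mod [OF z(1), of s]
    by (simp add: cong_def)
  show ?thesis
  proof (cases "t = 0")
    case True
    hence "m = 1" using t(1) s coprime_common_divisor [of s m m] cong_sym [OF t(1)] by (auto simp: cong_0_iff)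
    thus ?thesis using P z by simp
  qed (use all [of t] t zt in auto)
qed

lemma ev_conjugate_cong:
  assumes "z ^ m = 1" "m > 0" "coprime s m" "ev P z = ev Q z"
  shows "ev P (z ^ s) = ev Q (z ^ s)"
  using ev_conjugate_eq_0 [of z m s "P - Q"] assms by simp

section \<open>Products and sums over all conjugates\<close>

lemma sum_root_of_unity_powers:
  fixes w :: complex
  assumes "w ^ n = 1" "n > 0"
  shows "(\<Sum>s<n. w ^ s) = (if w = 1 then of_nat n else 0)"
  using assms by (auto simp: sum_gp_strict)

text \<open>Sorting the complete sum over \<open>{0<..n}\<close> by gcd(s, n) = d gives the same
  kind of sum for \<open>n div d\<close> and w^d; all classes but d = 1 fall under the induction
  hypothesis.\<close>

lemma ramanujan_sum_Ints:
  fixes w :: complex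
  assumes "w ^ n = 1" "n > 0"
  shows "(\<Sum>s\<in>totatives n. w ^ s) \<in> \<int>"
  using assms
proof (induction n arbitrary: w rule: less_induct)
  case (less n)
  define D where "D = {d. d dvd n}"
  have fin: "finite D" using less.prems by (simp add: D_def)
  have inner: "(\<Sum>s\<in>{s\<in>{0<..n}. gcd s n = d}. w ^ s) = (\<Sum>s\<in>totatives (n div d). (w ^ d) ^ s)"
    if "d \<in> D" for d
    using sum.reindex_bij_betw [OF bij_betw_totatives_gcd_eq [of d n], of "\<lambda>s. w ^ s"] that less.prems
    by (simp add: D_def power_mult [symmetric] mult.commute)
  have "(\<Sum>s\<in>{0<..n}. w ^ s) = (\<Sum>s<n. w ^ s)"
    by (rule sum.reindex_bij_witness [of _ "\<lambda>s. if s = 0 then n else s" "\<lambda>s. if s = n then 0 else s"])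
       (use less.prems in auto)
  hence tot: "(\<Sum>s\<in>{0<..n}. w ^ s) \<in> \<int>"
    using sum_root_of_unity_powers [OF less.prems] by simp
  have "(\<Sum>s\<in>{0<..n}. w ^ s) = (\<Sum>d\<in>D. \<Sum>s\<in>{s\<in>{0<..n}. gcd s n = d}. w ^ s)"
    by (rule sum.group [symmetric]) (use fin in \<open>auto simp: D_def\<close>)
  also have "\<dots> = (\<Sum>d\<in>D. \<Sum>s\<in>totatives (n div d). (w ^ d) ^ s)"
    by (intro sum.cong refl inner)
  also have "\<dots> = (\<Sum>s\<in>totatives n. w ^ s) + (\<Sum>d\<in>D - {1}. \<Sum>s\<in>totatives (n div d). (w ^ d) ^ s)"
    using fin by (subst sum.remove [of _ 1]) (auto simp: D_def)
  finally have "(\<Sum>s\<in>totatives n. w ^ s) =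
      (\<Sum>s\<in>{0<..n}. w ^ s) - (\<Sum>d\<in>D - {1}. \<Sum>s\<in>totatives (n div d). (w ^ d) ^ s)" by simp
  moreover have "(\<Sum>d\<in>D - {1}. \<Sum>s\<in>totatives (n div d). (w ^ d) ^ s) \<in> \<int>"
  proof (rule Ints_sum)
    fix d assume d: "d \<in> D - {1}"
    have "d \<noteq> 0" using d less.prems by (auto simp: D_def)
    hence "d > 1" using d by auto
    hence 1: "n div d < n" using less.prems by (intro div_less_dividend) auto
    have 2: "(w ^ d) ^ (n div d) = 1" using d less.prems by (simp add: D_def power_mult [symmetric])
    have 3: "n div d > 0" using d less.prems by (auto simp: D_def dvd_imp_le div_greater_zero_iff)
    show "(\<Sum>s\<in>totatives (n div d). (w ^ d) ^ s) \<in> \<int>" by (rule less.IH [OF 1 2 3])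
  qed
  ultimately show ?case using tot by simp
qed

lemma bij_betw_totatives_mult_mod:
  assumes "n > 1" "coprime t n"
  shows "bij_betw (\<lambda>s. t * s mod n) (totatives n) (totatives n)"
proof -
  have inj: "inj_on (\<lambda>s. t * s mod n) (totatives n)"
  proof (rule inj_onI)
    fix a b assume ab: "a \<in> totatives n" "b \<in> totatives n" "t * a mod n = t * b mod n"
    hence "[a = b] (mod n)" using assms by (simp add: cong_def [symmetric] cong_mult_lcancel_nat)
    thus "a = b" using ab totatives_less [OF _ assms(1)] by (auto simp: cong_def)
  qed
  have "(\<lambda>s. t * s mod n) ` totatives n \<subseteq> totatives n"
  proof
    fix x assume "x \<in> (\<lambda>s. t * s mod n) ` totatives n"
    then obtain s where s: "s \<in> totatives n" "x = t * s mod n" by auto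
    have "coprime (t * s) n" using s assms by (simp add: in_totatives_iff)
    hence cop: "coprime x n" using s assms by simp
    moreover have "x \<noteq> 0" using cop assms by (intro notI) auto
    ultimately show "x \<in> totatives n" using s assms by (auto simp: in_totatives_iff less_imp_le)
  qed
  thus ?thesis using inj by (simp add: bij_betw_def endo_inj_surj)
qed

lemma prod_conjugates_invariant:
  assumes z: "z ^ n = 1" "n > 0" and t: "coprime t n"
  shows "(\<Prod>s\<in>totatives n. ev P ((z ^ t) ^ s)) = (\<Prod>s\<in>totatives n. ev P (z ^ s))"
proof (cases "n = 1")
  case False
  hence n: "n > 1" using z by simp
  have "(\<Prod>s\<in>totatives n. ev P (z ^ s)) = (\<Prod>s\<in>totatives n. ev P (z ^ (t * s mod n)))"
    by (rule prod.reindex_bij_betw [OF bij_betw_totatives_mult_mod [OF n t], symmetric])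
  thus ?thesis by (simp add: root_of_unity_power_mod [OF z(1)] power_mult)
qed (use z in simp)

text \<open>A vanishing conjugate can be conjugated back by the inverse of \<open>s\<close> modulo
  \<open>n\<close>.\<close>

lemma ev_conjugate_nonzero:
  assumes z: "z ^ n = 1" "n > 0" and s: "coprime s n" and "ev P z \<noteq> 0"
  shows "ev P (z ^ s) \<noteq> 0"
proof
  assume 0: "ev P (z ^ s) = 0"
  obtain t where t: "[s * t = 1] (mod n)" using cong_solve_coprime_nat [OF s] by auto
  have ct: "coprime t n"
    using t by (metis coprime_mult_left_iff cong_imp_coprime cong_sym coprime_1_left)
  have "ev P ((z ^ s) ^ t) = 0"
    by (rule ev_conjugate_eq_0 [OF _ z(2) ct 0]) (simp add: power_mult [symmetric] mult.commute power_mult z)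
  moreover have "(z ^ s) ^ t = z"
    using t root_of_unity_power_mod [OF z(1), of "s * t"] root_of_unity_power_mod [OF z(1), of 1]
    by (simp add: power_mult [symmetric] cong_def)
  ultimately show False using assms by simp
qed

text \<open>The product is a nonzero integer. Rationality is obtained without Galois theory: the
  product is unchanged under conjugation, so it equals its own average over the conjugates, and that
  average is an integer combination of Ramanujan sums divided by \<open>totient n\<close>.\<close>

lemma norm_prod_conjugates_ge_1:
  assumes z: "z ^ n = 1" "n > 0" and nz: "ev P z \<noteq> 0"
  shows "cmod (\<Prod>s\<in>totatives n. ev P (z ^ s)) \<ge> 1"
proof -
  define N where "N = (\<Prod>s\<in>totatives n. ev P (z ^ s))"
  define Q where "Q = (\<Prod>s\<in>totatives n. pcompose P (Polynomial.monom 1 s))"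
  have Q: "ev Q (z ^ t) = N" if "t \<in> totatives n" for t
    using prod_conjugates_invariant [OF z, of t P] that
    by (simp add: Q_def N_def in_totatives_iff)
  have "of_nat (totient n) * N = (\<Sum>t\<in>totatives n. ev Q (z ^ t))"
    by (simp add: Q totient_def)
  also have "\<dots> = (\<Sum>k\<le>degree Q. of_int (Polynomial.coeff Q k) * (\<Sum>t\<in>totatives n. (z ^ k) ^ t))"
    unfolding ev_coeff_sum
    by (subst sum.swap) (simp add: sum_distrib_left power_mult [symmetric] mult.commute)
  also have "\<dots> \<in> \<int>"
  proof (rule Ints_sum)
    fix k
    have "(z ^ k) ^ n = 1" using z by (metis mult.commute power_mult power_one)
    thus "of_int (Polynomial.coeff Q k) * (\<Sum>t\<in>totatives n. (z ^ k) ^ t) \<in> \<int>"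
      using z(2) by (intro Ints_mult ramanujan_sum_Ints) auto
  qed
  finally obtain c :: int where c: "of_nat (totient n) * N = of_int c" by (auto elim: Ints_cases)
  have "N = of_int c / of_nat (totient n)"
    using c z by (simp add: field_simps)
  hence "N \<in> \<rat>" by simp
  moreover have "N \<in> int_adjoin z"
    unfolding N_def by (auto intro: ev_mem_int_adjoin)
  ultimately have "N \<in> \<int>" using rational_int_adjoin [OF z] by blast
  moreover have "N \<noteq> 0"
    unfolding N_def using ev_conjugate_nonzero [OF z _ nz] by (auto simp: in_totatives_iff)
  ultimately show ?thesis unfolding N_def [symmetric] by (auto elim!: Ints_cases)
qed

text \<open>The arithmetic-geometric mean inequality, applied to the conjugates.\<close>

lemma sum_conjugates_ge_totient:
  assumes z: "z ^ n = 1" "n > 0" and nz: "ev P z \<noteq> 0"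
    and X: "\<And>s. s \<in> totatives n \<Longrightarrow> ev P (z ^ s) = of_real (X s) \<and> X s \<ge> 0"
  shows "(\<Sum>s\<in>totatives n. X s) \<ge> real (totient n)"
proof -
  have pos: "X s > 0" if "s \<in> totatives n" for s
    using X [OF that] ev_conjugate_nonzero [OF z _ nz, of s] that
    by (cases "X s = 0") (auto simp: in_totatives_iff)
  have "(\<Prod>s\<in>totatives n. ev P (z ^ s)) = of_real (\<Prod>s\<in>totatives n. X s)"
    using X by simp
  hence "\<bar>\<Prod>s\<in>totatives n. X s\<bar> \<ge> 1"
    using norm_prod_conjugates_ge_1 [OF z nz] by (simp only: norm_of_real)
  hence "(\<Prod>s\<in>totatives n. X s) \<ge> 1"
    using prod_pos [of "totatives n" X] pos by simp
  hence "0 \<le> ln (\<Prod>s\<in>totatives n. X s)" by simp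
  also have "\<dots> = (\<Sum>s\<in>totatives n. ln (X s))" by (intro ln_prod) (use pos in \<open>auto simp: less_imp_neq [symmetric]\<close>)
  also have "\<dots> \<le> (\<Sum>s\<in>totatives n. X s - 1)" by (intro sum_mono ln_le_minus_one pos)
  also have "\<dots> = (\<Sum>s\<in>totatives n. X s) - real (totient n)"
    by (simp add: sum_subtractf totient_def)
  finally show ?thesis by simp
qed

section \<open>Primitive roots of unity\<close>

definition prim_root :: "complex \<Rightarrow> nat \<Rightarrow> bool" where
  "prim_root z n \<longleftrightarrow> n > 0 \<and> (\<forall>k. z ^ k = 1 \<longleftrightarrow> n dvd k)"

lemma prim_root_pos: "prim_root z n \<Longrightarrow> n > 0"
  and prim_root_power_eq_1: "prim_root z n \<Longrightarrow> z ^ n = 1"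
  and prim_root_power_eq_1_iff: "prim_root z n \<Longrightarrow> z ^ k = 1 \<longleftrightarrow> n dvd k"
  by (auto simp: prim_root_def)

lemma prim_root_nonzero: "prim_root z n \<Longrightarrow> z \<noteq> 0"
  using prim_root_power_eq_1 [of z n] prim_root_pos [of z n] by (auto simp: zero_power)

lemma prim_root_exists:
  assumes "n > 0"
  shows "\<exists>z. prim_root z n"
proof -
  define z where "z = exp (2 * of_real pi * \<i> / of_nat n)"
  have "z ^ k = exp (2 * of_real pi * \<i> * of_nat k / of_nat n)" for k
    unfolding z_def exp_of_nat_mult [symmetric] by (simp add: mult_ac)
  hence "prim_root z n"
    using assms complex_root_unity_eq_1 [of n] by (auto simp: prim_root_def)
  thus ?thesis ..
qed

lemma prim_root_power_eq_iff:
  assumes "prim_root z n"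
  shows "z ^ i = z ^ j \<longleftrightarrow> [i = j] (mod n)"
proof -
  have *: "z ^ i = z ^ j \<longleftrightarrow> [i = j] (mod n)" if "i \<le> j" for i j
  proof -
    have "z ^ j = z ^ i * z ^ (j - i)" using that by (simp add: power_add [symmetric])
    hence "z ^ i = z ^ j \<longleftrightarrow> z ^ (j - i) = 1"
      using prim_root_nonzero [OF assms] by auto
    also have "\<dots> \<longleftrightarrow> n dvd j - i" by (rule prim_root_power_eq_1_iff [OF assms])
    also have "\<dots> \<longleftrightarrow> [j = i] (mod n)" using that by (simp add: cong_altdef_nat)
    finally show ?thesis by (auto simp: cong_sym_eq)
  qed
  show ?thesis
  proof (cases "i \<le> j")
    case False
    thus ?thesis using * [of j i] by (auto simp: cong_sym_eq)
  qed (rule *)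
qed

lemma prim_root_power_divisor:
  assumes "prim_root z n" "n = d * e"
  shows "prim_root (z ^ d) e"
  using assms by (auto simp: prim_root_def power_mult [symmetric])

lemma prim_root_cmod:
  assumes "prim_root z n"
  shows "cmod z = 1"
proof -
  have "cmod z ^ n = 1" using prim_root_power_eq_1 [OF assms] by (metis norm_one norm_power)
  thus ?thesis using prim_root_pos [OF assms] power_eq_imp_eq_base [of "cmod z" n 1] by simp
qed

lemma prim_root_mult_cnj: "prim_root z n \<Longrightarrow> z * cnj z = 1"
  using prim_root_cmod [of z n] by (simp add: complex_norm_square [symmetric])

lemma prim_root_cnj:
  assumes "prim_root z n"
  shows "cnj z = z ^ (n - 1)"
proof -
  have "z * z ^ (n - 1) = 1"
    using prim_root_power_eq_1 [OF assms] prim_root_pos [OF assms] by (simp add: power_Suc [symmetric] del: power_Suc)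
  thus ?thesis using prim_root_mult_cnj [OF assms] prim_root_nonzero [OF assms]
    by (metis mult_cancel_left)
qed

lemma cnj_in_int_adjoin:
  assumes "prim_root z n" "x \<in> int_adjoin z"
  shows "cnj x \<in> int_adjoin z"
proof -
  obtain P where "x = ev P z" using assms by (elim int_adjoinE)
  thus ?thesis using prim_root_cnj [OF assms(1)] by (auto simp: cnj_ev intro: ev_mem_int_adjoin)
qed

lemma prod_prim_root_poly:
  assumes w: "prim_root w n"
  shows "(\<Prod>i<n. [:- (w ^ i), 1:]) = [:0, 1:] ^ n - 1"
proof -
  let ?A = "(\<lambda>i. w ^ i) ` {..<n}"
  have n: "n > 0" using w by (rule prim_root_pos)
  have inj: "inj_on (\<lambda>i. w ^ i) {..<n}"
    by (auto simp: inj_on_def prim_root_power_eq_iff [OF w] cong_def)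
  have deg: "degree (\<Prod>i<n. [:- (w ^ i), 1:]) = n"
    by (subst degree_prod_eq_sum_degree) auto
  have lc: "lead_coeff (\<Prod>i<n. [:- (w ^ i), 1:]) = 1"
    by (subst lead_coeff_prod) simp
  have deg2: "degree ([:0, 1 :: complex:] ^ n) = n" by (simp add: degree_power_eq)
  have lc2: "lead_coeff ([:0, 1 :: complex:] ^ n) = 1" by (simp add: lead_coeff_power)
  show ?thesis
  proof (rule poly_eqI_degree_lead_coeff [where n = n and A = ?A])
    show "card ?A \<ge> n" using inj by (simp add: card_image)
    show "degree ([:0, 1 :: complex:] ^ n - 1) \<le> n"
      using degree_diff_le [of "[:0, 1 :: complex:] ^ n" n 1] deg2 by simp
    show "poly.coeff (\<Prod>i<n. [:- (w ^ i), 1:]) n = poly.coeff ([:0, 1:] ^ n - 1) n"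
      using deg lc deg2 lc2 n by simp
    fix x assume "x \<in> ?A"
    then obtain i where i: "i < n" "x = w ^ i" by auto
    have "poly (\<Prod>i<n. [:- (w ^ i), 1:]) x = (\<Prod>j<n. x - w ^ j)"
      by (simp add: poly_prod)
    also have "\<dots> = 0" using i by (intro prod_zero) auto
    also have "0 = x ^ n - 1"
      using i prim_root_power_eq_1 [OF w] by (metis cancel_comm_monoid_add_class.diff_cancel mult.commute power_mult power_one)
    also have "\<dots> = poly ([:0, 1:] ^ n - 1) x" by (simp add: poly_power)
    finally show "poly (\<Prod>i<n. [:- (w ^ i), 1:]) x = poly ([:0, 1:] ^ n - 1) x" .
  qed (use deg in simp)
qed

lemma prod_one_minus_prim_root_mult:
  assumes w: "prim_root w n"
  shows "(\<Prod>i<n. 1 - w ^ i * x) = 1 - x ^ n"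
proof (cases "x = 0")
  case True
  thus ?thesis using prim_root_pos [OF w] by (simp add: zero_power)
next
  case False
  have "(\<Prod>i<n. 1 / x - w ^ i) = (1 / x) ^ n - 1"
    using arg_cong [OF prod_prim_root_poly [OF w], of "\<lambda>P. poly P (1 / x)"]
    by (simp add: poly_prod poly_power)
  hence "(\<Prod>i<n. x) * (\<Prod>i<n. 1 / x - w ^ i) = x ^ n * ((1 / x) ^ n - 1)" by simp
  hence "(\<Prod>i<n. x * (1 / x - w ^ i)) = x ^ n * ((1 / x) ^ n - 1)"
    by (simp only: prod.distrib)
  moreover have "x * (1 / x - w ^ i) = 1 - w ^ i * x" for i using False by (simp add: field_simps)
  moreover have "x ^ n * ((1 / x) ^ n - 1) = 1 - x ^ n" using False by (simp add: field_simps)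
  ultimately show ?thesis by simp
qed

text \<open>Cancel the factor X - 1 from X^n - 1 and evaluate at 1.\<close>

lemma prod_one_minus_prim_root:
  assumes w: "prim_root w n"
  shows "(\<Prod>i\<in>{1..<n}. 1 - w ^ i) = of_nat n"
proof -
  have n: "n > 0" using w by (rule prim_root_pos)
  have "{..<n} = insert 0 {1..<n}" using n by auto
  hence "(\<Prod>i<n. [:- (w ^ i), 1:]) = [:-1, 1:] * (\<Prod>i\<in>{1..<n}. [:- (w ^ i), 1:])" by simp
  moreover have "[:0, 1:] ^ n - (1 :: complex poly) = ([:0, 1:] - 1) * (\<Sum>i<n. [:0, 1:] ^ i)"
    by (rule power_diff_1_eq)
  moreover have "[:0, 1:] - (1 :: complex poly) = [:-1, 1:]" by (simp add: one_pCons)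
  ultimately have "[:-1, 1:] * (\<Prod>i\<in>{1..<n}. [:- (w ^ i), 1:]) = [:-1, 1:] * (\<Sum>i<n. [:0, 1:] ^ i)"
    using prod_prim_root_poly [OF w] by simp
  hence "(\<Prod>i\<in>{1..<n}. [:- (w ^ i), 1:]) = (\<Sum>i<n. [:0, 1 :: complex:] ^ i)"
    by (subst (asm) mult_cancel_left) auto
  from arg_cong [OF this, of "\<lambda>P. poly P 1"] show ?thesis
    by (simp add: poly_prod poly_power poly_sum)
qed

section \<open>Associates of 1 - w and square roots of self-conjugate prime powers\<close>

definition rassoc :: "complex \<Rightarrow> complex \<Rightarrow> complex \<Rightarrow> bool" where
  "rassoc z a b \<longleftrightarrow> rdvd z a b \<and> rdvd z b a"

lemma rassoc_refl: "rassoc z a a"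
  by (simp add: rassoc_def)

lemma rassoc_sym: "rassoc z a b \<Longrightarrow> rassoc z b a"
  by (simp add: rassoc_def)

lemma rassoc_trans: "rassoc z a b \<Longrightarrow> rassoc z b c \<Longrightarrow> rassoc z a c"
  unfolding rassoc_def using rdvd_trans by blast

lemma rassoc_mult: "rassoc z a b \<Longrightarrow> rassoc z c d \<Longrightarrow> rassoc z (a * c) (b * d)"
  by (simp add: rassoc_def rdvd_mult)

lemma rassoc_power: "rassoc z a b \<Longrightarrow> rassoc z (a ^ n) (b ^ n)"
  by (simp add: rassoc_def rdvd_power)

lemma rassoc_prod: "(\<And>i. i \<in> A \<Longrightarrow> rassoc z (f i) (g i)) \<Longrightarrow> rassoc z (prod f A) (prod g A)"
  by (simp add: rassoc_def rdvd_prod)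

lemma rassoc_mono: "rassoc w a b \<Longrightarrow> w \<in> int_adjoin z \<Longrightarrow> rassoc z a b"
  by (auto simp: rassoc_def intro: rdvd_mono)

lemma one_minus_rdvd_one_minus_power: "rdvd w (1 - w) (1 - w ^ i)"
  by (rule rdvdI [of "\<Sum>j<i. w ^ j"]) (auto simp: one_diff_power_eq)

lemma rassoc_one_minus_conjugate:
  assumes w: "prim_root w n" and i: "coprime i n"
  shows "rassoc w (1 - w) (1 - w ^ i)"
proof -
  obtain t where t: "[i * t = 1] (mod n)" using cong_solve_coprime_nat [OF i] by auto
  have "w = (w ^ i) ^ t"
    using t prim_root_power_eq_iff [OF w, of "i * t" 1] by (simp add: power_mult)
  hence "rdvd (w ^ i) (1 - w ^ i) (1 - w)" using one_minus_rdvd_one_minus_power [of "w ^ i" t] by simp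
  hence "rdvd w (1 - w ^ i) (1 - w)" by (rule rdvd_mono) auto
  thus ?thesis by (simp add: rassoc_def one_minus_rdvd_one_minus_power)
qed

text \<open>1 - w^(p^b) is the product of the factors 1 - w^(p j + 1) with j < p^b. Their exponents
  are prime to \<open>p\<close>, so each factor is associated to 1 - w.\<close>

lemma rassoc_one_minus_prime_power:
  assumes p: "prime p" and w: "prim_root w (p ^ Suc b)"
  shows "rassoc w (1 - w ^ (p ^ b)) ((1 - w) ^ (p ^ b))"
proof -
  have wp: "prim_root (w ^ p) (p ^ b)" using w by (rule prim_root_power_divisor) simp
  have "rassoc w (\<Prod>j<p ^ b. 1 - w) (\<Prod>j<p ^ b. 1 - (w ^ p) ^ j * w)"
  proof (rule rassoc_prod)
    fix j
    have "gcd (p * j + 1) p = 1" by (metis gcd.commute gcd_1_nat gcd_add_mult mult.commute add.commute)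
    hence "coprime (p * j + 1) p" by (simp only: coprime_iff_gcd_eq_1)
    hence "coprime (p * j + 1) (p ^ Suc b)" by (simp del: power_Suc)
    from rassoc_one_minus_conjugate [OF w this]
    show "rassoc w (1 - w) (1 - (w ^ p) ^ j * w)" by (simp only: power_add power_mult power_one_right)
  qed
  thus ?thesis
    using prod_one_minus_prim_root_mult [OF wp, of w] by (simp add: rassoc_sym)
qed

lemma rassoc_prime_one_minus:
  assumes p: "prime p" and w: "prim_root w p"
  shows "rassoc w (of_nat p) ((1 - w) ^ (p - 1))"
proof -
  have "rassoc w (\<Prod>i\<in>{1..<p}. 1 - w) (\<Prod>i\<in>{1..<p}. 1 - w ^ i)"
  proof (rule rassoc_prod)
    fix i assume i: "i \<in> {1..<p}"
    hence "\<not> p dvd i" by (auto dest: dvd_imp_le)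
    hence "coprime i p" using p by (metis coprime_commute prime_imp_coprime)
    thus "rassoc w (1 - w) (1 - w ^ i)" by (rule rassoc_one_minus_conjugate [OF w])
  qed
  thus ?thesis using prod_one_minus_prim_root [OF w] by (simp add: rassoc_sym)
qed

text \<open>Self-conjugacy makes complex conjugation a power of Frobenius modulo \<open>q\<close>; hence
  \<open>z\<^bsup>p\<^sup>j+1\<^esup> \<equiv> z \<cdot> cnj z \<equiv> 0\<close> while \<open>z\<^bsup>p\<^sup>2\<^sup>j\<^esup> \<equiv> z\<close>.\<close>

lemma self_conjugate_rdvd:
  assumes c: "prim_root c m" and p: "prime p" and j: "j > 0"
    and qp: "rdvd c q (of_nat p)" and qc: "rdvd c q (1 - c ^ (p ^ j + 1))"
    and z: "z \<in> int_adjoin c" and zz: "rdvd c q (z * cnj z)"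
  shows "rdvd c q z"
proof -
  obtain P where P: "z = ev P c" using z by (elim int_adjoinE)
  have cc: "cnj c \<in> int_adjoin c" by (rule cnj_in_int_adjoin [OF c]) auto
  have cz: "cnj z \<in> int_adjoin c" by (rule cnj_in_int_adjoin [OF c z])
  have c1: "c * cnj c = 1" by (rule prim_root_mult_cnj [OF c])
  have c1p: "c ^ k * cnj c ^ k = 1" for k using c1 by (metis power_mult_distrib power_one)
  have "rdvd c q (cnj c * (1 - c ^ (p ^ j + 1)))" using qc cc by (rule rdvd_mult_left)
  moreover have "cnj c * (1 - c ^ (p ^ j + 1)) = cnj c - (c * cnj c) * c ^ (p ^ j)"
    by (simp add: algebra_simps)
  ultimately have "rdvd c q (cnj c - c ^ (p ^ j))" using c1 by simp
  hence k1: "rdvd c q (c ^ (p ^ j) - cnj c)" by (rule rdvd_minus_commute)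
  have "rdvd c q (cnj c ^ (p ^ j) * (1 - c ^ (p ^ j + 1)))" using qc cc by (intro rdvd_mult_left) auto
  moreover have "cnj c ^ (p ^ j) * (1 - c ^ (p ^ j + 1)) =
      cnj c ^ (p ^ j) - (c ^ (p ^ j) * cnj c ^ (p ^ j)) * c"
    by (simp add: algebra_simps)
  ultimately have k2: "rdvd c q (cnj c ^ (p ^ j) - c)" using c1p by simp
  have f: "rdvd c q (ev P w ^ (p ^ j) - ev P (w ^ (p ^ j)))" if "w \<in> int_adjoin c" for w
    using frobenius_power_cong [OF p that] qp rdvd_trans by blast
  have 1: "rdvd c q (z ^ (p ^ j) - cnj z)"
    unfolding P cnj_ev by (rule rdvd_cong_trans [OF f rdvd_cong_ev [OF k1]]) (use cc in auto)
  have 2: "rdvd c q (cnj z ^ (p ^ j) - z)"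
    unfolding P cnj_ev by (rule rdvd_cong_trans [OF f rdvd_cong_ev [OF k2]]) (use cc in auto)
  have "rdvd c q ((z ^ (p ^ j)) ^ (p ^ j) - cnj z ^ (p ^ j))"
    by (rule rdvd_cong_power [OF 1]) (use z cz in auto)
  from rdvd_cong_trans [OF this 2] have 3: "rdvd c q ((z ^ (p ^ j)) ^ (p ^ j) - z)" .
  have "rdvd c q ((z ^ (p ^ j) - cnj z) * z)" using 1 z by (rule rdvd_mult_right)
  from rdvd_add [OF this zz] have 4: "rdvd c q (z ^ (p ^ j + 1))" by (simp add: algebra_simps)
  \<comment> \<open>Here \<open>j > 0\<close> matters: it gives p^j + 1 <= p^(2j), so that
    z^(p^(2j)) is a multiple of z^(p^j + 1).\<close>
  have "p ^ j \<ge> p" using j p by (intro self_le_power) (simp_all add: prime_gt_0_nat Suc_leI)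
  hence "p ^ j \<ge> 2" using prime_ge_2_nat [OF p] by linarith
  hence "p ^ j * 2 \<le> p ^ j * p ^ j" by (intro mult_left_mono) auto
  hence le: "p ^ j + 1 \<le> p ^ j * p ^ j" using \<open>p ^ j \<ge> 2\<close> by linarith
  have "(z ^ (p ^ j)) ^ (p ^ j) = z ^ (p ^ j + 1) * z ^ (p ^ j * p ^ j - (p ^ j + 1))"
    using le by (simp only: power_mult [symmetric] power_add [symmetric] le_add_diff_inverse)
  hence "rdvd c q ((z ^ (p ^ j)) ^ (p ^ j))"
    using rdvd_mult_right [OF 4] z by auto
  from rdvd_diff [OF this 3] show ?thesis by simp
qed

text \<open>With w = c^m' of order p^(b+1), the element 1 - w divides \<open>p\<close> and satisfies
  the congruence required by \<open>self_conjugate_rdvd\<close>, as m' divides p^j + 1. Factors 1 -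
  w are split off from \<open>z\<close> one at a time.\<close>

lemma self_conjugate_rdvd_power:
  assumes c: "prim_root c m" and p: "prime p" and j: "j > 0" and m: "m = p ^ Suc b * m'"
    and jm: "m' dvd p ^ j + 1"
    and z: "z \<in> int_adjoin c" and zz: "rdvd c ((1 - c ^ m') ^ (2 * A)) (z * cnj z)"
  shows "rdvd c ((1 - c ^ m') ^ A) z"
  using z zz
proof (induction A arbitrary: z)
  case 0
  thus ?case by (intro rdvdI [of z]) auto
next
  case (Suc A)
  define w where "w = c ^ m'"
  have w: "prim_root w (p ^ Suc b)"
    unfolding w_def using c by (rule prim_root_power_divisor) (simp add: m mult.commute)
  have wc: "w \<in> int_adjoin c" by (auto simp: w_def)
  define s where "s = w ^ (p ^ b)"
  have s: "prim_root s p" unfolding s_def using w by (rule prim_root_power_divisor) simp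
  have "rdvd s (1 - s) ((1 - s) ^ (p - 1))"
    using prime_ge_2_nat [OF p] by (intro rdvdI [of "(1 - s) ^ (p - 2)"])
      (auto simp: power_Suc [symmetric] Suc_diff_Suc numeral_2_eq_2 simp del: power_Suc
        intro!: int_adjoin_power int_adjoin_diff)
  hence "rdvd s (1 - s) (of_nat p)"
    using rassoc_prime_one_minus [OF p s] rdvd_trans by (auto simp: rassoc_def)
  hence "rdvd c (1 - s) (of_nat p)" by (rule rdvd_mono) (use wc in \<open>auto simp: s_def\<close>)
  moreover have "rdvd c (1 - w) (1 - s)"
    unfolding s_def using one_minus_rdvd_one_minus_power by (rule rdvd_mono) (rule wc)
  ultimately have qp: "rdvd c (1 - w) (of_nat p)" using rdvd_trans by blast
  obtain i where i: "p ^ j + 1 = m' * i" using jm by (elim dvdE)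
  have qc: "rdvd c (1 - w) (1 - c ^ (p ^ j + 1))"
    unfolding i power_mult w_def [symmetric] using one_minus_rdvd_one_minus_power by (rule rdvd_mono) (rule wc)
  have w1: "1 - w \<noteq> 0"
  proof
    assume "1 - w = 0"
    hence "p ^ Suc b dvd 1" using prim_root_power_eq_1_iff [OF w, of 1] by simp
    thus False using p by simp
  qed
  obtain d where d: "d \<in> int_adjoin c" "z * cnj z = (1 - w) ^ (2 * Suc A) * d"
    using Suc.prems(2) unfolding w_def by (elim rdvdE)
  have "rdvd c (1 - w) (z * cnj z)"
    unfolding d(2) using d(1) wc by (intro rdvdI [of "(1 - w) ^ (2 * A + 1) * d"])
      (auto intro!: int_adjoin_mult int_adjoin_power int_adjoin_diff)
  hence "rdvd c (1 - w) z"
    by (rule self_conjugate_rdvd [OF c p j qp qc Suc.prems(1)])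
  then obtain y where y: "y \<in> int_adjoin c" "z = (1 - w) * y" by (elim rdvdE)
  have "w * cnj w = 1" by (rule prim_root_mult_cnj [OF w])
  \<comment> \<open>1 - w and its complex conjugate differ by a unit, so removing one factor from
    \<open>z\<close> removes (1 - w)^2 from \<open>z * cnj z\<close> up to a unit.\<close>
  hence cw: "w * cnj (1 - w) = - (1 - w)" by (simp add: algebra_simps)
  have "w * (z * cnj z) = (1 - w) * (w * cnj (1 - w)) * (y * cnj y)"
    by (simp add: y algebra_simps)
  also have "\<dots> = (1 - w) ^ 2 * (- (y * cnj y))" unfolding cw by (simp add: power2_eq_square algebra_simps)
  finally have "(1 - w) ^ 2 * (- (y * cnj y)) = (1 - w) ^ 2 * ((1 - w) ^ (2 * A) * (w * d))"
    using d by (simp add: power2_eq_square algebra_simps)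
  hence "- (y * cnj y) = (1 - w) ^ (2 * A) * (w * d)"
    by (subst (asm) mult_cancel_left) (use w1 in simp)
  hence "y * cnj y = (1 - w) ^ (2 * A) * (- (w * d))" by (metis minus_equation_iff mult_minus_right)
  hence "rdvd c ((1 - w) ^ (2 * A)) (y * cnj y)"
    using d wc by (intro rdvdI [of "- (w * d)"]) auto
  hence "rdvd c ((1 - w) ^ A) y" using Suc.IH [OF y(1)] by (simp add: w_def)
  hence "rdvd c ((1 - w) * (1 - w) ^ A) ((1 - w) * y)" by (intro rdvd_mult rdvd_refl)
  thus ?case by (simp add: y w_def)
qed

text \<open>A generator of the square root of the ideal \<open>p\<^sup>e\<close>, rounded down, when \<open>s\<close> is a
  primitive \<open>p\<close>-th root of unity. For odd \<open>p\<close> and \<open>e\<close> it uses that \<open>(1 - s)\<^bsup>p-1\<^esup>\<close> is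
  associated to \<open>p\<close>.\<close>

definition half_power :: "complex \<Rightarrow> nat \<Rightarrow> nat \<Rightarrow> complex" where
  "half_power s p e = of_nat p ^ (e div 2) * (if odd e \<and> odd p then (1 - s) ^ ((p - 1) div 2) else 1)"

text \<open>Everything is measured in powers of 1 - w, to which \<open>p\<close> and 1 - s are
  associated up to a power; \<open>A\<close> is the exponent of the half power.\<close>

lemma half_power_rdvd:
  assumes c: "prim_root c m" and p: "prime p" and j: "j > 0" and m: "m = p ^ Suc b * m'"
    and jm: "m' dvd p ^ j + 1"
    and z: "z \<in> int_adjoin c" and zz: "rdvd c (of_nat p ^ e) (z * cnj z)"
  shows "rdvd c (half_power (c ^ (m div p)) p e) z"
proof -
  define w where "w = c ^ m'"
  have w: "prim_root w (p ^ Suc b)"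
    unfolding w_def using c by (rule prim_root_power_divisor) (simp add: m mult.commute)
  have wc: "w \<in> int_adjoin c" by (auto simp: w_def)
  define s where "s = w ^ (p ^ b)"
  have s: "prim_root s p" unfolding s_def using w by (rule prim_root_power_divisor) simp
  have sc: "s \<in> int_adjoin c" using wc by (auto simp: s_def)
  have "p > 0" using p by (simp add: prime_gt_0_nat)
  hence "m div p = m' * p ^ b" by (simp add: m)
  hence s_eq: "c ^ (m div p) = s" by (simp add: s_def w_def power_mult)
  have 1: "rassoc c (1 - s) ((1 - w) ^ (p ^ b))"
    unfolding s_def using rassoc_one_minus_prime_power [OF p w] by (rule rassoc_mono) (rule wc)
  have "rassoc c (of_nat p) ((1 - s) ^ (p - 1))"
    using rassoc_prime_one_minus [OF p s] by (rule rassoc_mono) (rule sc)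
  moreover have "rassoc c ((1 - s) ^ (p - 1)) (((1 - w) ^ (p ^ b)) ^ (p - 1))"
    by (rule rassoc_power [OF 1])
  ultimately have 2: "rassoc c (of_nat p) ((1 - w) ^ (p ^ b * (p - 1)))"
    by (metis rassoc_trans power_mult)
  define A where "A = p ^ b * (p - 1) * (e div 2) + (if odd e \<and> odd p then p ^ b * ((p - 1) div 2) else 0)"
  have 3: "rassoc c (of_nat p ^ e) ((1 - w) ^ (p ^ b * (p - 1) * e))" for e
    using rassoc_power [OF 2, of e] by (simp add: power_mult)
  have hp: "rassoc c (half_power s p e) ((1 - w) ^ A)"
  proof -
    have "rassoc c (if odd e \<and> odd p then (1 - s) ^ ((p - 1) div 2) else 1)
        ((1 - w) ^ (if odd e \<and> odd p then p ^ b * ((p - 1) div 2) else 0))"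
      using rassoc_power [OF 1, of "(p - 1) div 2"] by (simp add: power_mult rassoc_refl)
    from rassoc_mult [OF 3 [of "e div 2"] this] show ?thesis
      unfolding half_power_def A_def power_add .
  qed
  have "2 * A \<le> p ^ b * (p - 1) * e"
  proof -
    have "2 * A = p ^ b * ((p - 1) * (2 * (e div 2)) + (if odd e \<and> odd p then 2 * ((p - 1) div 2) else 0))"
      by (simp only: A_def distrib_left mult.assoc mult.left_commute [of 2] if_distrib [of "(*) 2"]
          if_distrib [of "(*) (p ^ b)"] mult_0_right)
    also have "(p - 1) * (2 * (e div 2)) + (if odd e \<and> odd p then 2 * ((p - 1) div 2) else 0) \<le>
        (p - 1) * (2 * (e div 2)) + (if odd e then p - 1 else 0)" by auto
    also have "\<dots> = (p - 1) * (2 * (e div 2) + e mod 2)"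
      by (simp only: distrib_left) (simp add: odd_iff_mod_2_eq_one)
    also have "\<dots> = (p - 1) * e" by simp
    finally show ?thesis by (simp add: mult.assoc)
  qed
  \<comment> \<open>The defect \<open>r\<close> is positive only for p = 2 and odd \<open>e\<close>,
    where the half power is rounded down.\<close>
  then obtain r where r: "p ^ b * (p - 1) * e = 2 * A + r" using le_Suc_ex by blast
  have "rdvd c ((1 - w) ^ (2 * A)) ((1 - w) ^ (p ^ b * (p - 1) * e))"
    unfolding r power_add using wc by (intro rdvdI [of "(1 - w) ^ r"]) auto
  moreover have "rdvd c ((1 - w) ^ (p ^ b * (p - 1) * e)) (of_nat p ^ e)"
    using 3 by (simp add: rassoc_def)
  ultimately have "rdvd c ((1 - w) ^ (2 * A)) (z * cnj z)" using zz rdvd_trans by blast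
  hence "rdvd c ((1 - w) ^ A) z"
    unfolding w_def by (rule self_conjugate_rdvd_power [OF c p j m jm z])
  thus ?thesis unfolding s_eq using hp rdvd_trans by (auto simp: rassoc_def)
qed

text \<open>A crude integer multiple of the half power. Only its being a power of \<open>p\<close>
  matters: it makes Bezout arguments between different primes possible.\<close>

lemma half_power_rdvd_prime_power:
  assumes c: "prim_root c m" and p: "prime p" and m: "p dvd m"
  shows "rdvd c (half_power (c ^ (m div p)) p e) (of_nat p ^ Suc e)"
proof -
  define s where "s = c ^ (m div p)"
  have s: "prim_root s p" unfolding s_def using c by (rule prim_root_power_divisor) (use m in simp)
  have sc: "s \<in> int_adjoin c" by (auto simp: s_def)
  have "rdvd c ((1 - s) ^ ((p - 1) div 2)) ((1 - s) ^ (p - 1))"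
  proof (rule rdvdI [of "(1 - s) ^ (p - 1 - (p - 1) div 2)"])
    have "(p - 1) div 2 + (p - 1 - (p - 1) div 2) = p - 1" by linarith
    thus "(1 - s) ^ (p - 1) = (1 - s) ^ ((p - 1) div 2) * (1 - s) ^ (p - 1 - (p - 1) div 2)"
      by (simp only: power_add [symmetric])
  qed (use sc in auto)
  moreover have "rdvd c ((1 - s) ^ (p - 1)) (of_nat p)"
    using rassoc_prime_one_minus [OF p s] sc by (auto simp: rassoc_def intro: rdvd_mono)
  ultimately have "rdvd c ((1 - s) ^ ((p - 1) div 2)) (of_nat p)" using rdvd_trans by blast
  moreover have "rdvd c 1 (of_nat p)" by (intro rdvdI [of "of_nat p"]) auto
  ultimately have 1: "rdvd c (if odd e \<and> odd p then (1 - s) ^ ((p - 1) div 2) else 1) (of_nat p)"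
    by simp
  have "of_nat p ^ (e - e div 2) * of_nat p ^ (e div 2) = (of_nat p ^ e :: complex)"
    by (simp add: power_add [symmetric])
  hence 2: "rdvd c (of_nat p ^ (e div 2)) (of_nat p ^ e)"
    by (intro rdvdI [of "of_nat p ^ (e - e div 2)"]) (auto simp: mult.commute)
  show ?thesis using rdvd_mult [OF 2 1] unfolding half_power_def s_def [symmetric] power_Suc by (subst mult.commute)
qed

lemma rdvd_mult_coprime:
  assumes "rdvd c a (of_int A)" "rdvd c b (of_int B)" "coprime A B" "rdvd c a z" "rdvd c b z"
  shows "rdvd c (a * b) z"
proof -
  obtain x y where "x * A + y * B = gcd A B" using bezout_int by blast
  hence "x * A + y * B = 1" using assms(3) by simp
  hence "of_int (x * A + y * B) = (1 :: complex)" by simp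
  hence "z = of_int x * (of_int A * z) + of_int y * (of_int B * z)"
    by (simp only: of_int_add of_int_mult mult.assoc [symmetric] distrib_right [symmetric]) simp
  moreover have "rdvd c (a * b) (of_int A * z)" using assms by (intro rdvd_mult)
  moreover have "rdvd c (b * a) (of_int B * z)" using assms by (intro rdvd_mult)
  ultimately show ?thesis
    using rdvd_add [OF rdvd_mult_left [of c "a * b" "of_int A * z" "of_int x"]
        rdvd_mult_left [of c "a * b" "of_int B * z" "of_int y"]]
    by (simp add: mult.commute [of b a])
qed

lemma rdvd_prod_coprime:
  assumes "finite S" "\<And>p. p \<in> S \<Longrightarrow> rdvd c (f p) (of_int (F p)) \<and> rdvd c (f p) z"
    and "\<And>p q. p \<in> S \<Longrightarrow> q \<in> S \<Longrightarrow> p \<noteq> q \<Longrightarrow> coprime (F p) (F q)"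
    and "z \<in> int_adjoin c"
  shows "rdvd c (\<Prod>p\<in>S. f p) z"
  using assms
proof (induction S rule: finite_induct)
  case empty
  thus ?case by (intro rdvdI [of z]) auto
next
  case (insert p S)
  have "rdvd c (\<Prod>p\<in>S. f p) (of_int (\<Prod>p\<in>S. F p))"
    using insert by (simp add: rdvd_prod)
  moreover have "coprime (F p) (\<Prod>p\<in>S. F p)"
    using insert by (intro prod_coprime_right) auto
  moreover have "rdvd c (\<Prod>p\<in>S. f p) z" using insert by auto
  ultimately have "rdvd c (f p * (\<Prod>p\<in>S. f p)) z"
    using insert.prems(1) [of p] by (intro rdvd_mult_coprime [of c "f p" "F p"]) auto
  thus ?case using insert by simp
qed

section \<open>Projection to a smaller cyclotomic ring by selecting exponents\<close>

text \<open>The selection acts on polynomials, not on numbers: in general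
  \<open>ev (select d P) z\<close> depends on \<open>P\<close> and not only on
  \<open>ev P z\<close>.\<close>

definition filter_poly :: "(nat \<Rightarrow> bool) \<Rightarrow> int poly \<Rightarrow> int poly" where
  "filter_poly A P = (\<Sum>k\<le>degree P. Polynomial.monom (if A k then poly.coeff P k else 0) k)"

abbreviation select :: "nat \<Rightarrow> int poly \<Rightarrow> int poly" where
  "select d \<equiv> filter_poly (\<lambda>k. d dvd k)"

lemma coeff_filter_poly: "poly.coeff (filter_poly A P) k = (if A k then poly.coeff P k else 0)"
proof -
  have "poly.coeff (filter_poly A P) k =
      (\<Sum>i\<le>degree P. if i = k then (if A k then poly.coeff P k else 0) else 0)"
    unfolding filter_poly_def coeff_sum by (intro sum.cong refl) (auto simp: coeff_monom)
  thus ?thesis by (auto simp: coeff_eq_0)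
qed

lemma filter_poly_0 [simp]: "filter_poly A 0 = 0"
  and filter_poly_add: "filter_poly A (P + Q) = filter_poly A P + filter_poly A Q"
  and filter_poly_diff: "filter_poly A (P - Q) = filter_poly A P - filter_poly A Q"
  by (auto intro!: poly_eqI simp: coeff_filter_poly)

lemma filter_poly_sum: "filter_poly A (sum f S) = (\<Sum>x\<in>S. filter_poly A (f x))"
  by (induction S rule: infinite_finite_induct) (auto simp: filter_poly_add)

lemma filter_poly_monom: "filter_poly A (Polynomial.monom a k) = (if A k then Polynomial.monom a k else 0)"
  by (auto intro!: poly_eqI simp: coeff_filter_poly coeff_monom)

lemma ev_select_in_int_adjoin: "ev (select d P) z \<in> int_adjoin (z ^ d)"
proof -
  have "ev (select d P) z = (\<Sum>k\<le>degree P. if d dvd k then of_int (poly.coeff P k) * z ^ k else 0)"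
    unfolding filter_poly_def ev_sum by (intro sum.cong refl) auto
  also have "\<dots> \<in> int_adjoin (z ^ d)"
    by (intro int_adjoin_sum) (auto simp: power_mult int_adjoin_power intro!: int_adjoin_mult elim!: dvdE)
  finally show ?thesis .
qed

text \<open>Selecting the exponents divisible by \<open>d\<close> amounts to averaging over the powers
  \<open>z\<^bsup>s\<^esup>\<close> with \<open>s \<equiv> 1 (mod q)\<close>.\<close>

lemma ev_select_average:
  assumes z: "prim_root z m" and m: "m = q * d"
  shows "of_nat d * ev (select d P) z = (\<Sum>i<d. ev P (z ^ (1 + q * i)))"
proof -
  have d: "d > 0" "q > 0" using prim_root_pos [OF z] m by auto
  have mono: "of_nat d * ev (select d (Polynomial.monom a k)) z = (\<Sum>i<d. ev (Polynomial.monom a k) (z ^ (1 + q * i)))"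
    for a k
  proof -
    have "(z ^ (q * k)) ^ d = (z ^ m) ^ k"
      by (simp only: m power_mult [symmetric]) (simp add: mult_ac)
    hence 1: "(z ^ (q * k)) ^ d = 1" using prim_root_power_eq_1 [OF z] by simp
    have 2: "z ^ (q * k) = 1 \<longleftrightarrow> d dvd k"
      using prim_root_power_eq_1_iff [OF z, of "q * k"] d m by simp
    have "(\<Sum>i<d. ev (Polynomial.monom a k) (z ^ (1 + q * i))) =
        of_int a * z ^ k * (\<Sum>i<d. (z ^ (q * k)) ^ i)"
      by (simp add: sum_distrib_left power_mult_distrib power_mult [symmetric] mult_ac)
    also have "\<dots> = of_int a * z ^ k * (if d dvd k then of_nat d else 0)"
      using sum_root_of_unity_powers [OF 1 d(1)] 2 by simp
    finally show ?thesis by (simp add: filter_poly_monom)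
  qed
  have "P = (\<Sum>k\<le>degree P. Polynomial.monom (poly.coeff P k) k)"
    by (rule poly_as_sum_of_monoms [symmetric])
  then obtain c :: "nat \<Rightarrow> int" and n where P: "P = (\<Sum>k\<le>n. Polynomial.monom (c k) k)" by blast
  have "of_nat d * ev (select d P) z = (\<Sum>k\<le>n. of_nat d * ev (select d (Polynomial.monom (c k) k)) z)"
    unfolding P filter_poly_sum ev_sum sum_distrib_left ..
  also have "\<dots> = (\<Sum>i<d. ev P (z ^ (1 + q * i)))"
    unfolding mono P ev_sum by (rule sum.swap)
  finally show ?thesis .
qed

text \<open>In the average over the z^(1 + q i), primitive powers inherit the factorisation of
  \<open>F\<close> by conjugation, and the first factor stays the same since their d-th power is
  z^d. At the other powers both sides vanish because of \<open>K\<close>.\<close>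

lemma ev_select_factor:
  assumes z: "prim_root z m" and m: "m = q * d"
    and K: "\<And>s. coprime s q \<Longrightarrow> \<not> coprime s m \<Longrightarrow> ev K (z ^ s) = 0"
    and F: "ev F z = ev T (z ^ d) * ev G z"
  shows "ev (select d (K * F)) z = ev T (z ^ d) * ev (select d (K * G)) z"
proof -
  have d: "d > 0" "q > 0" using prim_root_pos [OF z] m by auto
  have "ev (K * F) (z ^ (1 + q * i)) = ev T (z ^ d) * ev (K * G) (z ^ (1 + q * i))" for i
  proof (cases "coprime (1 + q * i) m")
    case True
    have "ev F z = ev (pcompose T (Polynomial.monom 1 d) * G) z" by (simp add: F)
    hence "ev F (z ^ (1 + q * i)) = ev (pcompose T (Polynomial.monom 1 d) * G) (z ^ (1 + q * i))"
      by (rule ev_conjugate_cong [OF prim_root_power_eq_1 [OF z] prim_root_pos [OF z] True])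
    moreover have "(z ^ (1 + q * i)) ^ d = z ^ d * (z ^ m) ^ i"
      unfolding m power_mult [symmetric] power_add [symmetric] by (simp add: algebra_simps)
    ultimately show ?thesis using prim_root_power_eq_1 [OF z] by simp
  next
    case False
    have "gcd (q * i + 1) q = 1" by (metis gcd.commute gcd_1_nat gcd_add_mult mult.commute add.commute)
    hence "coprime (1 + q * i) q" by (simp only: coprime_iff_gcd_eq_1 add.commute)
    from K [OF this False] show ?thesis by simp
  qed
  hence "of_nat d * ev (select d (K * F)) z = ev T (z ^ d) * (\<Sum>i<d. ev (K * G) (z ^ (1 + q * i)))"
    unfolding ev_select_average [OF z m] sum_distrib_left by (intro sum.cong refl)
  also have "\<dots> = of_nat d * (ev T (z ^ d) * ev (select d (K * G)) z)"
    unfolding ev_select_average [OF z m, symmetric] by (simp add: mult_ac)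
  finally show ?thesis using d by simp
qed

text \<open>\<open>P\<close> is a polynomial in x^l.\<close>

definition supported :: "nat \<Rightarrow> int poly \<Rightarrow> bool" where
  "supported l P \<longleftrightarrow> (\<forall>k. poly.coeff P k \<noteq> 0 \<longrightarrow> l dvd k)"

lemma supported_0: "supported l 0"
  by (simp add: supported_def)

lemma supported_1: "supported l 1"
  by (auto simp: supported_def coeff_1 split: if_splits)

lemma supported_monom: "l dvd k \<Longrightarrow> supported l (Polynomial.monom a k)"
  by (auto simp: supported_def coeff_monom split: if_splits)

lemma supported_diff: "supported l P \<Longrightarrow> supported l Q \<Longrightarrow> supported l (P - Q)"
  unfolding supported_def by (metis coeff_diff diff_0_right)

lemma supported_add: "supported l P \<Longrightarrow> supported l Q \<Longrightarrow> supported l (P + Q)"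
  unfolding supported_def by (metis add_0 coeff_add)

lemma supported_sum: "(\<And>x. x \<in> S \<Longrightarrow> supported l (f x)) \<Longrightarrow> supported l (sum f S)"
  by (induction S rule: infinite_finite_induct) (auto intro: supported_add supported_0)

lemma supported_mult:
  assumes "supported l P" "supported l Q"
  shows "supported l (P * Q)"
  unfolding supported_def
proof (intro allI impI)
  fix k assume "poly.coeff (P * Q) k \<noteq> 0"
  then obtain i where "i \<le> k" "poly.coeff P i \<noteq> 0" "poly.coeff Q (k - i) \<noteq> 0"
    by (auto simp: coeff_mult elim: sum.not_neutral_contains_not_neutral)
  hence "l dvd i" "l dvd k - i" "i + (k - i) = k" using assms by (simp_all add: supported_def)
  thus "l dvd k" by (metis dvd_add)
qed

lemma supported_prod: "(\<And>x. x \<in> S \<Longrightarrow> supported l (f x)) \<Longrightarrow> supported l (prod f S)"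
  by (induction S rule: infinite_finite_induct) (auto intro: supported_mult supported_1)

lemma supported_dvd: "supported l P \<Longrightarrow> l' dvd l \<Longrightarrow> supported l' P"
  unfolding supported_def using dvd_trans by blast

text \<open>For a prime \<open>p\<close> dividing \<open>m\<close> and \<open>z\<close> of order
  \<open>m\<close>, the factor belonging to \<open>p\<close> vanishes at z^s exactly when
  \<open>p\<close> divides \<open>s\<close>.\<close>

definition kappa :: "nat \<Rightarrow> nat set \<Rightarrow> int poly" where
  "kappa m S = (\<Prod>p\<in>S. 1 - Polynomial.monom 1 (m div p))"

lemma ev_kappa: "ev (kappa m S) z = (\<Prod>p\<in>S. 1 - z ^ (m div p))"
  by (simp add: kappa_def)

lemma supported_kappa: "(\<And>p. p \<in> S \<Longrightarrow> l dvd m div p) \<Longrightarrow> supported l (kappa m S)"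
  unfolding kappa_def by (intro supported_prod supported_diff supported_1 supported_monom) simp

text \<open>If all exponents of \<open>W\<close> are divisible by the full power of \<open>p\<close> in \<open>m\<close>, then those of
  \<open>x\<^bsup>m/p\<^esup> W\<close> are not, so that they are discarded by the selection.\<close>

lemma select_kappa_mult:
  assumes m: "m > 0" and S: "finite S"
    and "\<And>p. p \<in> S \<Longrightarrow> prime p \<and> p dvd m \<and> p ^ multiplicity p m dvd d \<and> supported (p ^ multiplicity p m) W"
  shows "select d (kappa m S * W) = select d W"
  using S assms(3)
proof (induction S rule: finite_induct)
  case empty
  thus ?case by (simp add: kappa_def)
next
  case (insert p S)
  define V where "V = kappa m S * W"
  define N where "N = p ^ multiplicity p m"
  have p: "prime p" "p dvd m" "N dvd d" "supported N W" using insert.prems by (auto simp: N_def)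
  have p': "\<not> is_unit p" "m \<noteq> 0" using p m by auto
  have "supported N (kappa m S)"
  proof (rule supported_kappa)
    fix r assume r: "r \<in> S"
    hence pr: "prime r" "r dvd m" using insert.prems by auto
    have "p \<noteq> r" using r insert.hyps by auto
    hence "coprime p r" using p(1) pr(1) by (simp add: primes_coprime)
    hence "coprime N r" by (simp add: N_def)
    moreover have "N dvd r * (m div r)" using pr by (simp add: N_def multiplicity_dvd)
    ultimately show "N dvd m div r" by (simp add: coprime_dvd_mult_right_iff)
  qed
  hence V: "supported N V" using p unfolding V_def by (intro supported_mult)
  have "select d (Polynomial.monom 1 (m div p) * V) = 0"
  proof (rule poly_eqI)
    fix k
    show "poly.coeff (select d (Polynomial.monom 1 (m div p) * V)) k = poly.coeff 0 k"
    proof (rule ccontr)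
      assume "\<not> ?thesis"
      hence k: "d dvd k" "m div p \<le> k" "poly.coeff V (k - m div p) \<noteq> 0"
        by (auto simp: coeff_filter_poly coeff_monom_mult split: if_splits)
      have "N dvd k - m div p" using V k by (auto simp: supported_def)
      moreover have "N dvd k" using k p dvd_trans by blast
      ultimately have "N dvd m div p" using k(2) by (metis dvd_diff_nat diff_diff_cancel)
      hence "N * p dvd m" using p(2) by (metis dvd_div_mult_self mult_dvd_mono dvd_refl)
      hence "p ^ Suc (multiplicity p m) dvd m" by (simp add: N_def mult.commute)
      thus False using p' by (metis multiplicity_geI Suc_n_not_le_n)
    qed
  qed
  moreover have "kappa m (insert p S) * W = V - Polynomial.monom 1 (m div p) * V"
    using insert.hyps by (simp add: kappa_def V_def algebra_simps)
  ultimately have "select d (kappa m (insert p S) * W) = select d V"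
    by (simp add: filter_poly_diff)
  thus ?case using insert unfolding V_def by auto
qed

text \<open>\<open>ev_select_factor\<close> calls for factors at all primes of \<open>m\<close>
  outside \<open>q\<close>. Those not dividing \<open>M\<close> (the set \<open>S'\<close>) have
  their full power in both \<open>l\<close> and \<open>d\<close>, so
  \<open>select_kappa_mult\<close> removes them again; only the factors for \<open>S\<close> remain
  to be paid for.\<close>

lemma rdvd_select:
  assumes z: "prim_root z m" and m: "m = q * d" and M: "m = M * l" "q dvd M"
    and F: "supported l F" "ev F z = ev T (z ^ d) * y" "y \<in> int_adjoin z"
    and S: "S = {p. prime p \<and> p dvd M \<and> \<not> p dvd q}"
  shows "rdvd (z ^ d) (ev T (z ^ d)) (ev (select d (kappa m S * F)) z)"
proof -
  have m0: "m > 0" using z by (rule prim_root_pos)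
  have pos: "M > 0" "l > 0" "q > 0" "d > 0" using m0 m M(1) by (metis mult_is_0 gr0I)+
  define S' where "S' = {p. prime p \<and> p dvd m \<and> \<not> p dvd M}"
  have finS: "finite S" by (rule finite_subset [of _ "{p. p dvd M}"]) (use S pos in auto)
  have finS': "finite S'" by (rule finite_subset [of _ "{p. p dvd m}"]) (use m0 in \<open>auto simp: S'_def\<close>)
  define K where "K = kappa m S' * kappa m S"
  have K: "ev K (z ^ s) = 0" if s: "coprime s q" "\<not> coprime s m" for s
  proof -
    obtain p where p: "prime p" "p dvd s" "p dvd m"
      using s(2) prime_factor_nat [of "gcd s m"] by (metis coprime_iff_gcd_eq_1 gcd_greatest_iff)
    have "\<not> p dvd q" using s(1) p by (meson coprime_common_divisor not_prime_unit)
    hence pS: "p \<in> S' \<union> S" using p S by (auto simp: S'_def)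
    have "m dvd s * (m div p)" using p by (metis dvd_div_mult_self dvd_mult mult.commute mult_dvd_mono dvd_refl)
    hence "(z ^ s) ^ (m div p) = 1"
      using prim_root_power_eq_1_iff [OF z] by (simp add: power_mult [symmetric])
    hence "ev (kappa m S') (z ^ s) = 0 \<or> ev (kappa m S) (z ^ s) = 0"
      using pS finS finS' by (auto simp: ev_kappa)
    thus ?thesis by (auto simp: K_def)
  qed
  obtain G where G: "y = ev G z" using F(3) by (rule int_adjoinE)
  have "ev (select d (K * F)) z = ev T (z ^ d) * ev (select d (K * G)) z"
    by (rule ev_select_factor [OF z m K]) (use F G in auto)
  hence "rdvd (z ^ d) (ev T (z ^ d)) (ev (select d (K * F)) z)"
    by (intro rdvdI [of "ev (select d (K * G)) z"] ev_select_in_int_adjoin)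
  moreover have "select d (kappa m S' * (kappa m S * F)) = select d (kappa m S * F)"
  proof (rule select_kappa_mult [OF m0 finS'])
    fix p assume "p \<in> S'"
    hence p: "prime p" "p dvd m" "\<not> p dvd M" by (auto simp: S'_def)
    have "coprime p M" using p by (simp add: prime_imp_coprime)
    hence cop: "coprime (p ^ multiplicity p m) M" by simp
    have "p ^ multiplicity p m dvd M * l" using M by (simp add: multiplicity_dvd)
    hence l: "p ^ multiplicity p m dvd l" using cop by (simp add: coprime_dvd_mult_right_iff)
    have "coprime (p ^ multiplicity p m) q" using cop M(2) by (meson coprime_divisors dvd_refl)
    moreover have "p ^ multiplicity p m dvd q * d" using m by (simp add: multiplicity_dvd)
    ultimately have d: "p ^ multiplicity p m dvd d" by (simp add: coprime_dvd_mult_right_iff)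
    have "supported l (kappa m S)"
    proof (rule supported_kappa)
      fix r assume "r \<in> S"
      hence "r dvd M" "r > 0" using S by (auto simp: prime_gt_0_nat)
      then obtain e where "M = r * e" by (elim dvdE)
      hence "m div r = e * l" using M \<open>r > 0\<close> by simp
      thus "l dvd m div r" by simp
    qed
    hence "supported l (kappa m S * F)" using F by (intro supported_mult)
    thus "prime p \<and> p dvd m \<and> p ^ multiplicity p m dvd d \<and>
        supported (p ^ multiplicity p m) (kappa m S * F)"
      using p d l supported_dvd by blast
  qed
  ultimately show ?thesis by (simp add: K_def mult.assoc)
qed

text \<open>Split \<open>F\<close> by the residues of its exponents modulo \<open>d\<close>. Some
  part has nonzero value, and a monomial moves its residue to 0.\<close>

lemma select_nonzero:
  assumes "supported l F" "ev F z \<noteq> 0" "d > 0" "z \<noteq> 0"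
  shows "\<exists>g. l dvd g \<and> ev (select d (Polynomial.monom 1 g * F)) z \<noteq> 0"
proof -
  have "F = (\<Sum>r<d. filter_poly (\<lambda>k. k mod d = r) F)"
    using assms(3) by (intro poly_eqI) (simp add: coeff_sum coeff_filter_poly)
  hence "ev F z = (\<Sum>r<d. ev (filter_poly (\<lambda>k. k mod d = r) F) z)" by (metis ev_sum)
  then obtain r where r: "ev (filter_poly (\<lambda>k. k mod d = r) F) z \<noteq> 0"
    using assms(2) by (metis (no_types, lifting) sum.neutral)
  hence "filter_poly (\<lambda>k. k mod d = r) F \<noteq> 0" by auto
  then obtain k where "poly.coeff (filter_poly (\<lambda>k. k mod d = r) F) k \<noteq> 0"
    by (metis leading_coeff_0_iff)
  hence k: "k mod d = r" "poly.coeff F k \<noteq> 0" by (auto simp: coeff_filter_poly split: if_splits)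
  \<comment> \<open>Modulo \<open>d\<close> this is -k, written without subtraction; as a multiple
    of \<open>k\<close> it is also a multiple of \<open>l\<close>.\<close>
  define g where "g = (d - 1) * k"
  have "l dvd g" using assms(1) k by (simp add: g_def supported_def)
  have gk: "d dvd g + i \<longleftrightarrow> i mod d = r" for i
  proof -
    have "g + k = d * k" using assms(3) by (simp add: g_def diff_mult_distrib)
    hence "[g + k = 0] (mod d)" by (simp add: cong_0_iff)
    hence "[g + i = 0] (mod d) \<longleftrightarrow> [g + i = g + k] (mod d)"
      by (meson cong_sym cong_trans)
    also have "\<dots> \<longleftrightarrow> [i = k] (mod d)" by (simp add: cong_add_lcancel_nat)
    finally show ?thesis using k by (simp only: cong_0_iff) (simp add: cong_def)
  qed
  have "select d (Polynomial.monom 1 g * F) = Polynomial.monom 1 g * filter_poly (\<lambda>k. k mod d = r) F"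
  proof (rule poly_eqI)
    fix i
    show "poly.coeff (select d (Polynomial.monom 1 g * F)) i =
        poly.coeff (Polynomial.monom 1 g * filter_poly (\<lambda>k. k mod d = r) F) i"
      using gk [of "i - g"] by (auto simp: coeff_filter_poly coeff_monom_mult)
  qed
  hence "ev (select d (Polynomial.monom 1 g * F)) z \<noteq> 0" using r assms(4) by auto
  thus ?thesis using \<open>l dvd g\<close> by blast
qed

section \<open>Coefficients modulo x^m - 1, Parseval and the size estimate\<close>

text \<open>The coefficient at x^j of the image of \<open>P\<close> in Z[x]/(x^m - 1).\<close>

definition class_sum :: "nat \<Rightarrow> int poly \<Rightarrow> nat \<Rightarrow> int" where
  "class_sum m P j = (\<Sum>k\<le>degree P. if [k = j] (mod m) then poly.coeff P k else 0)"

lemma class_sum_eq: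
  assumes "degree P \<le> n"
  shows "class_sum m P j = (\<Sum>k\<le>n. if [k = j] (mod m) then poly.coeff P k else 0)"
  unfolding class_sum_def
  by (rule sum.mono_neutral_left) (use assms in \<open>auto simp: coeff_eq_0\<close>)

lemma class_sum_cong: "[i = j] (mod m) \<Longrightarrow> class_sum m P i = class_sum m P j"
  unfolding class_sum_def by (intro sum.cong refl) (meson cong_sym cong_trans)

lemma class_sum_diff: "class_sum m (P - Q) j = class_sum m P j - class_sum m Q j"
proof -
  define n where "n = max (degree P) (degree Q)"
  have "degree P \<le> n" "degree Q \<le> n" "degree (P - Q) \<le> n"
    by (auto simp: n_def degree_diff_le_max)
  thus ?thesis
    by (simp add: class_sum_eq [where n = n] sum_subtractf [symmetric] if_distrib cong: if_cong)
qed

lemma class_sum_monom_mult: "class_sum m (Polynomial.monom 1 a * P) (a + j) = class_sum m P j"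
proof -
  define f where "f = (\<lambda>k. if [k = a + j] (mod m) then poly.coeff (Polynomial.monom 1 a * P) k else 0)"
  have "degree (Polynomial.monom 1 a * P) \<le> a + degree P"
    using degree_mult_le [of "Polynomial.monom 1 a" P] degree_monom_le [of "1::int" a] by linarith
  hence "class_sum m (Polynomial.monom 1 a * P) (a + j) = (\<Sum>k\<le>a + degree P. f k)"
    unfolding f_def by (rule class_sum_eq)
  also have "\<dots> = (\<Sum>k\<in>{a..a + degree P}. f k)"
    by (rule sum.mono_neutral_right) (auto simp: f_def coeff_monom_mult)
  also have "\<dots> = (\<Sum>k\<le>degree P. f (a + k))"
    by (rule sum.reindex_bij_witness [of _ "\<lambda>k. a + k" "\<lambda>k. k - a"]) auto
  also have "\<dots> = class_sum m P j"
    unfolding class_sum_def f_def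
    by (intro sum.cong refl) (simp add: coeff_monom_mult cong_add_lcancel_nat)
  finally show ?thesis .
qed

text \<open>\<open>(m - 1) * a\<close> stands for -a modulo \<open>m\<close>.\<close>

lemma class_sum_monom_mult':
  assumes "m > 0"
  shows "class_sum m (Polynomial.monom 1 a * P) j = class_sum m P (j + (m - 1) * a)"
proof -
  have "a + (j + (m - 1) * a) = j + m * a" using assms by (cases m) auto
  hence "[j = a + (j + (m - 1) * a)] (mod m)" by (simp only: cong_def mod_mult_self2)
  hence "class_sum m (Polynomial.monom 1 a * P) j =
      class_sum m (Polynomial.monom 1 a * P) (a + (j + (m - 1) * a))" by (rule class_sum_cong)
  thus ?thesis by (simp only: class_sum_monom_mult)
qed

lemma class_sum_monom: "class_sum m (Polynomial.monom 1 a) j = (if [a = j] (mod m) then 1 else 0)"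
proof -
  have "class_sum m (Polynomial.monom 1 a) j = (\<Sum>k\<le>a. if k = a then (if [a = j] (mod m) then 1 else 0) else 0)"
    unfolding class_sum_def by (intro sum.cong) (auto simp: degree_monom_eq coeff_monom)
  thus ?thesis by simp
qed

lemma class_sum_0: "class_sum m 0 j = 0"
  using class_sum_diff [of m 0 0 j] by simp

lemma class_sum_add: "class_sum m (P + Q) j = class_sum m P j + class_sum m Q j"
  using class_sum_diff [of m "P + Q" Q j] by simp

lemma class_sum_sum: "class_sum m (sum f S) j = (\<Sum>x\<in>S. class_sum m (f x) j)"
  by (induction S rule: infinite_finite_induct) (auto simp: class_sum_0 class_sum_add)

lemma ev_select_class_sum:
  assumes z: "prim_root z m" and m: "m = q * d"
  shows "ev (select d P) z = (\<Sum>i<q. of_int (class_sum m P (d * i)) * (z ^ d) ^ i)"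
proof -
  have pos: "d > 0" "q > 0" using prim_root_pos [OF z] m by auto
  define g where "g = (\<lambda>k i. if [k = d * i] (mod m) then of_int (poly.coeff P k) * (z ^ d) ^ i else 0)"
  have inner: "(\<Sum>i<q. g k i) = (if d dvd k then of_int (poly.coeff P k) * z ^ k else 0)" for k
  proof (cases "d dvd k")
    case True
    then obtain e where k: "k = d * e" by (elim dvdE)
    have "[k = d * i] (mod m) \<longleftrightarrow> i = e mod q" if "i < q" for i
    proof -
      have "[k = d * i] (mod m) \<longleftrightarrow> [e = i] (mod q)"
        unfolding k m using pos by (simp add: cong_def mult_mod_right [symmetric] mult.commute [of q d])
      thus ?thesis using that by (auto simp: cong_def)
    qed
    hence "(\<Sum>i<q. g k i) = (\<Sum>i<q. if i = e mod q then of_int (poly.coeff P k) * (z ^ d) ^ i else 0)"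
      unfolding g_def by (intro sum.cong refl) auto
    also have "\<dots> = of_int (poly.coeff P k) * (z ^ d) ^ (e mod q)" using pos by simp
    also have "(z ^ d) ^ (e mod q) = z ^ k"
    proof -
      have "(z ^ d) ^ q = 1" using prim_root_power_eq_1 [OF z] m by (simp add: power_mult [symmetric] mult.commute)
      from root_of_unity_power_mod [OF this, of e] show ?thesis by (simp add: k power_mult)
    qed
    finally show ?thesis using True by simp
  next
    case False
    have "\<not> [k = d * i] (mod m)" for i
    proof
      assume "[k = d * i] (mod m)"
      hence "[k = d * i] (mod d)" using m by (meson cong_dvd_modulus_nat dvd_triv_right)
      thus False using False by (simp add: cong_def mod_eq_0_iff_dvd [symmetric])
    qed
    thus ?thesis using False by (simp add: g_def)
  qed
  have "(\<Sum>i<q. of_int (class_sum m P (d * i)) * (z ^ d) ^ i) = (\<Sum>i<q. \<Sum>k\<le>degree P. g k i)"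
    unfolding class_sum_def g_def of_int_sum sum_distrib_right by (intro sum.cong refl) auto
  also have "\<dots> = (\<Sum>k\<le>degree P. \<Sum>i<q. g k i)" by (rule sum.swap)
  also have "\<dots> = ev (select d P) z"
    unfolding inner filter_poly_def ev_sum by (intro sum.cong refl) auto
  finally show ?thesis by simp
qed

text \<open>The factor 2 is lost for all but one of the factors of \<open>kappa\<close>, as the difference of two
  numbers in \<open>[0, C]\<close> is still bounded by \<open>C\<close>.\<close>

lemma class_sum_kappa_bound:
  assumes m: "m > 0" and "finite S" and F: "\<And>j. 0 \<le> class_sum m F j \<and> class_sum m F j \<le> C"
  shows "\<bar>class_sum m (kappa m S * F) j\<bar> \<le> 2 ^ (card S - 1) * C"
  using assms(2)
proof (induction S arbitrary: j rule: finite_induct)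
  case empty
  thus ?case using F [of j] by (simp add: kappa_def)
next
  case (insert p S)
  define V where "V = kappa m S * F"
  have "kappa m (insert p S) * F = V - Polynomial.monom 1 (m div p) * V"
    using insert.hyps by (simp add: kappa_def V_def algebra_simps)
  hence eq: "class_sum m (kappa m (insert p S) * F) j =
      class_sum m V j - class_sum m V (j + (m - 1) * (m div p))"
    by (simp add: class_sum_diff class_sum_monom_mult' [OF m])
  show ?case
  proof (cases "S = {}")
    case True
    hence "V = F" by (simp add: V_def kappa_def)
    thus ?thesis using eq F [of j] F [of "j + (m - 1) * (m div p)"] True
      by (simp only: abs_le_iff) simp
  next
    case False
    then obtain n where n: "card S = Suc n" using insert.hyps by (cases "card S") auto
    have "\<bar>class_sum m V i\<bar> \<le> 2 ^ n * C" for i using insert.IH [of i] n by (simp add: V_def)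
    from this [of j] this [of "j + (m - 1) * (m div p)"] show ?thesis
      unfolding eq using insert.hyps n by simp
  qed
qed

text \<open>The index range \<open>{0<..q}\<close> is chosen because it contains
  \<open>totatives q\<close>.\<close>

lemma parseval:
  assumes z: "prim_root z q"
  shows "(\<Sum>s\<in>{0<..q}. (cmod (\<Sum>i<q. of_int (H i) * (z ^ s) ^ i))\<^sup>2) = real q * (\<Sum>i<q. (real_of_int (H i))\<^sup>2)"
proof -
  have q: "q > 0" using z by (rule prim_root_pos)
  have z0: "z \<noteq> 0" using z by (rule prim_root_nonzero)
  have orth: "(\<Sum>s\<in>{0<..q}. (z ^ i * cnj z ^ j) ^ s) = (if i = j then of_nat q else 0)"
    if "i < q" "j < q" for i j
  proof -
    define w where "w = z ^ i * cnj z ^ j"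
    have cz: "z ^ j * cnj z ^ j = 1" using prim_root_mult_cnj [OF z] by (metis power_mult_distrib power_one)
    have "w ^ q = (z ^ q) ^ i * (cnj (z ^ q)) ^ j"
      unfolding w_def power_mult_distrib complex_cnj_power by (simp only: power_mult [symmetric] mult.commute)
    hence wq: "w ^ q = 1" using prim_root_power_eq_1 [OF z] by simp
    have "w = 1 \<longleftrightarrow> z ^ i = z ^ j"
    proof
      assume "w = 1"
      hence "z ^ i * (z ^ j * cnj z ^ j) = z ^ j" unfolding w_def by (metis mult.assoc mult.commute mult.right_neutral)
      thus "z ^ i = z ^ j" by (simp add: cz)
    qed (use cz in \<open>simp add: w_def\<close>)
    hence w1: "w = 1 \<longleftrightarrow> i = j"
      using that prim_root_power_eq_iff [OF z, of i j] by (auto simp: cong_def)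
    have "(\<Sum>s\<in>{0<..q}. w ^ s) = (\<Sum>s<q. w ^ Suc s)"
      by (rule sum.reindex_bij_witness [of _ Suc "\<lambda>s. s - 1"]) auto
    also have "\<dots> = w * (\<Sum>s<q. w ^ s)" by (simp add: sum_distrib_left)
    also have "\<dots> = (if i = j then of_nat q else 0)"
      using sum_root_of_unity_powers [OF wq q] w1 by simp
    finally show ?thesis by (simp add: w_def)
  qed
  have "complex_of_real (\<Sum>s\<in>{0<..q}. (cmod (\<Sum>i<q. of_int (H i) * (z ^ s) ^ i))\<^sup>2) =
      (\<Sum>s\<in>{0<..q}. (\<Sum>i<q. of_int (H i) * (z ^ s) ^ i) * (\<Sum>j<q. of_int (H j) * (cnj z ^ s) ^ j))"
    by (simp add: complex_norm_square del: of_real_power)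
  also have "\<dots> = (\<Sum>s\<in>{0<..q}. \<Sum>i<q. \<Sum>j<q. of_int (H i) * of_int (H j) * (z ^ i * cnj z ^ j) ^ s)"
    unfolding sum_product
    by (intro sum.cong refl) (simp add: power_mult_distrib power_mult [symmetric] mult_ac)
  also have "\<dots> = (\<Sum>i<q. \<Sum>s\<in>{0<..q}. \<Sum>j<q. of_int (H i) * of_int (H j) * (z ^ i * cnj z ^ j) ^ s)"
    by (rule sum.swap)
  also have "\<dots> = (\<Sum>i<q. \<Sum>j<q. \<Sum>s\<in>{0<..q}. of_int (H i) * of_int (H j) * (z ^ i * cnj z ^ j) ^ s)"
    by (intro sum.cong refl sum.swap)
  also have "\<dots> = (\<Sum>i<q. \<Sum>j<q. if i = j then of_int (H i) * of_int (H j) * of_nat q else 0)"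
    unfolding sum_distrib_left [symmetric]
    by (intro sum.cong refl) (simp add: orth)
  also have "\<dots> = (\<Sum>i<q. of_int (H i) * of_int (H i) * of_nat q)" by simp
  also have "\<dots> = complex_of_real (real q * (\<Sum>i<q. (real_of_int (H i))\<^sup>2))"
    by (simp add: sum_distrib_left power2_eq_square mult_ac)
  finally show ?thesis by (simp only: of_real_eq_iff)
qed

text \<open>The conjugates of \<open>y \<cdot> cnj y / N\<close> are nonnegative, so their sum is at least \<open>totient q\<close>, while
  Parseval's identity bounds it from above.\<close>

lemma divisibility_coefficient_bound:
  assumes z: "prim_root z q" and y: "y = (\<Sum>i<q. of_int (H i) * z ^ i)" "y \<noteq> 0"
    and H: "\<And>i. i < q \<Longrightarrow> \<bar>H i\<bar> \<le> B" and N: "N > 0" and dv: "rdvd z (of_nat N) (y * cnj y)"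
  shows "real N * real (totient q) \<le> (real q)\<^sup>2 * (real_of_int B)\<^sup>2"
proof -
  have q: "q > 0" and z1: "z ^ q = 1" using z by (auto simp: prim_root_def)
  define P where "P = (\<Sum>i<q. Polynomial.monom (H i) i)"
  have P: "ev P x = (\<Sum>i<q. of_int (H i) * x ^ i)" for x by (simp add: P_def)
  \<comment> \<open>On q-th roots of unity x^(q - 1) is the complex conjugate of x, so
    \<open>P'\<close> represents the conjugate as a polynomial value and the relation for
    \<open>y * cnj y\<close> can be moved to z^s.\<close>
  define P' where "P' = pcompose P (Polynomial.monom 1 (q - 1))"
  obtain c where c: "c \<in> int_adjoin z" "y * cnj y = of_nat N * c" using dv by (rule rdvdE)
  obtain X where X: "c = ev X z" using c(1) by (rule int_adjoinE)
  have conj: "ev P (z ^ s) * cnj (ev P (z ^ s)) = of_nat N * ev X (z ^ s)" if "coprime s q" for s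
  proof -
    have cz: "cnj (z ^ s) = (z ^ s) ^ (q - 1)" for s
      using prim_root_cnj [OF z] by (simp add: power_mult [symmetric] mult.commute)
    have cP: "cnj (ev P (z ^ s)) = ev P' (z ^ s)" for s
      unfolding P'_def cnj_ev by (simp add: cz [simplified])
    have "ev (P * P') z = ev ([:int N:] * X) z"
      using c X cP [of 1] y(1) unfolding ev_mult by (simp add: P [of z, symmetric])
    from ev_conjugate_cong [OF z1 q that this] show ?thesis unfolding cP ev_mult by simp
  qed
  define Y where "Y = (\<lambda>s. (cmod (ev P (z ^ s)))\<^sup>2 / real N)"
  have "real (totient q) \<le> (\<Sum>s\<in>totatives q. Y s)"
  proof (rule sum_conjugates_ge_totient [OF z1 q])
    show "ev X z \<noteq> 0" using c(2) X y(2) by (metis complex_cnj_zero_iff mult_eq_0_iff)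
    fix s assume s: "s \<in> totatives q"
    have "complex_of_real ((cmod (ev P (z ^ s)))\<^sup>2) = of_nat N * ev X (z ^ s)"
      using conj [of s] s by (simp add: complex_norm_square in_totatives_iff del: of_real_power)
    hence "ev X (z ^ s) = complex_of_real (Y s)" using N by (simp add: Y_def field_simps)
    thus "ev X (z ^ s) = complex_of_real (Y s) \<and> 0 \<le> Y s" by (simp add: Y_def)
  qed
  also have "\<dots> \<le> (\<Sum>s\<in>{0<..q}. Y s)"
    by (intro sum_mono2 totatives_subset) (auto simp: Y_def)
  also have "\<dots> = (\<Sum>s\<in>{0<..q}. (cmod (ev P (z ^ s)))\<^sup>2) / real N" by (simp add: Y_def sum_divide_distrib)
  also have "(\<Sum>s\<in>{0<..q}. (cmod (ev P (z ^ s)))\<^sup>2) = real q * (\<Sum>i<q. (real_of_int (H i))\<^sup>2)"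
    unfolding P by (rule parseval [OF z])
  finally have "real N * real (totient q) \<le> real q * (\<Sum>i<q. (real_of_int (H i))\<^sup>2)"
    using N by (simp add: field_simps)
  also have "\<dots> \<le> real q * (\<Sum>i<q. (real_of_int B)\<^sup>2)"
  proof (intro mult_left_mono sum_mono)
    fix i assume "i \<in> {..<q}"
    hence "\<bar>real_of_int (H i)\<bar> \<le> real_of_int B" using H [of i] by (metis lessThan_iff of_int_abs of_int_le_iff)
    thus "(real_of_int (H i))\<^sup>2 \<le> (real_of_int B)\<^sup>2" using abs_le_square_iff by force
  qed auto
  also have "\<dots> = (real q)\<^sup>2 * (real_of_int B)\<^sup>2" by (simp add: power2_eq_square)
  finally show ?thesis .
qed

section \<open>The sequence of a BH matrix and the divisibility of its segments\<close>

lemma sum_periodic_shift: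
  fixes f :: "nat \<Rightarrow> 'a::ab_group_add"
  assumes "\<And>x. f (x + n) = f x"
  shows "(\<Sum>r<n. f (y + r)) = (\<Sum>x<n. f x)"
proof (induction y)
  case (Suc y)
  have "f y + (\<Sum>r<n. f (Suc y + r)) = (\<Sum>r<Suc n. f (y + r))"
    by (subst sum.lessThan_Suc_shift) simp
  also have "\<dots> = (\<Sum>r<n. f (y + r)) + f (y + n)" by simp
  finally show ?case using Suc assms by simp
qed simp

lemma sum_segments:
  fixes f :: "nat \<Rightarrow> 'a::comm_monoid_add"
  assumes "v > 0"
  shows "(\<Sum>x<u * v. f x) = (\<Sum>y<v. \<Sum>c<u. f (y + v * c))"
proof -
  have "(\<Sum>y<v. \<Sum>c<u. f (y + v * c)) = (\<Sum>(y, c)\<in>{..<v} \<times> {..<u}. f (y + v * c))"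
    by (simp add: sum.cartesian_product)
  also have "\<dots> = (\<Sum>x<u * v. f x)"
  proof (rule sum.reindex_bij_witness [of _ "\<lambda>x. (x mod v, x div v)" "\<lambda>(y, c). y + v * c"])
    fix a assume "a \<in> {..<v} \<times> {..<u}"
    then obtain y c where a: "a = (y, c)" "y < v" "c < u" by auto
    have "y + v * c < v * Suc c" using a by simp
    also have "v * Suc c \<le> v * u" using a by (intro mult_le_mono2) simp
    finally show "(case a of (y, c) \<Rightarrow> y + v * c) \<in> {..<u * v}" using a by (simp add: mult.commute)
  qed (use assms in \<open>auto simp: less_mult_imp_div_less\<close>)
  finally show ?thesis by simp
qed

lemma prim_root_power_repr:
  assumes z: "prim_root z n" and w: "w ^ n = 1"
  shows "\<exists>i. w = z ^ i"
proof -
  have "(\<Prod>i<n. w - z ^ i) = w ^ n - 1"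
    using arg_cong [OF prod_prim_root_poly [OF z], of "\<lambda>P. poly P w"] by (simp add: poly_prod poly_power)
  hence "(\<Prod>i<n. w - z ^ i) = 0" using w by simp
  thus ?thesis by (auto simp: prod_zero_iff)
qed

text \<open>\<open>b\<close> is the first row, continued periodically to the natural numbers, and
  \<open>flat\<close> is H H* = n I seen through the characters of Z_n. The order lcm(n, h) of
  \<open>z\<close> lets one root generate both the character values and the entries.\<close>

locale bh_sequence =
  fixes n h m :: nat and b :: "nat \<Rightarrow> complex" and z :: complex
  assumes n: "n > 0" and h: "h > 0" and m: "m = lcm n h" and z: "prim_root z m"
    and b_root: "b x ^ h = 1"
    and b_periodic: "b (x + n) = b x"
    and flat: "w ^ n = 1 \<Longrightarrow> (\<Sum>x<n. b x * w ^ x) * cnj (\<Sum>x<n. b x * w ^ x) = of_nat n"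
begin

lemma m_pos: "m > 0"
  using n h by (simp add: m lcm_pos_nat)

lemma n_dvd_m: "n dvd m" and h_dvd_m: "h dvd m"
  by (simp_all add: m)

definition ex :: "nat \<Rightarrow> nat" where
  "ex x = (SOME i. b x = (z ^ (m div h)) ^ i)"

lemma prim_root_h: "prim_root (z ^ (m div h)) h"
  using z by (rule prim_root_power_divisor) (use h_dvd_m in simp)

lemma b_eq: "b x = (z ^ (m div h)) ^ ex x"
  unfolding ex_def using prim_root_power_repr [OF prim_root_h b_root [of x]] by (rule someI_ex)

lemma b_in_int_adjoin: "b x \<in> int_adjoin z"
  by (subst b_eq) (rule int_adjoin_power [OF int_adjoin_power [OF int_adjoin_self]])

definition segment :: "nat \<Rightarrow> nat \<Rightarrow> nat \<Rightarrow> complex" where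
  "segment u v y = (\<Sum>c<u. b (y + v * c) * (z ^ (m div u)) ^ c)"

lemma segment_in_int_adjoin: "segment u v y \<in> int_adjoin z"
proof -
  have "b (y + v * c) * (z ^ (m div u)) ^ c \<in> int_adjoin z" for c
    by (rule int_adjoin_mult [OF b_in_int_adjoin int_adjoin_power [OF int_adjoin_power [OF int_adjoin_self]]])
  thus ?thesis unfolding segment_def by (rule int_adjoin_sum)
qed

lemma segment_eq:
  assumes "n = u * v"
  shows "(\<Sum>c<u. b (y + v * c) * (z ^ (m div n)) ^ (y + v * c)) = (z ^ (m div n)) ^ y * segment u v y"
proof -
  have u: "u > 0" "v > 0" using n assms by auto
  obtain e where e: "m = n * e" using n_dvd_m by (elim dvdE)
  hence "m div n * v = m div u" using assms u by (simp add: mult_ac)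
  hence "(z ^ (m div n)) ^ (v * c) = (z ^ (m div u)) ^ c" for c
    by (simp add: power_mult [symmetric] mult.assoc [symmetric])
  thus ?thesis unfolding segment_def by (simp add: sum_distrib_left power_add mult_ac)
qed

text \<open>If all segments vanished, so would a character sum of squared modulus
  \<open>n\<close>.\<close>

lemma segment_nonzero:
  assumes "n = u * v"
  shows "\<exists>y<v. segment u v y \<noteq> 0"
proof (rule ccontr)
  assume "\<not> ?thesis"
  hence 0: "segment u v y = 0" if "y < v" for y using that by auto
  have v: "v > 0" using n assms by auto
  define w where "w = z ^ (m div n)"
  have "prim_root w n" unfolding w_def using z by (rule prim_root_power_divisor) (use n_dvd_m in simp)
  hence w: "w ^ n = 1" by (rule prim_root_power_eq_1)
  have "(\<Sum>x<n. b x * w ^ x) = (\<Sum>y<v. \<Sum>c<u. b (y + v * c) * w ^ (y + v * c))"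
    unfolding assms by (rule sum_segments [OF v])
  also have "\<dots> = 0" unfolding w_def segment_eq [OF assms] using 0 by simp
  finally show False using flat [OF w] n by simp
qed

text \<open>The characters w^(1 + u i) agree up to characters that see only the index modulo
  \<open>v\<close>; orthogonality of the latter isolates the indices congruent to
  \<open>y\<close>.\<close>

lemma segment_average:
  assumes nuv: "n = u * v" and y: "y < v"
  defines "w \<equiv> z ^ (m div n)"
  shows "of_nat v * (w ^ y * segment u v y) =
    (\<Sum>i<v. cnj (w ^ y) ^ (u * i) * (\<Sum>x<n. b x * (w ^ (1 + u * i)) ^ x))"
proof -
  have u: "u > 0" "v > 0" using n nuv by auto
  have w: "prim_root w n" unfolding w_def using z by (rule prim_root_power_divisor) (use n_dvd_m in simp)
  have w1: "w ^ n = 1" using w by (rule prim_root_power_eq_1)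
  have cw: "w ^ k * cnj w ^ k = 1" for k
    using prim_root_mult_cnj [OF w] by (metis power_mult_distrib power_one)
  have orth: "(\<Sum>i<v. cnj (w ^ y) ^ (u * i) * (w ^ (y' + v * c)) ^ (u * i)) = (if y' = y then of_nat v else 0)"
    if "y' < v" for y' c
  proof -
    define s where "s = (cnj w ^ y * w ^ y') ^ u"
    have wuv: "(w ^ (v * c)) ^ (u * i) = 1" for i
    proof -
      have "(w ^ (v * c)) ^ (u * i) = (w ^ n) ^ (c * i)"
        unfolding power_mult [symmetric] nuv by (simp add: mult_ac)
      thus ?thesis by (simp add: w1)
    qed
    have eq: "cnj (w ^ y) ^ (u * i) * (w ^ (y' + v * c)) ^ (u * i) = s ^ i" for i
      unfolding power_add power_mult_distrib wuv s_def by (simp add: power_mult power_mult_distrib)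
    have "s ^ v = (cnj w ^ y * w ^ y') ^ n" unfolding s_def nuv by (simp add: power_mult)
    also have "\<dots> = (cnj (w ^ n)) ^ y * (w ^ n) ^ y'"
      unfolding power_mult_distrib complex_cnj_power by (simp only: power_mult [symmetric] mult.commute)
    finally have sv: "s ^ v = 1" using w1 by simp
    have "s = 1 \<longleftrightarrow> w ^ (u * y') = w ^ (u * y)"
    proof -
      have s_eq: "s = cnj w ^ (u * y) * w ^ (u * y')"
        unfolding s_def power_mult_distrib by (simp add: power_mult [symmetric] mult.commute)
      show ?thesis
      proof
        assume "s = 1"
        hence "w ^ (u * y) * (cnj w ^ (u * y) * w ^ (u * y')) = w ^ (u * y)" using s_eq by simp
        thus "w ^ (u * y') = w ^ (u * y)" using cw [of "u * y"] by (simp add: mult.assoc [symmetric])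
      next
        assume "w ^ (u * y') = w ^ (u * y)"
        thus "s = 1" using cw [of "u * y"] s_eq by (simp add: mult.commute)
      qed
    qed
    also have "\<dots> \<longleftrightarrow> [u * y' = u * y] (mod u * v)" using prim_root_power_eq_iff [OF w] nuv by simp
    also have "\<dots> \<longleftrightarrow> y' = y" using that y u by (auto simp: cong_def)
    finally show ?thesis unfolding eq using sum_root_of_unity_powers [OF sv u(2)] by simp
  qed
  have pw: "(w ^ (1 + u * i)) ^ x = w ^ x * (w ^ x) ^ (u * i)" for i x
    unfolding power_mult [symmetric] power_add [symmetric] by (simp add: algebra_simps)
  have "(\<Sum>i<v. cnj (w ^ y) ^ (u * i) * (\<Sum>x<n. b x * (w ^ (1 + u * i)) ^ x)) =
      (\<Sum>i<v. \<Sum>x<n. b x * w ^ x * (cnj (w ^ y) ^ (u * i) * (w ^ x) ^ (u * i)))"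
    unfolding sum_distrib_left by (intro sum.cong refl) (simp only: pw, simp only: mult_ac)
  also have "\<dots> = (\<Sum>x<n. b x * w ^ x * (\<Sum>i<v. cnj (w ^ y) ^ (u * i) * (w ^ x) ^ (u * i)))"
    unfolding sum_distrib_left by (rule sum.swap)
  also have "\<dots> = (\<Sum>y'<v. \<Sum>c<u. b (y' + v * c) * w ^ (y' + v * c) *
      (\<Sum>i<v. cnj (w ^ y) ^ (u * i) * (w ^ (y' + v * c)) ^ (u * i)))"
    unfolding nuv by (rule sum_segments [OF u(2)])
  also have "\<dots> = (\<Sum>y'<v. \<Sum>c<u. b (y' + v * c) * w ^ (y' + v * c) * (if y' = y then of_nat v else 0))"
    by (intro sum.cong refl) (simp only: orth lessThan_iff)
  also have "\<dots> = (\<Sum>y'<v. if y' = y then (\<Sum>c<u. b (y' + v * c) * w ^ (y' + v * c)) * of_nat v else 0)"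
    by (intro sum.cong refl) (simp add: sum_distrib_right)
  also have "\<dots> = (\<Sum>c<u. b (y + v * c) * w ^ (y + v * c)) * of_nat v" using y by simp
  also have "\<dots> = of_nat v * (w ^ y * segment u v y)" unfolding w_def segment_eq [OF nuv] by simp
  finally show ?thesis by simp
qed

text \<open>The theta of the overview.\<close>

definition root_ideal :: "nat \<Rightarrow> complex" where
  "root_ideal u = (\<Prod>p\<in>prime_factors u. half_power (z ^ (m div p)) p (multiplicity p u))"

lemma self_conjugate_primeE:
  assumes "self_conjugate_prime p m" "p dvd n"
  obtains c m' j where "m = p ^ Suc c * m'" "coprime p m'" "m' dvd p ^ j + 1" "j > 0"
proof -
  obtain a m' j where a: "prime p" "m = p ^ a * m'" "coprime p m'" "[int p ^ j = -1] (mod int m')"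
    using assms(1) by (auto simp: self_conjugate_prime_def)
  have "p dvd m" using assms(2) n_dvd_m by (rule dvd_trans)
  hence "a \<noteq> 0" using a by (metis coprime_absorb_left mult_1 not_prime_unit power_0)
  then obtain c where c: "a = Suc c" by (cases a) auto
  have m': "m' > 0" using a m_pos by (intro Nat.gr0I) auto
  \<comment> \<open>The given \<open>j\<close> may be 0, for instance when m' = 2; adding a period
    of the powers of \<open>p\<close> modulo m' makes the exponent positive.\<close>
  define j' where "j' = j + totient m'"
  have "[p ^ totient m' = 1] (mod m')" using a(3) by (rule euler_theorem)
  hence "[int p ^ totient m' = 1] (mod int m')" by (metis cong_int_iff of_nat_1 of_nat_power)
  from cong_mult [OF a(4) this] have "[int p ^ j' = -1] (mod int m')"
    by (simp add: j'_def power_add)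
  hence "int m' dvd int p ^ j' + 1" by (simp add: cong_iff_dvd_diff)
  hence "int m' dvd int (p ^ j' + 1)" by (simp add: add.commute)
  hence "m' dvd p ^ j' + 1" by (simp only: int_dvd_int_iff)
  moreover have "j' > 0" using m' by (simp add: j'_def)
  ultimately show ?thesis using that a c by blast
qed

text \<open>The local divisibilities combine because half powers for distinct primes divide coprime
  integers. The second conclusion supplies an integer multiple of theta composed of primes of
  \<open>u\<close> only.\<close>

lemma root_ideal_rdvd_flat:
  assumes u: "u dvd n" and sc: "\<And>p. prime p \<Longrightarrow> p dvd u \<Longrightarrow> self_conjugate_prime p m"
    and x: "x \<in> int_adjoin z" "x * cnj x = of_nat n"
  shows "rdvd z (root_ideal u) x" "rdvd z (root_ideal u) (of_int (\<Prod>p\<in>prime_factors u. int p ^ Suc (multiplicity p u)))"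
proof -
  have u0: "u > 0" using u n by (intro Nat.gr0I) auto
  have p: "prime p" "p dvd u" "p dvd n" if "p \<in> prime_factors u" for p
    using that u by (auto simp: in_prime_factors_iff intro: dvd_trans)
  have 1: "rdvd z (half_power (z ^ (m div p)) p (multiplicity p u)) (of_int (int p ^ Suc (multiplicity p u)))"
    if "p \<in> prime_factors u" for p
    using half_power_rdvd_prime_power [OF z p(1) [OF that] dvd_trans [OF p(3) [OF that] n_dvd_m]]
    by simp
  show "rdvd z (root_ideal u) (of_int (\<Prod>p\<in>prime_factors u. int p ^ Suc (multiplicity p u)))"
    unfolding root_ideal_def of_int_prod by (intro rdvd_prod 1)
  show "rdvd z (root_ideal u) x"
    unfolding root_ideal_def
  proof (rule rdvd_prod_coprime [where F = "\<lambda>p. int p ^ Suc (multiplicity p u)"])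
    fix p assume pu: "p \<in> prime_factors u"
    note pp = p [OF pu]
    obtain c m' j where j: "m = p ^ Suc c * m'" "coprime p m'" "m' dvd p ^ j + 1" "j > 0"
      using self_conjugate_primeE [OF sc [OF pp(1,2)] pp(3)] .
    have "p ^ multiplicity p u dvd n" using u by (meson dvd_trans multiplicity_dvd)
    then obtain e where "n = p ^ multiplicity p u * e" by (elim dvdE)
    hence "rdvd z (of_nat p ^ multiplicity p u) (x * cnj x)"
      using x by (intro rdvdI [of "of_nat e"]) auto
    from half_power_rdvd [OF z pp(1) j(4) j(1) j(3) x(1) this] 1 [OF pu]
    show "rdvd z (half_power (z ^ (m div p)) p (multiplicity p u)) (of_int (int p ^ Suc (multiplicity p u))) \<and>
      rdvd z (half_power (z ^ (m div p)) p (multiplicity p u)) x" by simp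
  next
    fix p r assume pr: "p \<in> prime_factors u" "r \<in> prime_factors u" "p \<noteq> r"
    hence "coprime p r" using p by (simp add: primes_coprime)
    hence "coprime (int p) (int r)" by simp
    thus "coprime (int p ^ Suc (multiplicity p u)) (int r ^ Suc (multiplicity r u))"
      by (simp del: power_Suc)
  qed (simp_all add: x)
qed

text \<open>Fourier inversion only shows that theta divides \<open>v\<close> times the segment. The
  factor \<open>v\<close> is removed by Bezout, as theta also divides the integer \<open>A\<close>,
  which is coprime to \<open>v\<close>.\<close>

lemma root_ideal_rdvd_segment:
  assumes nuv: "n = u * v" and uv: "coprime u v" and y: "y < v"
    and sc: "\<And>p. prime p \<Longrightarrow> p dvd u \<Longrightarrow> self_conjugate_prime p m"
  shows "rdvd z (root_ideal u) (segment u v y)"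
proof -
  define w where "w = z ^ (m div n)"
  have w: "prim_root w n" unfolding w_def using z by (rule prim_root_power_divisor) (use n_dvd_m in simp)
  have wz: "w \<in> int_adjoin z" by (auto simp: w_def)
  have cwz: "cnj w \<in> int_adjoin z" by (rule cnj_in_int_adjoin [OF z wz])
  have u: "u > 0" using n nuv by auto
  have udn: "u dvd n" using nuv by simp
  define A where "A = (\<Prod>p\<in>prime_factors u. int p ^ Suc (multiplicity p u))"
  have S: "rdvd z (root_ideal u) (\<Sum>x<n. b x * (w ^ k) ^ x)" for k
  proof (rule root_ideal_rdvd_flat [OF udn sc])
    show "(\<Sum>x<n. b x * (w ^ k) ^ x) \<in> int_adjoin z"
      by (intro int_adjoin_sum int_adjoin_mult b_in_int_adjoin int_adjoin_power wz)
    have "(w ^ k) ^ n = 1" using prim_root_power_eq_1 [OF w] by (metis mult.commute power_mult power_one)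
    thus "(\<Sum>x<n. b x * (w ^ k) ^ x) * cnj (\<Sum>x<n. b x * (w ^ k) ^ x) = of_nat n" by (rule flat)
  qed
  have "rdvd z (root_ideal u) (of_nat v * (w ^ y * segment u v y))"
    unfolding w_def segment_average [OF nuv y] unfolding w_def [symmetric]
    by (intro rdvd_sum rdvd_mult_left S) (auto intro!: int_adjoin_power cwz)
  hence "rdvd z (root_ideal u) (cnj w ^ y * (of_nat v * (w ^ y * segment u v y)))"
    by (rule rdvd_mult_left) (auto intro!: int_adjoin_power cwz)
  moreover have "w ^ y * cnj w ^ y = 1"
    using prim_root_mult_cnj [OF w] by (metis power_mult_distrib power_one)
  hence "cnj w ^ y * (of_nat v * (w ^ y * segment u v y)) = of_nat v * segment u v y"
    by (simp add: mult.left_commute mult.assoc [symmetric] mult.commute [of "cnj w ^ y"])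
  ultimately have 1: "rdvd z (root_ideal u) (of_int (int v) * segment u v y)" by simp
  have "prim_root w n \<and> (\<Sum>x<n. b x * w ^ x) \<in> int_adjoin z"
    using w by (auto intro!: int_adjoin_sum int_adjoin_mult b_in_int_adjoin int_adjoin_power wz)
  hence "rdvd z (root_ideal u) (of_int A)"
    unfolding A_def using root_ideal_rdvd_flat(2) [OF udn sc] flat [of w] prim_root_power_eq_1 by blast
  hence 2: "rdvd z (root_ideal u) (of_int A * segment u v y)"
    by (rule rdvd_mult_right) (rule segment_in_int_adjoin)
  have "coprime (int p ^ Suc (multiplicity p u)) (int v)" if "p \<in> prime_factors u" for p
  proof -
    have "p dvd u" using that by (simp add: in_prime_factors_iff)
    hence "coprime p v" using uv by (meson coprime_divisors dvd_refl)
    hence "coprime (int p) (int v)" by simp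
    thus ?thesis by (simp del: power_Suc)
  qed
  hence "coprime A (int v)" unfolding A_def by (intro prod_coprime_left) auto
  moreover obtain s t where "s * A + t * int v = gcd A (int v)" using bezout_int by blast
  ultimately have "s * A + t * int v = 1" by simp
  hence "of_int (s * A + t * int v) = (1 :: complex)" by simp
  hence "segment u v y = of_int s * (of_int A * segment u v y) + of_int t * (of_int (int v) * segment u v y)"
    by (simp only: of_int_add of_int_mult mult.assoc [symmetric] distrib_right [symmetric]) simp
  moreover have "rdvd z (root_ideal u) (of_int s * (of_int A * segment u v y) + of_int t * (of_int (int v) * segment u v y))"
    by (intro rdvd_add rdvd_mult_left 1 2) auto
  ultimately show ?thesis by simp
qed

end

section \<open>Self-conjugate primes of n divide h\<close>

text \<open>For p >= 3 the trivial bound 2 suffices. For p = 2 the value 2 would force a = -c,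
  impossible since \<open>h\<close> is odd.\<close>

lemma cmod_root_diff_less:
  assumes "cmod a = 1" "cmod c = 1" "a ^ h = 1" "c ^ h = 1" "prime p" "\<not> p dvd h"
  shows "cmod (a - c) < real p"
proof (cases "p = 2")
  case False
  hence "p \<ge> 3" using prime_ge_2_nat [OF assms(5)] by simp
  moreover have "cmod (a - c) \<le> 2" using norm_triangle_ineq4 [of a c] assms by simp
  ultimately show ?thesis by simp
next
  case True
  hence "odd h" using assms(6) by simp
  have "a + c \<noteq> 0"
  proof
    assume "a + c = 0"
    hence "a = - c" by (simp add: add_eq_0_iff2)
    hence "a ^ h = - (c ^ h)" using \<open>odd h\<close> by simp
    thus False using assms by simp
  qed
  hence "(cmod (a + c))\<^sup>2 > 0" by simp
  moreover have "(cmod (a - c))\<^sup>2 + (cmod (a + c))\<^sup>2 = 2 * (cmod a)\<^sup>2 + 2 * (cmod c)\<^sup>2"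
    unfolding cmod_power2 by (simp add: power2_eq_square algebra_simps)
  ultimately have "(cmod (a - c))\<^sup>2 < 2\<^sup>2" unfolding assms(1,2) power_one
    by (simp only: power2_eq_square [of "2::real"])
  hence "cmod (a - c) < 2" by (rule power_less_imp_less_base) simp
  thus ?thesis using True by simp
qed

text \<open>Otherwise the difference divided by \<open>p\<close> would be nonzero in Z[c] with all
  conjugates of modulus below 1, against the lower bound for their product.\<close>

lemma prim_root_power_eq_if_rdvd:
  assumes c: "prim_root c h" and p: "prime p" "\<not> p dvd h"
    and dv: "rdvd c (of_nat p) (c ^ i - c ^ j)"
  shows "c ^ i = c ^ j"
proof (rule ccontr)
  assume ne: "c ^ i \<noteq> c ^ j"
  have h: "h > 0" and c1: "c ^ h = 1" using c by (auto simp: prim_root_def)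
  obtain x where x: "x \<in> int_adjoin c" "c ^ i - c ^ j = of_nat p * x" using dv by (rule rdvdE)
  obtain X where X: "x = ev X c" using x(1) by (rule int_adjoinE)
  have nz: "ev X c \<noteq> 0" using ne x X by auto
  have less: "cmod (ev X (c ^ s)) < 1" if s: "s \<in> totatives h" for s
  proof -
    have "ev (Polynomial.monom 1 i - Polynomial.monom 1 j) c = ev ([:int p:] * X) c"
      using x X unfolding ev_mult by simp
    hence "ev (Polynomial.monom 1 i - Polynomial.monom 1 j) (c ^ s) = ev ([:int p:] * X) (c ^ s)"
      by (rule ev_conjugate_cong [OF c1 h, rotated]) (use s in \<open>simp add: in_totatives_iff\<close>)
    hence eq: "(c ^ s) ^ i - (c ^ s) ^ j = of_nat p * ev X (c ^ s)" unfolding ev_mult by simp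
    have 1: "cmod ((c ^ s) ^ k) = 1" for k using prim_root_cmod [OF c] by (simp add: norm_power)
    have 2: "((c ^ s) ^ k) ^ h = 1" for k
      using c1 by (metis mult.commute power_mult power_one)
    have "cmod ((c ^ s) ^ i - (c ^ s) ^ j) < real p" by (rule cmod_root_diff_less [OF 1 1 2 2 p])
    hence "real p * cmod (ev X (c ^ s)) < real p * 1" unfolding eq by (simp add: norm_mult)
    thus ?thesis using prime_gt_0_nat [OF p(1)] by (simp only: mult_less_cancel_left_pos of_nat_0_less_iff)
  qed
  \<comment> \<open>The factor for s = 1 is kept apart so that the final inequality is
    strict.\<close>
  have "cmod (\<Prod>s\<in>totatives h. ev X (c ^ s)) =
      cmod (ev X (c ^ 1)) * (\<Prod>s\<in>totatives h - {1}. cmod (ev X (c ^ s)))"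
    unfolding prod_norm norm_mult [symmetric] using h
    by (subst prod.remove [of _ 1]) auto
  also have "\<dots> \<le> cmod (ev X (c ^ 1)) * 1"
    by (intro mult_left_mono prod_le_1) (use less in \<open>auto intro: less_imp_le\<close>)
  also have "\<dots> < 1" using less [of 1] h by simp
  finally show False using norm_prod_conjugates_ge_1 [OF c1 h nz] by simp
qed

context bh_sequence
begin

lemma b_cong: "[x = y] (mod n) \<Longrightarrow> b x = b y"
proof -
  have *: "b (x + n * k) = b x" for x k
  proof (induction k)
    case (Suc k)
    have "b (x + n * Suc k) = b ((x + n * k) + n)" by (simp add: algebra_simps)
    thus ?case using Suc b_periodic by simp
  qed simp
  have "b x = b (x mod n)" for x using * [of "x mod n" "x div n"] by simp
  thus "[x = y] (mod n) \<Longrightarrow> b x = b y" by (metis cong_def)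
qed

definition expo :: "nat \<Rightarrow> nat \<Rightarrow> nat \<Rightarrow> nat \<Rightarrow> nat" where
  "expo u v y c = (m div h) * ex (y + v * c) + (m div u) * c"

text \<open>The chosen lift of a segment: its coefficients modulo x^m - 1 count coinciding
  exponents, so they are nonnegative.\<close>

definition seg_poly :: "nat \<Rightarrow> nat \<Rightarrow> nat \<Rightarrow> int poly" where
  "seg_poly u v y = (\<Sum>c<u. Polynomial.monom 1 (expo u v y c))"

lemma power_expo: "z ^ expo u v y c = b (y + v * c) * (z ^ (m div u)) ^ c"
  by (subst b_eq) (simp add: expo_def power_add power_mult)

lemma ev_seg_poly: "ev (seg_poly u v y) z = segment u v y"
  by (simp add: seg_poly_def segment_def power_expo)

lemma supported_seg_poly:
  assumes "m = M * l" "u dvd M" "h dvd M"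
  shows "supported l (seg_poly u v y)"
proof -
  have "l dvd m div k" if "k dvd M" for k
  proof -
    obtain e where "M = k * e" using \<open>k dvd M\<close> by (elim dvdE)
    hence "m = k * (e * l)" "k > 0" using assms m_pos by (auto intro: Nat.gr0I)
    thus ?thesis by simp
  qed
  hence "l dvd m div h" "l dvd m div u" using assms by blast+
  thus ?thesis unfolding seg_poly_def
    by (intro supported_sum supported_monom) (unfold expo_def, intro dvd_add dvd_mult2)
qed

lemma ev_select_sum_monom:
  "ev (select d (\<Sum>c\<in>A. Polynomial.monom 1 (f c))) z = (\<Sum>c\<in>A. if d dvd f c then z ^ f c else 0)"
  unfolding filter_poly_sum ev_sum by (intro sum.cong refl) (simp add: filter_poly_monom)

text \<open>If \<open>p\<close> divided \<open>n\<close> only once, \<open>p\<close> would divide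
  \<open>m\<close> only once, and the entries of \<open>b\<close> lie in Z[y] with y of order m'
  prime to \<open>p\<close>. There \<open>self_conjugate_rdvd\<close> works with q = p itself and
  gives that \<open>p\<close> divides a character sum S, so p^2 divides S S* = n.\<close>

lemma self_conjugate_prime_square_dvd:
  assumes sc: "self_conjugate_prime p m" and pn: "p dvd n" and ph: "\<not> p dvd h"
  shows "p\<^sup>2 dvd n"
proof (rule ccontr)
  assume np: "\<not> p\<^sup>2 dvd n"
  have p: "prime p" using sc by (simp add: self_conjugate_prime_def)
  obtain c m' j where j: "m = p ^ Suc c * m'" "coprime p m'" "m' dvd p ^ j + 1" "j > 0"
    using self_conjugate_primeE [OF sc pn] .
  have ch: "coprime p h" using p ph by (simp add: prime_imp_coprime)
  have "c = 0"
  proof (rule ccontr)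
    assume "c \<noteq> 0"
    then obtain c' where "c = Suc c'" by (cases c) auto
    hence "p\<^sup>2 dvd m" using j(1) by (simp add: power2_eq_square)
    moreover have "m dvd n * h" unfolding m by (simp add: lcm_least)
    ultimately have "p\<^sup>2 dvd n * h" by (rule dvd_trans)
    moreover have "coprime (p\<^sup>2) h" using ch by simp
    ultimately show False using np by (simp add: coprime_dvd_mult_left_iff)
  qed
  hence mp: "m = p * m'" using j by simp
  define y where "y = z ^ p"
  have y: "prim_root y m'" unfolding y_def using z mp by (rule prim_root_power_divisor)
  have bA: "b x \<in> int_adjoin y" for x
  proof -
    have "p dvd h * (m div h)" using h_dvd_m mp by simp
    hence "p dvd m div h" using ch by (simp add: coprime_dvd_mult_right_iff)
    then obtain e where "m div h = p * e" by (elim dvdE)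
    hence "b x = (y ^ e) ^ ex x" unfolding y_def by (subst b_eq) (simp add: power_mult)
    thus ?thesis by auto
  qed
  \<comment> \<open>The extra power \<open>p\<close> in \<open>y\<close> makes this character
    trivial on the p-part, which keeps its values in Z[y].\<close>
  define w where "w = y ^ (m div n)"
  have wA: "w \<in> int_adjoin y" by (auto simp: w_def)
  have "w ^ n = (z ^ m) ^ p"
    unfolding w_def y_def power_mult [symmetric] using n_dvd_m
    by (metis dvd_div_mult_self mult.assoc mult.commute)
  hence w1: "w ^ n = 1" using prim_root_power_eq_1 [OF z] by simp
  define S where "S = (\<Sum>x<n. b x * w ^ x)"
  have S: "S * cnj S = of_nat n" unfolding S_def by (rule flat [OF w1])
  have SA: "S \<in> int_adjoin y"
    unfolding S_def by (auto intro!: int_adjoin_sum int_adjoin_mult bA int_adjoin_power wA)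
  obtain n' where n': "n = p * n'" using pn by (elim dvdE)
  have "rdvd y (of_nat p) (1 - y ^ (p ^ j + 1))"
    using j(3) prim_root_power_eq_1_iff [OF y, of "p ^ j + 1"] by simp
  moreover have "rdvd y (of_nat p) (S * cnj S)"
    unfolding S n' by (rule rdvdI [of "of_nat n'"]) auto
  ultimately have "rdvd y (of_nat p) S"
    by (rule self_conjugate_rdvd [OF y p j(4) rdvd_refl _ SA])
  then obtain x where x: "x \<in> int_adjoin y" "S = of_nat p * x" by (rule rdvdE)
  have "of_int (int n) = of_int (int (p\<^sup>2)) * (x * cnj x)"
    using S x by (simp add: power2_eq_square mult_ac)
  hence "rdvd y (of_int (int (p\<^sup>2))) (of_int (int n))"
    using x cnj_in_int_adjoin [OF y x(1)] by (intro rdvdI [of "x * cnj x"]) auto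
  hence "int (p\<^sup>2) dvd int n"
    using rdvd_of_int_iff [OF prim_root_power_eq_1 [OF y] prim_root_pos [OF y]] by blast
  thus False using np by (simp only: int_dvd_int_iff)
qed

text \<open>As e >= 2, the half power contains at least one full factor \<open>p\<close>.\<close>

lemma rdvd_segment_prime:
  assumes sc: "self_conjugate_prime p m" and pn: "p dvd n"
    and e: "e = multiplicity p n" "e \<ge> 2" and nuv: "n = p ^ e * v" and y: "y < v"
  shows "rdvd z (of_nat p) (segment (p ^ e) v y)"
proof -
  have p: "prime p" using sc by (simp add: self_conjugate_prime_def)
  have "\<not> p dvd v"
  proof
    assume "p dvd v"
    hence "p ^ Suc e dvd n" unfolding nuv by (simp add: mult.commute mult_dvd_mono)
    hence "Suc e \<le> multiplicity p n" using n p by (intro multiplicity_geI) auto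
    thus False using e by simp
  qed
  hence "coprime (p ^ e) v" using p by (simp add: prime_imp_coprime)
  moreover have "self_conjugate_prime r m" if "prime r" "r dvd p ^ e" for r
    using that p sc by (metis prime_dvd_power primes_dvd_imp_eq)
  ultimately have 1: "rdvd z (root_ideal (p ^ e)) (segment (p ^ e) v y)"
    using root_ideal_rdvd_segment [OF nuv _ y] by blast
  have "prime_factors (p ^ e) = {p}" using p e by (simp add: prime_factors_power prime_prime_factors)
  moreover have "multiplicity p (p ^ e) = e" using p by (intro multiplicity_same_power) auto
  ultimately have r: "root_ideal (p ^ e) = half_power (z ^ (m div p)) p e" by (simp add: root_ideal_def)
  obtain e' where e': "e div 2 = Suc e'" using e(2) by (cases "e div 2") auto
  define t where "t = (if odd e \<and> odd p then (1 - z ^ (m div p)) ^ ((p - 1) div 2) else 1)"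
  have "t \<in> int_adjoin z" unfolding t_def by (auto intro!: int_adjoin_power int_adjoin_diff)
  hence "rdvd z (of_nat p) (root_ideal (p ^ e))"
    unfolding r half_power_def e' t_def [symmetric]
    by (intro rdvdI [of "of_nat p ^ e' * t"]) (auto intro!: int_adjoin_mult int_adjoin_power)
  thus ?thesis using 1 rdvd_trans by blast
qed

text \<open>Projecting the divisible segment to the \<open>h\<close>-th cyclotomic ring isolates the difference of two
  entries.\<close>

lemma b_shift_eq:
  assumes sc: "self_conjugate_prime p m" and pn: "p dvd n" and ph: "\<not> p dvd h"
    and e: "e = multiplicity p n" "e \<ge> 2" and nuv: "n = p ^ e * v" and y: "y < v" and c1: "c1 < p ^ e"
  shows "b (y + v * (c1 + p ^ (e - 1))) = b (y + v * c1)"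
proof -
  have p: "prime p" using sc by (simp add: self_conjugate_prime_def)
  have p0: "p > 0" using p by (rule prime_gt_0_nat)
  define u where "u = p ^ e"
  define c0 where "c0 = (c1 + p ^ (e - 1)) mod u"
  have u: "u > 0" using p0 by (simp add: u_def)
  have c0: "c0 < u" using u by (simp add: c0_def)
  have cu: "coprime u h" using p ph by (simp add: u_def prime_imp_coprime)
  have pe: "u = p * p ^ (e - 1)" unfolding u_def using e(2) by (cases e) auto
  define M where "M = u * h"
  have "u dvd m" using n_dvd_m nuv u_def by (meson dvd_trans dvd_triv_left)
  hence "M dvd m" unfolding M_def using h_dvd_m cu by (rule divides_mult)
  then obtain l where ml: "m = M * l" by (elim dvdE)
  have l0: "l > 0" using ml m_pos by (auto intro: Nat.gr0I)
  define d where "d = m div h"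
  have d: "m = h * d" using h_dvd_m by (simp add: d_def)
  have dl: "d = u * l" using h by (simp add: d_def ml M_def)
  have mu: "m div u = h * l" using u by (simp add: ml M_def)
  have mp: "m div p = h * l * p ^ (e - 1)" using p0 by (simp add: ml M_def pe)
  \<comment> \<open>\<open>g\<close> is chosen so that the projection retains from \<open>F\<close>
    the term with index \<open>c0\<close> only; in the copy shifted by m/p the surviving index is
    \<open>c1\<close>.\<close>
  define g where "g = h * l * (u - c0)"
  define E where "E = expo u v y"
  define F where "F = Polynomial.monom 1 g * seg_poly u v y"
  define F1 where "F1 = (\<Sum>c<u. Polynomial.monom (1::int) (g + E c))"
  define F2 where "F2 = (\<Sum>c<u. Polynomial.monom (1::int) (m div p + (g + E c)))"
  have kF: "kappa m {p} * F = F1 - F2"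
    unfolding F_def F1_def F2_def seg_poly_def kappa_def E_def
    by (simp add: sum_distrib_left mult_monom left_diff_distrib sum_subtractf)
  have "rdvd z (of_nat p) (segment u v y)"
    unfolding u_def by (rule rdvd_segment_prime [OF sc pn e nuv y])
  then obtain x where x: "x \<in> int_adjoin z" "segment u v y = of_nat p * x" by (rule rdvdE)
  have supp: "supported l F"
  proof -
    have "supported l (seg_poly u v y)" by (rule supported_seg_poly [OF ml]) (simp_all add: M_def)
    thus ?thesis unfolding F_def by (intro supported_mult supported_monom) (simp add: g_def)
  qed
  have "rdvd (z ^ d) (ev [:int p:] (z ^ d)) (ev (select d (kappa m {p} * F)) z)"
  proof (rule rdvd_select [OF z d ml _ supp])
    show "ev F z = ev [:int p:] (z ^ d) * (z ^ g * x)"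
      by (simp add: F_def ev_seg_poly x)
    show "z ^ g * x \<in> int_adjoin z" using x by auto
    show "{p} = {r. prime r \<and> r dvd M \<and> \<not> r dvd h}"
      using p ph e unfolding M_def u_def
      by (auto simp: prime_dvd_mult_iff prime_dvd_power_iff primes_dvd_imp_eq dest: primes_dvd_imp_eq)
  qed (simp add: M_def)
  hence dv: "rdvd (z ^ d) (of_nat p) (ev (select d F1) z - ev (select d F2) z)"
    by (simp add: kF filter_poly_diff)
  have key: "d dvd k + (g + E c) \<longleftrightarrow> u dvd k' + (u - c0) + c" if "k = h * l * k'" for k k' c
  proof -
    have "k + (g + E c) = d * ex (y + v * c) + (h * l) * (k' + (u - c0) + c)"
      by (simp add: that g_def E_def expo_def mu d_def algebra_simps)
    hence "d dvd k + (g + E c) \<longleftrightarrow> d dvd (h * l) * (k' + (u - c0) + c)"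
      by (simp add: dvd_add_right_iff)
    also have "\<dots> \<longleftrightarrow> u * l dvd (h * (k' + (u - c0) + c)) * l" by (simp add: dl mult_ac)
    also have "\<dots> \<longleftrightarrow> u dvd h * (k' + (u - c0) + c)" using l0 by simp
    also have "\<dots> \<longleftrightarrow> u dvd k' + (u - c0) + c" using cu by (simp add: coprime_dvd_mult_right_iff)
    finally show ?thesis .
  qed
  have val: "z ^ (k + (g + E c)) = b (y + v * c)" if k: "k = h * l * k'" "u dvd k' + (u - c0) + c" for k k' c
  proof -
    obtain t where t: "k' + (u - c0) + c = u * t" using k(2) by (elim dvdE)
    have "z ^ (k + (g + E c)) = z ^ (k + g) * z ^ E c" by (simp add: power_add mult.assoc)
    also have "\<dots> = z ^ (h * l * k' + h * l * (u - c0)) * (b (y + v * c) * (z ^ (h * l)) ^ c)"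
      unfolding E_def power_expo mu k(1) g_def ..
    also have "\<dots> = b (y + v * c) * z ^ (h * l * (k' + (u - c0) + c))"
      by (simp only: distrib_left power_add power_mult [of z "h * l"], simp only: mult_ac)
    also have "h * l * (k' + (u - c0) + c) = m * t" unfolding t ml M_def by (simp add: mult_ac)
    finally show ?thesis using prim_root_power_eq_1 [OF z] by (simp add: power_mult)
  qed
  have "ev (select d F1) z = (\<Sum>c<u. if d dvd g + E c then z ^ (g + E c) else 0)"
    unfolding F1_def by (rule ev_select_sum_monom)
  also have "\<dots> = (\<Sum>c<u. if c = c0 then b (y + v * c) else 0)"
  proof (intro sum.cong refl)
    fix c assume "c \<in> {..<u}"
    hence c: "c < u" by simp
    have "u dvd 0 + (u - c0) + c \<longleftrightarrow> c = c0"
    proof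
      assume "u dvd 0 + (u - c0) + c"
      hence "[(u - c0) + c = 0] (mod u)" by (simp add: cong_0_iff)
      moreover have "[(u - c0) + c0 = 0] (mod u)" using c0 by (simp add: cong_0_iff)
      ultimately have "[(u - c0) + c = (u - c0) + c0] (mod u)" by (meson cong_sym cong_trans)
      hence "[c = c0] (mod u)" by (simp only: cong_add_lcancel_nat)
      thus "c = c0" using c c0 by (simp add: cong_def)
    qed (use c0 in simp)
    thus "(if d dvd g + E c then z ^ (g + E c) else 0) = (if c = c0 then b (y + v * c) else 0)"
      using key [of 0 0 c] val [of 0 0 c] by simp
  qed
  also have "\<dots> = b (y + v * c0)" using c0 by simp
  finally have 1: "ev (select d F1) z = b (y + v * c0)" .
  have "ev (select d F2) z = (\<Sum>c<u. if d dvd m div p + (g + E c) then z ^ (m div p + (g + E c)) else 0)"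
    unfolding F2_def by (rule ev_select_sum_monom)
  also have "\<dots> = (\<Sum>c<u. if c = c1 then b (y + v * c) else 0)"
  proof (intro sum.cong refl)
    fix c assume "c \<in> {..<u}"
    hence c: "c < u" by simp
    have base: "[p ^ (e - 1) + (u - c0) + c1 = 0] (mod u)"
    proof -
      have "[p ^ (e - 1) + (u - c0) + c1 = (u - c0) + (c1 + p ^ (e - 1))] (mod u)" by (simp add: add_ac)
      also have "[(u - c0) + (c1 + p ^ (e - 1)) = (u - c0) + c0] (mod u)"
        by (intro cong_add cong_refl) (simp add: c0_def cong_def)
      also have "(u - c0) + c0 = u" using c0 by simp
      also have "[u = 0] (mod u)" by (simp add: cong_0_iff)
      finally show ?thesis .
    qed
    have "u dvd p ^ (e - 1) + (u - c0) + c \<longleftrightarrow> c = c1"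
    proof
      assume "u dvd p ^ (e - 1) + (u - c0) + c"
      hence "[p ^ (e - 1) + (u - c0) + c = 0] (mod u)" by (simp add: cong_0_iff)
      hence "[p ^ (e - 1) + (u - c0) + c = p ^ (e - 1) + (u - c0) + c1] (mod u)"
        using base by (meson cong_sym cong_trans)
      hence "[c = c1] (mod u)" by (simp only: cong_add_lcancel_nat)
      thus "c = c1" using c c1 by (simp add: cong_def u_def)
    qed (use base in \<open>simp add: cong_0_iff\<close>)
    thus "(if d dvd m div p + (g + E c) then z ^ (m div p + (g + E c)) else 0) =
        (if c = c1 then b (y + v * c) else 0)"
      using key [OF mp, of c] val [OF mp, of c] by simp
  qed
  also have "\<dots> = b (y + v * c1)" using c1 by (simp add: u_def)
  finally have 2: "ev (select d F2) z = b (y + v * c1)" .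
  have h_root: "prim_root (z ^ d) h" unfolding d_def by (rule prim_root_h)
  have b_pow: "b x = (z ^ d) ^ ex x" for x unfolding d_def by (rule b_eq)
  have "b (y + v * c0) = b (y + v * c1)"
    using prim_root_power_eq_if_rdvd [OF h_root p ph, of "ex (y + v * c0)" "ex (y + v * c1)"] dv
    unfolding 1 2 b_pow [of "y + v * c0"] b_pow [of "y + v * c1"] by blast
  moreover have "b (y + v * c0) = b (y + v * (c1 + p ^ (e - 1)))"
  proof (rule b_cong)
    have "[c0 = c1 + p ^ (e - 1)] (mod u)" by (simp add: c0_def cong_def)
    hence "[v * c0 = v * (c1 + p ^ (e - 1))] (mod n)"
      unfolding nuv u_def [symmetric] by (simp add: cong_def mult.commute [of u v] mult_mod_right [symmetric])
    thus "[y + v * c0 = y + v * (c1 + p ^ (e - 1))] (mod n)" by (intro cong_add cong_refl)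
  qed
  ultimately show ?thesis by simp
qed

text \<open>Otherwise shifting the summation index by p^(e-1) fixes the entries and multiplies each
  segment by s, which is not 1; so all segments would be 0.\<close>

lemma self_conjugate_prime_dvd_h:
  assumes sc: "self_conjugate_prime p m" and pn: "p dvd n"
  shows "p dvd h"
proof (rule ccontr)
  assume ph: "\<not> p dvd h"
  have p: "prime p" using sc by (simp add: self_conjugate_prime_def)
  define e where "e = multiplicity p n"
  define u where "u = p ^ e"
  have e2: "e \<ge> 2"
    unfolding e_def using self_conjugate_prime_square_dvd [OF sc pn ph] n p by (intro multiplicity_geI) auto
  have "u dvd n" unfolding u_def e_def by (rule multiplicity_dvd)
  then obtain v where nuv: "n = u * v" by (elim dvdE)
  have u: "u > 0" using n nuv by auto
  define w where "w = z ^ (m div u)"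
  have "u dvd m" using \<open>u dvd n\<close> n_dvd_m by (rule dvd_trans)
  hence w: "prim_root w u" unfolding w_def using z by (intro prim_root_power_divisor [OF z]) simp
  define s where "s = w ^ (p ^ (e - 1))"
  have "s \<noteq> 1"
  proof
    assume "s = 1"
    hence "u dvd p ^ (e - 1)" using prim_root_power_eq_1_iff [OF w] by (simp add: s_def)
    hence "e \<le> e - 1" using prime_gt_1_nat [OF p] unfolding u_def by (intro power_dvd_imp_le [of p]) auto
    thus False using e2 by simp
  qed
  have "segment u v y = 0" if y: "y < v" for y
  proof -
    define f where "f = (\<lambda>c. b (y + v * c) * w ^ c)"
    have per: "f (c + u) = f c" for c
    proof -
      have "b (y + v * (c + u)) = b (y + v * c)" using b_periodic [of "y + v * c"] by (simp add: nuv algebra_simps)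
      thus ?thesis using prim_root_power_eq_1 [OF w] by (simp add: f_def power_add)
    qed
    have "(\<Sum>c<u. f c) = (\<Sum>c<u. f (p ^ (e - 1) + c))" using sum_periodic_shift [of f u "p ^ (e - 1)"] per by simp
    also have "\<dots> = (\<Sum>c<u. s * f c)"
    proof (intro sum.cong refl)
      fix c assume "c \<in> {..<u}"
      hence "b (y + v * (c + p ^ (e - 1))) = b (y + v * c)"
        using b_shift_eq [OF sc pn ph e_def e2 _ y] nuv by (simp add: u_def)
      thus "f (p ^ (e - 1) + c) = s * f c" by (simp add: f_def s_def power_add add.commute)
    qed
    also have "\<dots> = s * (\<Sum>c<u. f c)" by (simp add: sum_distrib_left)
    finally have "(\<Sum>c<u. f c) = 0" using \<open>s \<noteq> 1\<close> by simp
    thus ?thesis by (simp add: segment_def f_def w_def)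
  qed
  thus False using segment_nonzero [OF nuv] by blast
qed

end

section \<open>The inequality for N and q\<close>

text \<open>1 - s and its conjugate differ by a unit, so for odd \<open>p\<close> and
  \<open>e\<close> the last factor contributes (1 - s)^(p-1), an associate of \<open>p\<close>. For
  p = 2 an odd exponent loses one factor.\<close>

lemma half_power_norm:
  assumes p: "prime p" and s: "odd e \<and> odd p \<Longrightarrow> prim_root s p \<and> s \<in> int_adjoin x"
  shows "rdvd x (of_nat (p ^ (if odd p then e else 2 * (e div 2)))) (half_power s p e * cnj (half_power s p e))"
proof (cases "odd e \<and> odd p")
  case False
  hence e: "(if odd p then e else 2 * (e div 2)) = 2 * (e div 2)" by auto
  have "half_power s p e = of_nat p ^ (e div 2)" using False by (auto simp: half_power_def)
  thus ?thesis unfolding e by (simp add: power_mult power2_eq_square power_mult_distrib)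
next
  case True
  define k where "k = (p - 1) div 2"
  have k: "p - 1 = 2 * k" using True by (auto simp: k_def)
  have s': "prim_root s p" "s \<in> int_adjoin x" using s [OF True] by auto
  define a where "a = (1 - s) ^ k"
  have hp: "half_power s p e = of_nat p ^ (e div 2) * a" using True by (simp add: half_power_def a_def k_def)
  have "s * cnj s = 1" by (rule prim_root_mult_cnj [OF s'(1)])
  hence "cnj (1 - s) = - cnj s * (1 - s)" by (simp add: algebra_simps)
  hence "a * cnj a = (- cnj s) ^ k * (1 - s) ^ (p - 1)"
    unfolding a_def k by (simp add: power_mult_distrib [symmetric] power_mult power2_eq_square mult_ac)
  moreover have "rdvd s (of_nat p) ((- cnj s) ^ k * (1 - s) ^ (p - 1))"
    using rassoc_prime_one_minus [OF p s'(1)] cnj_in_int_adjoin [OF s'(1) int_adjoin_self]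
    by (intro rdvd_mult_left int_adjoin_power int_adjoin_uminus) (auto simp: rassoc_def)
  ultimately have "rdvd x (of_nat p) (a * cnj a)" using s'(2) by (auto intro: rdvd_mono)
  hence "rdvd x ((of_nat p ^ (e div 2) * of_nat p ^ (e div 2)) * of_nat p)
      ((of_nat p ^ (e div 2) * of_nat p ^ (e div 2)) * (a * cnj a))"
    by (intro rdvd_mult rdvd_refl)
  moreover have "half_power s p e * cnj (half_power s p e) =
      (of_nat p ^ (e div 2) * of_nat p ^ (e div 2)) * (a * cnj a)" by (simp add: hp mult_ac)
  moreover have "of_nat (p ^ e) = (of_nat p ^ (e div 2) * of_nat p ^ (e div 2)) * (of_nat p :: complex)"
  proof -
    have "e = Suc (e div 2 + e div 2)" using True by presburger
    hence "p ^ e = p ^ (e div 2) * p ^ (e div 2) * p" by (metis power_Suc2 power_add)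
    thus ?thesis by simp
  qed
  ultimately show ?thesis using True by simp
qed

context bh_sequence
begin

text \<open>Raising to the h-th power removes the entry of \<open>b\<close> and leaves zeta_u^(c h),
  which determines \<open>c\<close> modulo u / gcd(u, h).\<close>

lemma card_same_expo:
  assumes nuv: "n = u * v"
  shows "card {c. c < u \<and> [expo u v y c = j] (mod m)} \<le> gcd u h"
proof -
  have u: "u > 0" using n nuv by auto
  define g where "g = gcd u h"
  have g: "g > 0" using u by (simp add: g_def)
  define u' where "u' = u div g"
  have uu: "u = g * u'" by (simp add: u'_def g_def)
  have u': "u' > 0" using u uu by (auto intro: Nat.gr0I)
  define A where "A = {c. c < u \<and> [expo u v y c = j] (mod m)}"
  have "u dvd m" using n_dvd_m nuv by (meson dvd_trans dvd_triv_left)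
  hence w: "prim_root (z ^ (m div u)) u" by (intro prim_root_power_divisor [OF z]) simp
  have cong: "[c = c'] (mod u')" if c: "c \<in> A" "c' \<in> A" for c c'
  proof -
    have "[expo u v y c = expo u v y c'] (mod m)"
      using c unfolding A_def by (auto intro: cong_trans cong_sym)
    hence "z ^ expo u v y c = z ^ expo u v y c'" using prim_root_power_eq_iff [OF z] by simp
    hence "(z ^ expo u v y c) ^ h = (z ^ expo u v y c') ^ h" by simp
    hence "((z ^ (m div u)) ^ c) ^ h = ((z ^ (m div u)) ^ c') ^ h"
      unfolding power_expo power_mult_distrib b_root by simp
    hence "(z ^ (m div u)) ^ (c * h) = (z ^ (m div u)) ^ (c' * h)" by (simp only: power_mult)
    hence "[c * h = c' * h] (mod u)" using prim_root_power_eq_iff [OF w] by blast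
    hence "[int c * int h = int c' * int h] (mod int u)" by (metis cong_int_iff of_nat_mult)
    hence "int u dvd int c * int h - int c' * int h" by (simp add: cong_iff_dvd_diff)
    hence 1: "int u dvd (int c - int c') * int h" by (simp add: left_diff_distrib)
    define h' where "h' = h div g"
    have hh: "h = g * h'" by (simp add: h'_def g_def)
    have "int g * int u' dvd int g * ((int c - int c') * int h')"
      using 1 unfolding uu hh by (simp add: mult_ac)
    hence "int u' dvd (int c - int c') * int h'" using g by simp
    moreover have "coprime u' h'" unfolding u'_def h'_def g_def using u by (intro div_gcd_coprime) auto
    hence "coprime (int u') (int h')" by simp
    ultimately have "int u' dvd int c - int c'" by (simp add: coprime_dvd_mult_left_iff)
    thus ?thesis by (simp add: cong_int_iff [symmetric] cong_iff_dvd_diff)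
  qed
  have "card A \<le> card {..<g}"
  proof (rule card_inj_on_le [where f = "\<lambda>c. c div u'"])
    show "inj_on (\<lambda>c. c div u') A"
    proof (rule inj_onI)
      fix c c' assume "c \<in> A" "c' \<in> A" "c div u' = c' div u'"
      thus "c = c'" using cong [of c c'] by (metis cong_def div_mult_mod_eq)
    qed
    show "(\<lambda>c. c div u') ` A \<subseteq> {..<g}"
      unfolding A_def uu by (auto simp: less_mult_imp_div_less)
  qed simp
  thus ?thesis by (simp add: A_def g_def)
qed

lemma class_sum_seg_poly:
  assumes nuv: "n = u * v"
  shows "0 \<le> class_sum m (seg_poly u v y) j \<and> class_sum m (seg_poly u v y) j \<le> int (gcd u h)"
proof -
  have "class_sum m (seg_poly u v y) j = (\<Sum>c<u. if [expo u v y c = j] (mod m) then 1 else 0)"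
    unfolding seg_poly_def class_sum_sum class_sum_monom ..
  also have "\<dots> = int (card ({..<u} \<inter> {c. [expo u v y c = j] (mod m)}))"
    by (subst sum.If_cases) auto
  also have "{..<u} \<inter> {c. [expo u v y c = j] (mod m)} = {c. c < u \<and> [expo u v y c = j] (mod m)}"
    by auto
  finally show ?thesis using card_same_expo [OF nuv, of y j] by simp
qed

text \<open>A nonzero segment is multiplied by \<open>kappa\<close> and a monomial, then projected
  with d = m / q. The result keeps the divisor theta because theta already lies in Z[zeta_q], and
  its coordinates are class sums.\<close>

lemma size_bound:
  assumes nuv: "n = u * v" and uv: "coprime u v"
    and sc: "\<And>p. prime p \<Longrightarrow> p dvd u \<Longrightarrow> self_conjugate_prime p m"
    and q: "q = \<Prod>{p \<in> prime_factors u. odd p \<and> odd (multiplicity p u)}"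
    and N: "N = (\<Prod>p\<in>prime_factors u. p ^ (if odd p then multiplicity p u else 2 * (multiplicity p u div 2)))"
    and S: "S = {p. prime p \<and> p dvd lcm u h \<and> \<not> p dvd q}"
  shows "real N * real (totient q) \<le> (real q)\<^sup>2 * (real_of_int (2 ^ (card S - 1) * int (gcd u h)))\<^sup>2"
proof -
  have u: "u > 0" using n nuv by auto
  define M where "M = lcm u h"
  have "u dvd m" using n_dvd_m nuv by (meson dvd_trans dvd_triv_left)
  hence "M dvd m" unfolding M_def using h_dvd_m by (rule lcm_least)
  then obtain l where ml: "m = M * l" by (elim dvdE)
  have M0: "M > 0" using ml m_pos by (auto intro: Nat.gr0I)
  have "q dvd (\<Prod>p\<in>prime_factors u. p)"
    unfolding q by (intro prod_dvd_prod_subset) auto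
  moreover have "(\<Prod>p\<in>prime_factors u. p) dvd (\<Prod>p\<in>prime_factors u. p ^ multiplicity p u)"
    by (intro prod_dvd_prod dvd_power) (auto simp: prime_factors_multiplicity)
  moreover have "(\<Prod>p\<in>prime_factors u. p ^ multiplicity p u) = u"
    using u by (simp add: prime_factorization_nat [symmetric])
  ultimately have qu: "q dvd u" using dvd_trans by auto
  hence qM: "q dvd M" by (simp add: M_def)
  have "q dvd m" using qu \<open>u dvd m\<close> by (rule dvd_trans)
  then obtain d where d: "m = q * d" by (elim dvdE)
  have q0: "q > 0" and d0: "d > 0" using d m_pos by (auto intro: Nat.gr0I)
  define x where "x = z ^ d"
  have x: "prim_root x q" unfolding x_def using z by (rule prim_root_power_divisor) (simp add: d mult.commute)
  \<comment> \<open>Only primes dividing \<open>q\<close> contribute a root of unity to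
    \<open>root_ideal u\<close>.\<close>
  have prq: "prim_root (z ^ (m div p)) p \<and> z ^ (m div p) \<in> int_adjoin x"
    if p: "p \<in> prime_factors u" "odd p" "odd (multiplicity p u)" for p
  proof -
    have "p dvd q" unfolding q using p by (intro dvd_prodI [where f = "\<lambda>p. p", simplified]) auto
    then obtain e where e: "q = p * e" by (elim dvdE)
    have "p > 0" using p by (auto intro: Nat.gr0I)
    hence me: "m div p = d * e" unfolding d e by simp
    have "prim_root (z ^ (m div p)) p"
      by (rule prim_root_power_divisor [OF z]) (simp add: me d e)
    moreover have "z ^ (m div p) = x ^ e" by (simp add: me x_def power_mult)
    ultimately show ?thesis by auto
  qed
  have pr: "prime p" if "p \<in> prime_factors u" for p using that by auto
  have "half_power (z ^ (m div p)) p (multiplicity p u) \<in> int_adjoin x" if "p \<in> prime_factors u" for p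
    unfolding half_power_def using prq [OF that]
    by (intro int_adjoin_mult) (auto intro: int_adjoin_power [OF int_adjoin_diff])
  hence "root_ideal u \<in> int_adjoin x" unfolding root_ideal_def by (rule int_adjoin_prod)
  then obtain T where T: "root_ideal u = ev T x" by (rule int_adjoinE)
  have norm: "rdvd x (of_nat N) (root_ideal u * cnj (root_ideal u))"
    unfolding root_ideal_def N of_nat_prod cnj_prod prod.distrib [symmetric]
    by (intro rdvd_prod half_power_norm pr prq) auto
  obtain y where y: "y < v" "segment u v y \<noteq> 0" using segment_nonzero [OF nuv] by auto
  obtain t where t: "t \<in> int_adjoin z" "segment u v y = root_ideal u * t"
    using root_ideal_rdvd_segment [OF nuv uv y(1) sc] by (rule rdvdE)
  have finS: "finite S" by (rule finite_subset [of _ "{p. p dvd M}"]) (use S M0 in \<open>auto simp: M_def\<close>)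
  have suppS: "supported l (seg_poly u v y)" by (rule supported_seg_poly [OF ml]) (simp_all add: M_def)
  have "supported l (kappa m S)"
  proof (rule supported_kappa)
    fix p assume "p \<in> S"
    hence "p dvd M" "p > 0" using S by (auto simp: M_def prime_gt_0_nat)
    then obtain e where "M = p * e" by (elim dvdE)
    hence "m div p = e * l" using ml \<open>p > 0\<close> by simp
    thus "l dvd m div p" by simp
  qed
  hence supp: "supported l (kappa m S * seg_poly u v y)" using suppS by (rule supported_mult)
  have "ev (kappa m S) z \<noteq> 0"
    unfolding ev_kappa prod_zero_iff [OF finS]
  proof
    assume "\<exists>p\<in>S. 1 - z ^ (m div p) = 0"
    then obtain p where p: "p \<in> S" "z ^ (m div p) = 1" by auto
    hence "prime p" "p dvd M" using S by (auto simp: M_def)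
    have "p dvd m" using \<open>p dvd M\<close> \<open>M dvd m\<close> by (rule dvd_trans)
    have "m dvd m div p" using p prim_root_power_eq_1_iff [OF z] by blast
    moreover have "m div p > 0" using \<open>p dvd m\<close> m_pos by (metis div_greater_zero_iff dvd_imp_le dvd_0_left neq0_conv)
    ultimately have "m \<le> m div p" by (rule dvd_imp_le)
    moreover have "m div p < m" using m_pos prime_gt_1_nat [OF \<open>prime p\<close>] by (intro div_less_dividend)
    ultimately show False by simp
  qed
  hence "ev (kappa m S * seg_poly u v y) z \<noteq> 0" using y by (simp add: ev_seg_poly)
  \<comment> \<open>The shift must be found with \<open>kappa\<close> already present, as it is the
    projection of this product that has to be nonzero. It commutes with \<open>kappa\<close> and
    merely permutes class sums.\<close>
  then obtain g where g: "l dvd g" "ev (select d (Polynomial.monom 1 g * (kappa m S * seg_poly u v y))) z \<noteq> 0"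
    using select_nonzero [OF supp _ d0 prim_root_nonzero [OF z]] by auto
  define F where "F = Polynomial.monom 1 g * seg_poly u v y"
  define Y where "Y = ev (select d (kappa m S * F)) z"
  have Y0: "Y \<noteq> 0" using g(2) by (simp only: Y_def F_def mult.left_commute not_False_eq_True)
  have "rdvd x (ev T x) Y"
    unfolding Y_def x_def
  proof (rule rdvd_select [OF z d ml qM])
    show "supported l F" unfolding F_def by (intro supported_mult supported_monom g suppS)
    show "ev F z = ev T (z ^ d) * (z ^ g * t)"
      using t(2) T by (simp add: F_def ev_seg_poly x_def mult_ac)
    show "z ^ g * t \<in> int_adjoin z" using t by auto
  qed (simp add: S M_def)
  then obtain s where s: "s \<in> int_adjoin x" "Y = root_ideal u * s" unfolding T by (rule rdvdE)
  have "rdvd x (of_nat N) (root_ideal u * cnj (root_ideal u) * (s * cnj s))"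
    by (rule rdvd_mult_right [OF norm int_adjoin_mult [OF s(1) cnj_in_int_adjoin [OF x s(1)]]])
  hence dv: "rdvd x (of_nat N) (Y * cnj Y)" by (simp add: s(2) mult_ac)
  have Fb: "0 \<le> class_sum m F j \<and> class_sum m F j \<le> int (gcd u h)" for j
    unfolding F_def class_sum_monom_mult' [OF m_pos] by (rule class_sum_seg_poly [OF nuv])
  show ?thesis
  proof (rule divisibility_coefficient_bound [OF x _ Y0 _ _ dv])
    show "Y = (\<Sum>i<q. of_int (class_sum m (kappa m S * F) (d * i)) * x ^ i)"
      unfolding Y_def x_def by (rule ev_select_class_sum [OF z d])
    show "\<bar>class_sum m (kappa m S * F) (d * i)\<bar> \<le> 2 ^ (card S - 1) * int (gcd u h)" for i
      by (rule class_sum_kappa_bound [OF m_pos finS Fb])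
    show "N > 0" unfolding N by (intro prod_pos) (auto simp: prime_gt_0_nat intro: Nat.gr0I)
  qed
qed

end

section \<open>From matrices to sequences, and the final count of primes\<close>

text \<open>Invariance makes the row orthogonality a statement on periodic autocorrelations of the
  first row; expanding the squared modulus of a character sum by differences of indices gives
  \<open>flat\<close>.\<close>

lemma bh_matrix_sequence:
  assumes n: "n > 0" and H: "is_BH (integer_mod_group n) h H" and z: "prim_root z (lcm n h)"
  shows "bh_sequence n h (lcm n h) (\<lambda>x. H 0 (int (x mod n))) z"
proof -
  let ?G = "integer_mod_group n"
  define b where "b = (\<lambda>x. H 0 (int (x mod n)))"
  have car: "carrier ?G = {0..<int n}" using n by (simp add: carrier_integer_mod_group)
  have h: "h > 0" using H by (simp add: is_BH_def)
  have root: "H x y ^ h = 1" if "x \<in> {0..<int n}" "y \<in> {0..<int n}" for x y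
    using H that unfolding is_BH_def car by blast
  have inv: "H ((x + l) mod int n) ((y + l) mod int n) = H x y"
    if "x \<in> {0..<int n}" "y \<in> {0..<int n}" "l \<in> {0..<int n}" for x y l
    using H that unfolding is_BH_def car by simp
  have orth: "(\<Sum>l\<in>{0..<int n}. H x l * cnj (H y l)) = (if x = y then of_nat n else 0)"
    if "x \<in> {0..<int n}" "y \<in> {0..<int n}" for x y
    using H that unfolding is_BH_def car order_def by simp
  have per: "b (x + n) = b x" for x by (simp add: b_def)
  have auto: "(\<Sum>y<n. b (y + r) * cnj (b y)) = (if r = 0 then of_nat n else 0)" if r: "r < n" for r
  proof -
    \<comment> \<open>The row with index -r is the first row advanced by \<open>r\<close>.\<close>
    define x where "x = (- int r) mod int n"
    have x: "x \<in> {0..<int n}" using n by (simp add: x_def)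
    have x0: "x = 0 \<longleftrightarrow> r = 0"
    proof -
      have "x = 0 \<longleftrightarrow> int n dvd int r" unfolding x_def by (simp add: mod_eq_0_iff_dvd)
      also have "\<dots> \<longleftrightarrow> r = 0" using r by (auto dest: dvd_imp_le)
      finally show ?thesis .
    qed
    have "(\<Sum>y<n. b (y + r) * cnj (b y)) = (\<Sum>l\<in>{0..<int n}. H x l * cnj (H 0 l))"
    proof (rule sum.reindex_bij_witness [of _ nat int])
      fix y assume y: "y \<in> {..<n}"
      have "H x (int y) = H ((x + int r) mod int n) ((int y + int r) mod int n)"
        using inv [of x "int y" "int r"] x y r by simp
      also have "(x + int r) mod int n = 0" by (simp add: x_def mod_add_left_eq)
      also have "(int y + int r) mod int n = int ((y + r) mod n)" by (simp add: zmod_int)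
      finally show "H x (int y) * cnj (H 0 (int y)) = b (y + r) * cnj (b y)" using y by (simp add: b_def)
    qed auto
    thus ?thesis using orth [OF x, of 0] n x0 by simp
  qed
  have flat: "(\<Sum>x<n. b x * w ^ x) * cnj (\<Sum>x<n. b x * w ^ x) = of_nat n" if w: "w ^ n = 1" for w
  proof -
    have "cmod w ^ n = 1" using w by (metis norm_one norm_power)
    hence "cmod w = 1" using n power_eq_imp_eq_base [of "cmod w" n 1] by simp
    hence cw1: "w * cnj w = 1" by (simp add: complex_norm_square [symmetric])
    have cw: "w ^ k * cnj w ^ k = 1" for k using cw1 by (metis power_mult_distrib power_one)
    define f where "f = (\<lambda>x. b x * w ^ x)"
    have fper: "f (x + n) = f x" for x by (simp add: f_def per power_add w)
    have "(\<Sum>x<n. f x) * cnj (\<Sum>x<n. f x) = (\<Sum>y<n. (\<Sum>x<n. f x) * cnj (f y))"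
      by (simp add: sum_distrib_left)
    also have "\<dots> = (\<Sum>y<n. (\<Sum>r<n. f (y + r)) * cnj (f y))"
      using sum_periodic_shift [of f n] fper by simp
    also have "\<dots> = (\<Sum>y<n. \<Sum>r<n. w ^ r * (b (y + r) * cnj (b y)))"
      unfolding sum_distrib_right
    proof (intro sum.cong refl)
      fix y r
      have "f (y + r) * cnj (f y) = (w ^ y * cnj w ^ y) * (w ^ r * (b (y + r) * cnj (b y)))"
        by (simp add: f_def power_add mult_ac)
      thus "f (y + r) * cnj (f y) = w ^ r * (b (y + r) * cnj (b y))" by (simp add: cw)
    qed
    also have "\<dots> = (\<Sum>r<n. w ^ r * (\<Sum>y<n. b (y + r) * cnj (b y)))"
      by (subst sum.swap) (simp add: sum_distrib_left)
    also have "\<dots> = (\<Sum>r<n. if r = 0 then of_nat n else 0)" by (intro sum.cong refl) (simp add: auto)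
    also have "\<dots> = of_nat n" using n by simp
    finally show ?thesis by (simp add: f_def)
  qed
  have "bh_sequence n h (lcm n h) b z"
  proof
    show "b x ^ h = 1" for x unfolding b_def by (rule root) (use n in auto)
  qed (use n h z per flat in auto)
  thus ?thesis by (simp add: b_def)
qed

text \<open>As \<open>q\<close> is the odd part of \<open>k\<close>, one has \<open>N = w\<^sup>2 q\<close> for the integer \<open>N\<close> of \<open>size_bound\<close>.\<close>

lemma odd_square_free_part:
  fixes u w k :: nat
  assumes u: "u > 0" and k: "k = squarefree_part u" and uwk: "u = w ^ 2 * k"
  defines "q \<equiv> \<Prod>{p \<in> prime_factors u. odd p \<and> odd (multiplicity p u)}"
  defines "N \<equiv> (\<Prod>p\<in>prime_factors u. p ^ (if odd p then multiplicity p u else 2 * (multiplicity p u div 2)))"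
  shows "odd q" and "k = (if even k then 2 * q else q)" and "N = w\<^sup>2 * q"
proof -
  let ?Q = "{p \<in> prime_factors u. odd p \<and> odd (multiplicity p u)}"
  have u_eq: "(\<Prod>p\<in>prime_factors u. p ^ multiplicity p u) = u"
    using u by (simp add: prime_factorization_nat [symmetric])
  have K: "{p. prime p \<and> odd (multiplicity p u)} = {p \<in> prime_factors u. odd (multiplicity p u)}"
    using u by (auto simp: prime_factors_multiplicity intro: Nat.gr0I)
  have kK: "k = \<Prod>{p \<in> prime_factors u. odd (multiplicity p u)}"
    unfolding k squarefree_part_eq_prod_odd_primes [OF u] K ..
  show oq: "odd q" unfolding q_def by (subst even_prod_iff) auto
  have ev2: "p = 2" if "p \<in> prime_factors u" "even p" for p
    using that by (metis in_prime_factors_iff primes_dvd_imp_eq two_is_prime_nat)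
  show kq: "k = (if even k then 2 * q else q)" and "N = w\<^sup>2 * q"
  proof -
    have main: "k = (if even k then 2 * q else q) \<and> N = w\<^sup>2 * q"
    proof (cases "2 \<in> prime_factors u \<and> odd (multiplicity 2 u)")
      case False
      hence "p \<in> prime_factors u \<Longrightarrow> odd (multiplicity p u) \<Longrightarrow> odd p" for p using ev2 by blast
      hence "{p \<in> prime_factors u. odd (multiplicity p u)} = ?Q" by auto
      hence kq: "k = q" by (simp add: kK q_def)
      have "N = (\<Prod>p\<in>prime_factors u. p ^ multiplicity p u)"
        unfolding N_def
      proof (intro prod.cong refl)
        fix p assume p: "p \<in> prime_factors u"
        show "p ^ (if odd p then multiplicity p u else 2 * (multiplicity p u div 2)) = p ^ multiplicity p u"
          using False ev2 [OF p] p by auto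
      qed
      thus ?thesis using kq oq u_eq uwk by simp
    next
      case True
      have "{p \<in> prime_factors u. odd (multiplicity p u)} = insert 2 ?Q" using True ev2 by auto
      hence kq: "k = 2 * q" by (simp add: kK q_def)
      have fin: "finite (prime_factors u)" by simp
      have "N = 2 ^ (2 * (multiplicity 2 u div 2)) *
          (\<Prod>p\<in>prime_factors u - {2}. p ^ (if odd p then multiplicity p u else 2 * (multiplicity p u div 2)))"
        unfolding N_def using True by (subst prod.remove [OF fin, of 2]) auto
      also have "(\<Prod>p\<in>prime_factors u - {2}. p ^ (if odd p then multiplicity p u else 2 * (multiplicity p u div 2))) =
          (\<Prod>p\<in>prime_factors u - {2}. p ^ multiplicity p u)"
      proof (intro prod.cong refl)
        fix p assume p: "p \<in> prime_factors u - {2}"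
        hence "odd p" using ev2 by blast
        thus "p ^ (if odd p then multiplicity p u else 2 * (multiplicity p u div 2)) = p ^ multiplicity p u" by simp
      qed
      \<comment> \<open>The single factor 2 lost by rounding is the one that separates k = 2 q from
        q, so N = w^2 q holds here too.\<close>
      finally have "2 * N = 2 ^ Suc (2 * (multiplicity 2 u div 2)) * (\<Prod>p\<in>prime_factors u - {2}. p ^ multiplicity p u)"
        by simp
      also have "Suc (2 * (multiplicity 2 u div 2)) = multiplicity 2 u"
        using odd_two_times_div_two_succ [of "multiplicity 2 u"] True by simp
      also have "2 ^ multiplicity 2 u * (\<Prod>p\<in>prime_factors u - {2}. p ^ multiplicity p u) = u"
        using True u_eq by (subst (asm) prod.remove [OF fin, of 2]) auto
      also have "u = 2 * (w\<^sup>2 * q)" using uwk kq by simp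
      finally show ?thesis using kq by simp
    qed
    show "k = (if even k then 2 * q else q)" using main by blast
    show "N = w\<^sup>2 * q" using main by blast
  qed
qed

text \<open>Self-conjugacy depends only on the prime divisors, so a prime common to \<open>u\<close>
  and \<open>v\<close> would make \<open>u * p\<close> a larger candidate.\<close>

lemma largest_self_conjugate_divisor:
  assumes n: "n > 0" and u: "u = Max {d. d dvd n \<and> self_conjugate d m}"
  obtains v where "n = u * v" "coprime u v" "\<And>p. prime p \<Longrightarrow> p dvd u \<Longrightarrow> self_conjugate_prime p m"
proof -
  let ?D = "{d. d dvd n \<and> self_conjugate d m}"
  have fin: "finite ?D" by (rule finite_subset [of _ "{d. d dvd n}"]) (use n in auto)
  have "1 \<in> ?D" by (simp add: self_conjugate_def)
  hence uD: "u \<in> ?D" unfolding u using fin by (intro Max_in) auto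
  then obtain v where v: "n = u * v" by (auto elim: dvdE)
  have sc: "self_conjugate_prime p m" if "prime p" "p dvd u" for p
    using uD that by (auto simp: self_conjugate_def)
  have "coprime u v"
  proof (rule ccontr)
    assume "\<not> coprime u v"
    then obtain p where p: "prime p" "p dvd u" "p dvd v"
      using prime_factor_nat [of "gcd u v"] by (metis coprime_iff_gcd_eq_1 gcd_greatest_iff)
    have u0: "u > 0" using n v by auto
    have "self_conjugate (u * p) m"
      unfolding self_conjugate_def
    proof (intro conjI allI impI)
      show "u * p > 0" using u0 p by (simp add: prime_gt_0_nat)
      fix r assume "prime r \<and> r dvd u * p"
      hence "prime r" "r dvd u" using p dvd_trans by (auto simp: prime_dvd_mult_iff)
      thus "self_conjugate_prime r m" by (rule sc)
    qed
    moreover have "u * p dvd n" unfolding v using p by (intro mult_dvd_mono) auto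
    ultimately have "u * p \<le> u" unfolding u using fin by (intro Max_ge) (auto simp: u [symmetric])
    thus False using u0 prime_gt_1_nat [OF p(1)] by simp
  qed
  thus ?thesis using that v sc by blast
qed

theorem theorem3p7:
  fixes n h m u w k t r :: nat
  assumes "n > 0" and "h > 0"
    and "m = lcm n h"
    and "u = Max {d. d dvd n \<and> self_conjugate d m}"
    and "k = squarefree_part u"
    and "u = w ^ 2 * k"
    and "t = card {p. prime p \<and> p dvd h}"
    and "r = card {p. prime p \<and> p dvd k}"
    and "\<exists>H. is_BH (integer_mod_group n) h H"
  shows "(odd k \<longrightarrow>
            real w \<le> 2 powi (int t - int r - 1 + (if r = t then 1 else 0))
                       * real (gcd h u) * sqrt (real k / real (totient k)))
       \<and> (even k \<longrightarrow>
            real w \<le> 2 powi (int t - int r - 1)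
                       * real (gcd h u) * sqrt (2 * real k / real (totient k)))"
proof -
  obtain H where H: "is_BH (integer_mod_group n) h H" using assms(9) by blast
  have "m > 0" unfolding assms(3) using assms(1,2) by (rule lcm_pos_nat)
  then obtain z where z: "prim_root z m" by (rule exE [OF prim_root_exists])
  interpret bh_sequence n h m "\<lambda>x. H 0 (int (x mod n))" z
    using bh_matrix_sequence [OF assms(1) H z [unfolded assms(3)]] unfolding assms(3) .
  obtain v where nuv: "n = u * v" and uv: "coprime u v"
    and sc: "\<And>p. prime p \<Longrightarrow> p dvd u \<Longrightarrow> self_conjugate_prime p m"
    using largest_self_conjugate_divisor [OF assms(1,4)] by blast
  have u0: "u > 0" using nuv assms(1) by auto
  \<comment> \<open>This makes the primes of \<open>lcm u h\<close> those of \<open>h\<close>, so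
    that the cardinality of \<open>S\<close> is expressed by \<open>t\<close> and
    \<open>r\<close>.\<close>
  have ph: "p dvd h" if "prime p" "p dvd u" for p
    using self_conjugate_prime_dvd_h [OF sc [OF that]] that nuv by simp
  define q where "q = \<Prod>{p \<in> prime_factors u. odd p \<and> odd (multiplicity p u)}"
  define N where "N = (\<Prod>p\<in>prime_factors u. p ^ (if odd p then multiplicity p u else 2 * (multiplicity p u div 2)))"
  note kq = odd_square_free_part [OF u0 assms(5,6), folded q_def N_def]
  have q0: "q > 0" using kq(1) by (intro Nat.gr0I) auto
  have "k dvd u" using assms(6) by simp
  have "q dvd k" using kq(2) by (metis dvd_refl dvd_triv_right)
  define S where "S = {p. prime p \<and> p dvd lcm u h \<and> \<not> p dvd q}"
  define C where "C = gcd h u"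
  define B where "B = (2::real) ^ (card S - 1) * real C"
  let ?h = "{p. prime p \<and> p dvd h}" and ?k = "{p. prime p \<and> p dvd k}" and ?q = "{p. prime p \<and> p dvd q}"
  have finh: "finite ?h" by (rule finite_subset [of _ "{p. p dvd h}"]) (use assms(2) in auto)
  have kh: "?k \<subseteq> ?h" using ph \<open>k dvd u\<close> dvd_trans by blast
  have qk: "?q \<subseteq> ?k" using \<open>q dvd k\<close> dvd_trans by blast
  have rt: "r \<le> t" unfolding assms(7,8) by (rule card_mono [OF finh kh])
  have "p dvd lcm u h \<longleftrightarrow> p dvd h" if "prime p" for p
  proof
    assume "p dvd lcm u h"
    moreover have "lcm u h dvd u * h" by (simp add: lcm_least)
    ultimately have "p dvd u * h" by (rule dvd_trans)
    thus "p dvd h" using that ph by (auto simp: prime_dvd_mult_iff)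
  qed (simp add: dvd_lcmI2)
  hence S_eq: "S = ?h - ?q" unfolding S_def by auto
  have cardS: "card S = t - card ?q"
    unfolding S_eq assms(7) using finh qk kh by (intro card_Diff_subset finite_subset [OF _ finh]) auto
  have phi: "totient q > 0" using q0 by simp
  have B0: "B \<ge> 0" by (simp add: B_def)
  have "real N * real (totient q) \<le> (real q)\<^sup>2 * B\<^sup>2"
    using size_bound [OF nuv uv sc q_def N_def S_def] by (simp add: B_def C_def gcd.commute)
  hence "real q * ((real w)\<^sup>2 * real (totient q)) \<le> real q * (real q * B\<^sup>2)"
    unfolding kq(3) by (simp add: power2_eq_square mult_ac)
  hence "(real w)\<^sup>2 * real (totient q) \<le> real q * B\<^sup>2" using q0 by simp
  hence "(real w)\<^sup>2 \<le> B\<^sup>2 * (real q / real (totient q))" using phi by (simp add: field_simps)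
  hence "sqrt ((real w)\<^sup>2) \<le> sqrt (B\<^sup>2 * (real q / real (totient q)))" by (rule real_sqrt_le_mono)
  hence bound: "real w \<le> B * sqrt (real q / real (totient q))"
    by (simp only: real_sqrt_mult real_sqrt_abs abs_of_nonneg [OF B0] abs_of_nat)
  show ?thesis
  proof (intro conjI impI)
    assume "odd k"
    hence k: "k = q" using kq(2) by simp
    hence "card S = t - r" using cardS assms(8) by simp
    \<comment> \<open>If r = t then \<open>S\<close> is empty and the truncated
      \<open>card S - 1\<close> is 0, which is what the delta term yields.\<close>
    hence "2 powi (int t - int r - 1 + (if r = t then 1 else 0)) = (2::real) ^ (card S - 1)"
    proof (cases "r = t")
      case False
      hence "int t - int r - 1 = int (card S - 1)" using rt \<open>card S = t - r\<close> by linarith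
      thus ?thesis using False by simp
    qed simp
    thus "real w \<le> 2 powi (int t - int r - 1 + (if r = t then 1 else 0))
        * real (gcd h u) * sqrt (real k / real (totient k))"
      using bound by (simp add: B_def C_def k)
  next
    assume "even k"
    hence k: "k = 2 * q" using kq(2) by simp
    have "?k = insert 2 ?q"
      unfolding k by (auto simp: prime_dvd_mult_iff dest: primes_dvd_imp_eq [OF _ two_is_prime_nat])
    moreover have "finite ?q" using qk kh finite_subset [OF _ finh] by blast
    moreover have "2 \<notin> ?q" using kq(1) by simp
    ultimately have "r = Suc (card ?q)" using assms(8) by simp
    hence "card S - 1 = t - r" using cardS rt by simp
    hence B: "B = 2 ^ (t - r) * real C" by (simp add: B_def)
    have "coprime 2 q" using kq(1) by simp
    hence "totient k = totient q" unfolding k by (simp add: totient_mult_coprime)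
    \<comment> \<open>The prime 2 lies in \<open>S\<close>, so B has the exponent t - r, one more
      than claimed; the factor 2 drawn from the square root makes up for it.\<close>
    hence "2 * real k / real (totient k) = 2\<^sup>2 * (real q / real (totient q))" by (simp add: k)
    hence sq: "sqrt (2 * real k / real (totient k)) = 2 * sqrt (real q / real (totient q))"
      by (simp only: real_sqrt_mult real_sqrt_abs abs_numeral)
    have "(2::real) ^ (t - r) = 2 powi (int t - int r)"
      using rt by (simp flip: power_int_of_nat add: of_nat_diff)
    also have "\<dots> = 2 powi (int t - int r - 1) * 2"
      using power_int_add_1 [of "2::real" "int t - int r - 1"] by simp
    finally show "real w \<le> 2 powi (int t - int r - 1)
        * real (gcd h u) * sqrt (2 * real k / real (totient k))"
      using bound unfolding sq B C_def by (simp add: mult_ac)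
  qed
qed

end
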